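(* Let $s\in(1/2,1)$ and let $\psi$ be an approximating function. Let $I$ be an interval, $f\in C^{(3)}(I)$, and $\mathcal{C}_f=\{(x,f(x)):x\in I\}$. Assume that $\dim\{x\in I:f''(x)=0\}\le 1/2$. Then $$\mathcal{H}^s(\mathcal{C}_f\cap\mathcal{S}(\psi))=0\quad\text{whenever}\quad\sum_{t=1}^\infty t^{1-s}\psi(t)^{s+1}<\infty.$$
   Context: An approximating function is a real, positive, decreasing function $\psi:\mathbb{R}^+\to\mathbb{R}^+$ with $\psi(t)\to0$ as $t\to\infty$. $\mathcal{S}(\psi)$ is the set of $\mathbf y=(y_1,y_2)\in\mathbb{R}^2$ for which there are infinitely many $q\in\mathbb{N}$ with $\max_{1\le i\le2}\|qy_i\|<\psi(q)$, where $\|x\|$ is the distance to the nearest integer. $\mathcal{H}^s$ denotes $s$-dimensional Hausdorff measure and $\dim$ denotes Hausdorff dimension. *)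

theory Defs
  imports "HOL-Analysis.Analysis"
begin

section \<open>Hausdorff measure and dimension\<close>

(* diam(U)^s with the usual conventions diam(U)^0 = 1 for nonempty U and diam({})^s = 0; the case
   s = 0 is separate because 0 powr 0 = 0.  Meaningful for bounded U only (diameter is unspecified
   otherwise). *)
definition hausdorff_gauge :: "real \<Rightarrow> 'a::metric_space set \<Rightarrow> ennreal" where
  "hausdorff_gauge s U =
     (if U = {} then 0 else if s = 0 then 1 else ennreal (diameter U powr s))"

(* Covers are sequences; finite covers are included, since the U i may be empty. *)
definition hausdorff_premeasure :: "real \<Rightarrow> real \<Rightarrow> 'a::metric_space set \<Rightarrow> ennreal" where
  "hausdorff_premeasure s \<delta> E =
     (INF U \<in> {U :: nat \<Rightarrow> 'a set. E \<subseteq> (\<Union>i. U i) \<and> (\<forall>i. bounded (U i) \<and> diameter (U i) \<le> \<delta>)}.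
        (\<Sum>i. hausdorff_gauge s (U i)))"

definition hausdorff_measure :: "real \<Rightarrow> 'a::metric_space set \<Rightarrow> ennreal" where
  "hausdorff_measure s E = (SUP \<delta> \<in> {0<..}. hausdorff_premeasure s \<delta> E)"

definition hausdorff_dim :: "'a::metric_space set \<Rightarrow> ennreal" where
  "hausdorff_dim E = Inf {ennreal s | s. 0 \<le> s \<and> hausdorff_measure s E = 0}"


section \<open>Functions of class C(k) on an interval\<close>

(* The j-th derivative relative to I, hence one-sided at endpoints belonging to I. *)
definition deriv_within :: "real set \<Rightarrow> nat \<Rightarrow> (real \<Rightarrow> real) \<Rightarrow> real \<Rightarrow> real" where
  "deriv_within I j f = ((\<lambda>g x. vector_derivative g (at x within I)) ^^ j) f"

definition C_k_on :: "nat \<Rightarrow> real set \<Rightarrow> (real \<Rightarrow> real) \<Rightarrow> bool" where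
  "C_k_on k I f \<longleftrightarrow>
     (\<forall>j<k. deriv_within I j f differentiable_on I) \<and> continuous_on I (deriv_within I k f)"


section \<open>Simultaneous approximation and planar curves\<close>

(* The domain is (0, \<infinity>); values of \<psi> elsewhere are irrelevant.
   Decreasing means non-increasing. *)
definition approximating_function :: "(real \<Rightarrow> real) \<Rightarrow> bool" where
  "approximating_function \<psi> \<longleftrightarrow>
     (\<forall>t>0. \<psi> t > 0) \<and> antimono_on {0<..} \<psi> \<and> (\<psi> \<longlongrightarrow> 0) at_top"

definition dist_nearest_int :: "real \<Rightarrow> real" where
  "dist_nearest_int x = infdist x \<int>"

definition simul_approximable :: "(real \<Rightarrow> real) \<Rightarrow> (real \<times> real) set" where
  "simul_approximable \<psi> =
     {(y1, y2). infinite {q::nat. 0 < q \<and>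
        max (dist_nearest_int (real q * y1)) (dist_nearest_int (real q * y2)) < \<psi> (real q)}}"

definition graph_curve :: "real set \<Rightarrow> (real \<Rightarrow> real) \<Rightarrow> (real \<times> real) set" where
  "graph_curve I f = {(x, f x) | x. x \<in> I}"

end

theory Submission
  imports Defs
begin

text \<open>
  The heart of the matter is that a strictly convex arc has \<open>O(d Q^3)\<close> rational points of
  denominator at most \<open>Q\<close> within vertical distance \<open>d\<close>, as soon as \<open>d \<ge> Q^(\<eta> - 2)\<close>. With this
  count, the balls of radius about \<open>\<psi>(2^k) / 2^k\<close> around the rational points of denominator about
  \<open>2^k\<close> near the curve form a limsup cover whose \<open>s\<close>-dimensional sums are the dyadic form of the given
  series; values \<open>\<psi>(q) < q^(\<eta> - 1)\<close> may be increased to \<open>q^(\<eta> - 1)\<close>, since \<open>s > 1/2\<close> keeps the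
  series convergent for small \<open>\<eta>\<close>. The zeros of \<open>f''\<close> contribute a Lipschitz image of an
  \<open>H^s\<close>-null set.

  The count is by strong induction on \<open>Q\<close>, simultaneously for all functions whose second derivative
  lies (in the Lipschitz sense) between \<open>1/A\<close> and \<open>A\<close>, a class closed under the Legendre transform
  \<open>f*\<close>. Three rational points on an arc of length about \<open>1 / (d Q^3)\<close> are collinear, because twice
  the area of their triangle is a multiple of the inverse product of their denominators. Arcs with few
  points are harmless. Arcs with at least \<open>M\<close> points lie on rational lines \<open>y = U x - W\<close> whose common
  denominator \<open>v\<close> is smaller than \<open>Q\<close> by a factor \<open>M\<close>. Such a line carries
  \<open>O(d Q^2 / (v \<surd>e))\<close> points, where \<open>e\<close> is the distance of the dual point \<open>(U, W)\<close> from the graph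
  of \<open>f*\<close>, raised to \<open>d\<close> if it is smaller. The dual points are rational points of small denominator
  near the graph of \<open>f*\<close>, so the induction hypothesis counts them, dyadically in \<open>v\<close> and \<open>e\<close>; the
  power of \<open>M\<close> that is gained closes the induction.
\<close>

section \<open>Uniformly convex functions and duality\<close>

text \<open>The functions of the class live on the whole line, so that every slope is attained and
  the dual function is again defined everywhere. The bounds concern increments of \<open>g\<close>,
  because these pass to the inverse function of \<open>g\<close>, which is the derivative of the
  dual. The constant \<open>A\<close> survives exactly, so one constant can serve the whole class at
  every stage of the induction. One passage to the dual costs a factor depending only on
  \<open>A\<close> and \<epsilon>. The exponents of the bound are displaced by \<epsilon> from the
  critical ones: this makes the dyadic sums geometric and leaves a gain M^-\<epsilon>, which beats
  that factor once M is large. Two kinds of points escape the dual count and are counted directly: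
  points sharing their abscissa, which no line y = U x - W can join, and points on lines much
  steeper than the arc, whose dual points do not lie over a bounded interval.\<close>

definition uniformly_convex :: "real \<Rightarrow> (real \<Rightarrow> real) \<Rightarrow> (real \<Rightarrow> real) \<Rightarrow> bool" where
  "uniformly_convex A f g \<longleftrightarrow> A \<ge> 1 \<and> (\<forall>x. (f has_real_derivative g x) (at x)) \<and>
     (\<forall>x y. x \<le> y \<longrightarrow> (y - x) / A \<le> g y - g x \<and> g y - g x \<le> A * (y - x))"

lemma nonneg_by_derivative_sign:
  fixes F G :: "real \<Rightarrow> real"
  assumes der: "\<And>t. (F has_real_derivative G t) (at t)"
    and "F x = 0" and pos: "\<And>t. x \<le> t \<Longrightarrow> 0 \<le> G t" and neg: "\<And>t. t \<le> x \<Longrightarrow> G t \<le> 0"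
  shows "0 \<le> F y"
proof (cases "x \<le> y")
  case True
  then have "F x \<le> F y"
    using der pos by (intro DERIV_nonneg_imp_nondecreasing[of x y F]) auto
  with \<open>F x = 0\<close> show ?thesis by simp
next
  case False
  then have "F x \<le> F y"
    using der neg by (intro DERIV_nonpos_imp_nonincreasing[of y x F]) auto
  with \<open>F x = 0\<close> show ?thesis by simp
qed

text \<open>Stands in for Taylor's formula with 1/A \<le> f'' \<le> A, since \<open>g\<close> need
  not be differentiable: the difference of the two sides vanishes at \<open>x\<close>, and its
  derivative in \<open>y\<close> changes sign there by the bounds on the increments of
  \<open>g\<close>.\<close>

lemma uniformly_convex_taylor:
  assumes "uniformly_convex A f g"
  shows "(y - x)\<^sup>2 / (2 * A) \<le> f y - f x - g x * (y - x)"
    and "f y - f x - g x * (y - x) \<le> A * (y - x)\<^sup>2 / 2"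
proof -
  have A: "A \<ge> 1" and der: "\<And>x. (f has_real_derivative g x) (at x)"
    and mono: "\<And>x y. x \<le> y \<Longrightarrow> (y - x) / A \<le> g y - g x \<and> g y - g x \<le> A * (y - x)"
    using assms unfolding uniformly_convex_def by auto
  have "0 \<le> (\<lambda>t. f t - f x - g x * (t - x) - (t - x)\<^sup>2 / (2 * A)) y"
  proof (rule nonneg_by_derivative_sign[where x = x and G = "\<lambda>t. g t - g x - (t - x) / A"
        and F = "\<lambda>t. f t - f x - g x * (t - x) - (t - x)\<^sup>2 / (2 * A)"])
    fix t
    show "((\<lambda>t. f t - f x - g x * (t - x) - (t - x)\<^sup>2 / (2 * A))
        has_real_derivative g t - g x - (t - x) / A) (at t)"
      using A by (auto intro!: derivative_eq_intros der simp: field_simps)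
  next
    fix t assume "x \<le> t"
    from mono[OF this] show "0 \<le> g t - g x - (t - x) / A" by simp
  next
    fix t assume "t \<le> x"
    from mono[OF this] show "g t - g x - (t - x) / A \<le> 0"
      using A by (simp add: diff_divide_distrib)
  qed simp
  then show "(y - x)\<^sup>2 / (2 * A) \<le> f y - f x - g x * (y - x)" by simp
  have "0 \<le> (\<lambda>t. A * (t - x)\<^sup>2 / 2 - (f t - f x - g x * (t - x))) y"
  proof (rule nonneg_by_derivative_sign[where x = x and G = "\<lambda>t. A * (t - x) - (g t - g x)"
        and F = "\<lambda>t. A * (t - x)\<^sup>2 / 2 - (f t - f x - g x * (t - x))"])
    fix t
    show "((\<lambda>t. A * (t - x)\<^sup>2 / 2 - (f t - f x - g x * (t - x)))
        has_real_derivative A * (t - x) - (g t - g x)) (at t)"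
      by (auto intro!: derivative_eq_intros der)
  next
    fix t assume "x \<le> t"
    from mono[OF this] show "0 \<le> A * (t - x) - (g t - g x)" by simp
  next
    fix t assume "t \<le> x"
    from mono[OF this] show "A * (t - x) - (g t - g x) \<le> 0"
      by (simp add: algebra_simps)
  qed simp
  then show "f y - f x - g x * (y - x) \<le> A * (y - x)\<^sup>2 / 2" by simp
qed

text \<open>Serves to differentiate the Legendre transform \<open>u * h u - f (h u)\<close>:
  \<open>h\<close> is only known to be Lipschitz, so the product and chain rules do not apply, but
  the linearisation error can be bounded quadratically.\<close>

lemma has_real_derivative_if_quadratic_error:
  fixes F :: "real \<Rightarrow> real"
  assumes "\<And>y. \<bar>F y - F x - D * (y - x)\<bar> \<le> C * (y - x)\<^sup>2"
  shows "(F has_real_derivative D) (at x)"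
proof -
  have bd: "\<bar>(F (x + h) - F x) / h - D\<bar> \<le> C * \<bar>h\<bar>" if "h \<noteq> 0" for h
  proof -
    have "\<bar>F (x + h) - F x - D * h\<bar> \<le> C * h\<^sup>2" using assms[of "x + h"] by simp
    then have "\<bar>F (x + h) - F x - D * h\<bar> / \<bar>h\<bar> \<le> C * h\<^sup>2 / \<bar>h\<bar>"
      by (rule divide_right_mono) simp
    moreover have "\<bar>F (x + h) - F x - D * h\<bar> / \<bar>h\<bar> = \<bar>(F (x + h) - F x) / h - D\<bar>"
      using that by (simp add: abs_divide[symmetric] diff_divide_distrib)
    moreover have "h\<^sup>2 / \<bar>h\<bar> = \<bar>h\<bar>"
      using that by (metis abs_eq_0 nonzero_mult_div_cancel_left power2_abs power2_eq_square)
    ultimately show ?thesis by (metis times_divide_eq_right)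
  qed
  have "((\<lambda>h. (F (x + h) - F x) / h - D) \<longlongrightarrow> 0) (at 0)"
  proof (rule Lim_null_comparison)
    show "\<forall>\<^sub>F h in at 0. norm ((F (x + h) - F x) / h - D) \<le> C * \<bar>h\<bar>"
      using bd by (auto simp: eventually_at intro!: exI[of _ 1])
    show "((\<lambda>h. C * \<bar>h\<bar>) \<longlongrightarrow> 0) (at (0::real))"
      by (auto intro!: tendsto_eq_intros)
  qed
  then show ?thesis
    unfolding DERIV_def by (rule LIM_zero_cancel)
qed

text \<open>\<open>h\<close> is the inverse of \<open>g\<close>, and
  \<open>u * h u - f (h u)\<close> is the Legendre transform of \<open>f\<close>. Increment bounds
  with the constants 1/A and A are symmetric under inversion, so the dual belongs to the class with
  the same \<open>A\<close>.\<close>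

lemma uniformly_convex_dual:
  assumes uc: "uniformly_convex A f g"
  obtains h where "\<And>u. g (h u) = u" and "\<And>x. h (g x) = x"
    and "uniformly_convex A (\<lambda>u. u * h u - f (h u)) h"
proof -
  have A: "A \<ge> 1" and der: "\<And>x. (f has_real_derivative g x) (at x)"
    and mono: "\<And>x y. x \<le> y \<Longrightarrow> (y - x) / A \<le> g y - g x \<and> g y - g x \<le> A * (y - x)"
    using assms unfolding uniformly_convex_def by auto
  have cont: "continuous_on S g" for S
  proof (rule lipschitz_on_continuous_on[of A], rule lipschitz_onI)
    fix x y :: real
    show "dist (g x) (g y) \<le> A * dist x y"
    proof (cases "x \<le> y")
      case True
      then have "0 \<le> (y - x) / A" using A by simp
      with mono[OF True] True show ?thesis by (simp add: dist_real_def abs_if)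
    next
      case False
      then have "0 \<le> (x - y) / A" using A by simp
      with mono[of y x] False show ?thesis by (simp add: dist_real_def abs_if)
    qed
  qed (use A in simp)
  have smono: "strict_mono g"
  proof (rule strict_monoI)
    fix x y :: real assume "x < y"
    then have "0 < (y - x) / A" using A by simp
    with mono[of x y] \<open>x < y\<close> show "g x < g y" by simp
  qed
  have ex: "\<exists>x. g x = u" for u
  proof -
    define t where "t = A * \<bar>u - g 0\<bar>"
    have t: "0 \<le> t" "t / A = \<bar>u - g 0\<bar>" using A by (auto simp: t_def)
    have "g (- t) \<le> u" 
    proof -
      have "\<bar>u - g 0\<bar> \<le> g 0 - g (- t)" using mono[of "- t" 0] t by simp
      then show ?thesis by linarith
    qed
    moreover have "u \<le> g t"
    proof -
      have "\<bar>u - g 0\<bar> \<le> g t - g 0" using mono[of 0 t] t by simp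
      then show ?thesis by linarith
    qed
    ultimately show ?thesis using IVT'[of g "- t" u t] t cont by auto
  qed
  define h where "h u = (SOME x. g x = u)" for u
  have gh: "g (h u) = u" for u unfolding h_def using someI_ex[OF ex] .
  have hg: "h (g x) = x" for x using gh[of "g x"] strict_mono_eq[OF smono] by blast
  have hlip: "(v - u) / A \<le> h v - h u \<and> h v - h u \<le> A * (v - u)" if "u \<le> v" for u v
  proof -
    have le: "h u \<le> h v" using that strict_mono_less_eq[OF smono, of "h u" "h v"] gh by simp
    from mono[OF le] show ?thesis using A by (simp add: gh field_simps)
  qed
  have habs: "(h v - h u)\<^sup>2 \<le> A\<^sup>2 * (v - u)\<^sup>2" for u v
  proof -
    have "\<bar>h v - h u\<bar> \<le> A * \<bar>v - u\<bar>"
    proof (cases "u \<le> v")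
      case True
      then have "0 \<le> (v - u) / A" using A by simp
      with hlip[OF True] True show ?thesis by (simp add: abs_if)
    next
      case False
      then have "0 \<le> (u - v) / A" using A by simp
      with hlip[of v u] False show ?thesis by (simp add: abs_if)
    qed
    then have "\<bar>h v - h u\<bar>\<^sup>2 \<le> (A * \<bar>v - u\<bar>)\<^sup>2" by (rule power_mono) simp
    then show ?thesis by (simp add: power_mult_distrib)
  qed
  have dder: "((\<lambda>u. u * h u - f (h u)) has_real_derivative h u) (at u)" for u
  proof (rule has_real_derivative_if_quadratic_error[where C = "A ^ 3 / 2"])
    fix v
    \<comment> \<open>The linearisation error of the dual at \<open>u\<close> is a linearisation
      error of \<open>f\<close> at \<open>h v\<close>, so the Taylor bound for \<open>f\<close>
      applies to it.\<close>
    have eq: "v * h v - f (h v) - (u * h u - f (h u)) - h u * (v - u)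
        = f (h u) - f (h v) - g (h v) * (h u - h v)"
      by (simp add: gh algebra_simps)
    have "0 \<le> (h u - h v)\<^sup>2 / (2 * A)" using A by simp
    with uniformly_convex_taylor[OF uc, where x = "h v" and y = "h u"]
    have "\<bar>v * h v - f (h v) - (u * h u - f (h u)) - h u * (v - u)\<bar> \<le> A * (h u - h v)\<^sup>2 / 2"
      unfolding eq by linarith
    also have "\<dots> \<le> A * (A\<^sup>2 * (v - u)\<^sup>2) / 2"
      using A habs[of u v] by (simp add: power2_commute)
    also have "\<dots> = A ^ 3 / 2 * (v - u)\<^sup>2" by (simp add: power3_eq_cube power2_eq_square)
    finally show "\<bar>v * h v - f (h v) - (u * h u - f (h u)) - h u * (v - u)\<bar> \<le> A ^ 3 / 2 * (v - u)\<^sup>2" .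
  qed
  show thesis
    by (rule that[of h]) (use gh hg hlip dder A in \<open>auto simp: uniformly_convex_def\<close>)
qed

section \<open>Rational points near a graph\<close>

definition rational_points :: "nat \<Rightarrow> (real \<times> real) set" where
  "rational_points Q = {(x, y). \<exists>q\<in>{1..Q}. real q * x \<in> \<int> \<and> real q * y \<in> \<int>}"

text \<open>Junk value unless both numbers are rational.\<close>
definition common_den :: "real \<Rightarrow> real \<Rightarrow> nat" where
  "common_den x y = (LEAST q. 0 < q \<and> real q * x \<in> \<int> \<and> real q * y \<in> \<int>)"

text \<open>The elements are points of the plane, so a fraction written with several denominators
  counts once. The base point \<open>z\<close> is free because the bounds are uniform in it; windows
  can thus be shifted and longer intervals covered.\<close>

definition near_points :: "(real \<Rightarrow> real) \<Rightarrow> nat \<Rightarrow> real \<Rightarrow> real \<Rightarrow> (real \<times> real) set" where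
  "near_points f Q d z = {(x, y) \<in> rational_points Q. z \<le> x \<and> x \<le> z + 1 \<and> \<bar>y - f x\<bar> \<le> d}"

lemma common_den_props:
  assumes "0 < q" "real q * x \<in> \<int>" "real q * y \<in> \<int>"
  shows "0 < common_den x y" "real (common_den x y) * x \<in> \<int>" "real (common_den x y) * y \<in> \<int>"
    and "common_den x y \<le> q"
proof -
  let ?P = "\<lambda>q. 0 < q \<and> real q * x \<in> \<int> \<and> real q * y \<in> \<int>"
  have "?P q" using assms by simp
  then have "?P (LEAST q. ?P q)" by (rule LeastI)
  then show "0 < common_den x y" "real (common_den x y) * x \<in> \<int>" "real (common_den x y) * y \<in> \<int>"
    unfolding common_den_def by auto
  show "common_den x y \<le> q" unfolding common_den_def using assms by (intro Least_le) simp
qed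

text \<open>Meant for integers \<open>n\<close> that arise as cleared differences of coordinates of
  two rational points. Their sign is not controlled, hence the absolute value.\<close>

lemma common_den_le_abs:
  assumes n: "n \<in> \<int>" "n \<noteq> 0" and "n * x \<in> \<int>" "n * y \<in> \<int>"
  shows "real (common_den x y) \<le> \<bar>n\<bar>" "(x, y) \<in> rational_points (common_den x y)"
proof -
  from n(1) obtain k where k: "n = of_int k" by (auto elim: Ints_cases)
  define q where "q = nat \<bar>k\<bar>"
  have q: "0 < q" "real q = \<bar>n\<bar>" using n(2) k by (auto simp: q_def)
  have "real q * t \<in> \<int>" if "n * t \<in> \<int>" for t
    using that q(2) by (cases "n \<ge> 0") (auto simp: abs_if minus_mult_left[symmetric] simp del: minus_mult_left)
  then have m: "real q * x \<in> \<int>" "real q * y \<in> \<int>" using assms by auto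
  show "real (common_den x y) \<le> \<bar>n\<bar>" using common_den_props(4)[OF q(1) m] q(2) by simp
  show "(x, y) \<in> rational_points (common_den x y)"
    using common_den_props[OF q(1) m] unfolding rational_points_def by (auto intro!: bexI[of _ "common_den x y"])
qed

section \<open>Elementary counting of integers, spaced sets and rational points\<close>

lemma card_int_interval:
  fixes a b :: real
  shows "finite {n::int. a \<le> of_int n \<and> of_int n \<le> b}"
    and "a \<le> b + 1 \<Longrightarrow> real (card {n::int. a \<le> of_int n \<and> of_int n \<le> b}) \<le> b - a + 1"
proof -
  have eq: "{n::int. a \<le> of_int n \<and> of_int n \<le> b} = {\<lceil>a\<rceil>..\<lfloor>b\<rfloor>}"
    by (auto simp: ceiling_le_iff le_floor_iff)
  show "finite {n::int. a \<le> of_int n \<and> of_int n \<le> b}" unfolding eq by simp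
  assume "a \<le> b + 1"
  then show "real (card {n::int. a \<le> of_int n \<and> of_int n \<le> b}) \<le> b - a + 1"
    unfolding eq card_atLeastAtMost_int by (cases "\<lfloor>b\<rfloor> - \<lceil>a\<rceil> + 1 \<ge> 0") (simp, linarith, simp)
qed

lemma card_spaced_le:
  fixes S :: "real set"
  assumes \<delta>: "0 < \<delta>" and S: "\<And>x y. x \<in> S \<Longrightarrow> y \<in> S \<Longrightarrow> x \<noteq> y \<Longrightarrow> \<delta> \<le> \<bar>x - y\<bar>"
    and diam: "\<And>x y. x \<in> S \<Longrightarrow> y \<in> S \<Longrightarrow> \<bar>x - y\<bar> \<le> l" and "0 \<le> l"
  shows "finite S" "real (card S) \<le> l / \<delta> + 1"
proof -
  have "finite S \<and> real (card S) \<le> l / \<delta> + 1"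
  proof (cases "S = {}")
    case True
    then show ?thesis using assms by simp
  next
    case False
    have bb: "bdd_below S"
      using False diam by (meson abs_le_D1 bdd_belowI diff_le_eq le_diff_eq ex_in_conv abs_le_D2
        abs_diff_le_iff)
    define m where "m = Inf S"
    have m1: "m \<le> x" if "x \<in> S" for x unfolding m_def using bb that by (rule cInf_lower[rotated])
    have m2: "x \<le> m + l" if "x \<in> S" for x
    proof -
      have "x - l \<le> m" unfolding m_def
        by (rule cInf_greatest[OF False]) (use diam[OF that] in force)
      then show ?thesis by simp
    qed
    define F where "F x = \<lfloor>(x - m) / \<delta>\<rfloor>" for x
    have inj: "inj_on F S"
    proof (rule inj_onI)
      fix x y assume xy: "x \<in> S" "y \<in> S" "F x = F y"
      have "\<bar>(x - m) / \<delta> - (y - m) / \<delta>\<bar> < 1"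
        using xy(3) unfolding F_def by linarith
      then have "\<bar>(x - y) / \<delta>\<bar> < 1" by (simp add: diff_divide_distrib)
      then have "\<bar>x - y\<bar> < \<delta>" using \<delta> by (simp add: abs_divide)
      with S[OF xy(1,2)] show "x = y" by fastforce
    qed
    let ?T = "{n::int. 0 \<le> real_of_int n \<and> of_int n \<le> l / \<delta>}"
    have sub: "F ` S \<subseteq> ?T"
    proof
      fix n assume "n \<in> F ` S"
      then obtain x where x: "x \<in> S" "n = F x" by auto
      have "(x - m) / \<delta> \<le> l / \<delta>" using m2[OF x(1)] \<delta> by (simp add: divide_right_mono)
      moreover have "0 \<le> (x - m) / \<delta>" using m1[OF x(1)] \<delta> by simp
      ultimately show "n \<in> ?T" using x(2) unfolding F_def by (auto intro: order_trans[OF of_int_floor_le])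
    qed
    have fin: "finite S" using sub inj card_int_interval(1) finite_subset finite_imageD by blast
    have "0 \<le> l / \<delta>" using \<delta> \<open>0 \<le> l\<close> by simp
    then have "real (card ?T) \<le> l / \<delta> + 1" using card_int_interval(2)[of 0 "l / \<delta>"] by simp
    moreover have "card S \<le> card ?T"
      using card_mono[OF card_int_interval(1) sub] card_image[OF inj] by simp
    ultimately show ?thesis using fin by linarith
  qed
  then show "finite S" "real (card S) \<le> l / \<delta> + 1" by auto
qed

text \<open>Counts the triples (q, p, r) of a denominator and two numerators, with p in an interval
  of length q and r in one of length 2 d q. The \<open>+ 1\<close> for r costs a term of order Q^2,
  which dominates d Q^3 when d is much smaller than 1/Q.\<close>

lemma near_points_trivial_bound:
  assumes "0 \<le> d"
  shows "finite (near_points f Q d z)"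
    and "real (card (near_points f Q d z)) \<le> (\<Sum>q=1..Q. (real q + 1) * (2 * d * real q + 1))"
proof -
  define B where "B q p = {r::int. real q * (f (of_int p / real q) - d) \<le> of_int r \<and> of_int r \<le> real q * (f (of_int p / real q) + d)}" for q :: nat and p :: int
  define P where "P q = {p::int. real q * z \<le> of_int p \<and> of_int p \<le> real q * (z + 1)}" for q :: nat
  define S where "S = (SIGMA q:{1..Q}. SIGMA p:P q. B q p)"
  have finB: "finite (B q p)" and finP: "finite (P q)" for q p
    unfolding B_def P_def by (rule card_int_interval)+
  have finS: "finite S" unfolding S_def using finB finP by auto
  have sub: "near_points f Q d z \<subseteq> (\<lambda>(q, p, r). (of_int p / real q, of_int r / real q)) ` S"
  proof
    fix t assume "t \<in> near_points f Q d z"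
    then obtain x y q where t: "t = (x, y)" "q \<in> {1..Q}" "real q * x \<in> \<int>" "real q * y \<in> \<int>"
      "z \<le> x" "x \<le> z + 1" "\<bar>y - f x\<bar> \<le> d"
      unfolding near_points_def rational_points_def by auto
    then obtain p r where pr: "real q * x = of_int p" "real q * y = of_int r"
      by (auto elim!: Ints_cases)
    have q: "0 < real q" using t(2) by simp
    have xy: "x = of_int p / real q" "y = of_int r / real q" using pr q by (auto simp: field_simps)
    have "p \<in> P q" unfolding P_def using t(5,6) q pr[symmetric] by auto
    moreover have "r \<in> B q p"
    proof -
      have "f x - d \<le> y" "y \<le> f x + d" using t(7) by linarith+
      then have "real q * (f x - d) \<le> real q * y" "real q * y \<le> real q * (f x + d)" using q by simp_all
      then show ?thesis unfolding B_def using xy(1) pr(2) by auto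
    qed
    ultimately have "(q, p, r) \<in> S" unfolding S_def using t(2) by auto
    then show "t \<in> (\<lambda>(q, p, r). (of_int p / real q, of_int r / real q)) ` S"
      using t(1) xy by force
  qed
  then show "finite (near_points f Q d z)" using finS finite_surj by blast
  have "real (card (near_points f Q d z)) \<le> real (card S)"
    using surj_card_le[OF finS sub] by simp
  also have "\<dots> = (\<Sum>q=1..Q. \<Sum>p\<in>P q. real (card (B q p)))"
    unfolding S_def using finB finP by (subst card_SigmaI) auto
  also have "\<dots> \<le> (\<Sum>q=1..Q. \<Sum>p\<in>P q. 2 * d * real q + 1)"
  proof (intro sum_mono)
    fix q p
    have "real q * (f (of_int p / real q) - d) \<le> real q * (f (of_int p / real q) + d) + 1"
      using assms mult_left_mono[of "f (of_int p / real q) - d" "f (of_int p / real q) + d" "real q"] by simp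
    from card_int_interval(2)[OF this] show "real (card (B q p)) \<le> 2 * d * real q + 1"
      unfolding B_def by (simp add: algebra_simps)
  qed
  also have "\<dots> \<le> (\<Sum>q=1..Q. (real q + 1) * (2 * d * real q + 1))"
  proof (intro sum_mono)
    fix q :: nat
    have "real (card (P q)) \<le> real q + 1"
      unfolding P_def using card_int_interval(2)[of "real q * z" "real q * (z + 1)"] by (simp add: algebra_simps)
    then show "(\<Sum>p\<in>P q. 2 * d * real q + 1) \<le> (real q + 1) * (2 * d * real q + 1)"
      using assms by (simp add: mult_right_mono)
  qed
  finally show "real (card (near_points f Q d z)) \<le> (\<Sum>q=1..Q. (real q + 1) * (2 * d * real q + 1))" .
qed

text \<open>For d \<ge> 1/Q the trivial count already has the right order, which leaves only d Q < 1
  to the induction.\<close>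

lemma near_points_bound_large:
  assumes "1 \<le> d * real Q"
  shows "real (card (near_points f Q d z)) \<le> 6 * d * real Q ^ 3"
proof -
  have Q: "0 < Q" using assms by (cases Q) auto
  have d: "0 < d" using assms Q
    by (smt (verit) mult_nonpos_nonneg of_nat_0_le_iff)
  have "real (card (near_points f Q d z)) \<le> (\<Sum>q=1..Q. (real q + 1) * (2 * d * real q + 1))"
    using near_points_trivial_bound(2)[of d] d by simp
  also have "\<dots> \<le> (\<Sum>q=1..Q. (2 * real Q) * (3 * d * real Q))"
  proof (intro sum_mono mult_mono)
    fix q assume q: "q \<in> {1..Q}"
    have "d * real q \<le> d * real Q" using q d by simp
    with assms show "2 * d * real q + 1 \<le> 3 * d * real Q" by (simp add: algebra_simps)
  qed (use d in auto)
  also have "\<dots> = 6 * d * real Q ^ 3" by (simp add: power3_eq_cube)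
  finally show ?thesis .
qed

lemma near_points_mono: "d \<le> d' \<Longrightarrow> Q \<le> Q' \<Longrightarrow> near_points f Q d z \<subseteq> near_points f Q' d' z"
  unfolding near_points_def rational_points_def by fastforce

section \<open>Arithmetic of two or three rational points\<close>

lemma rational_points_mult:
  assumes "(x, y) \<in> rational_points Q" "(x', y') \<in> rational_points Q"
  obtains n where "n \<in> \<int>" "0 < n" "n \<le> (real Q)\<^sup>2" "n * (x' - x) \<in> \<int>" "n * (y' - y) \<in> \<int>" "n * (x * y' - y * x') \<in> \<int>"
proof -
  from assms obtain q q' where q: "q \<in> {1..Q}" "real q * x \<in> \<int>" "real q * y \<in> \<int>"
    and q': "q' \<in> {1..Q}" "real q' * x' \<in> \<int>" "real q' * y' \<in> \<int>"
    unfolding rational_points_def by auto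
  show thesis
  proof (rule that[of "real q * real q'"])
    show "real q * real q' \<le> (real Q)\<^sup>2" using q(1) q'(1) unfolding power2_eq_square by (intro mult_mono) auto
    have "real q * real q' * (x' - x) = real q * (real q' * x') - real q' * (real q * x)" by (simp add: algebra_simps)
    then show "real q * real q' * (x' - x) \<in> \<int>" using q q' by (simp add: Ints_mult)
    have "real q * real q' * (y' - y) = real q * (real q' * y') - real q' * (real q * y)" by (simp add: algebra_simps)
    then show "real q * real q' * (y' - y) \<in> \<int>" using q q' by (simp add: Ints_mult)
    have "real q * real q' * (x * y' - y * x') = (real q * x) * (real q' * y') - (real q * y) * (real q' * x')" by (simp add: algebra_simps)
    then show "real q * real q' * (x * y' - y * x') \<in> \<int>" using q q' by (simp add: Ints_mult)
  qed (use q q' in auto)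
qed

text \<open>With n = q q', the integers n (x' - x), n (y' - y) and n (x y' - y x') are proportional
  to 1, U and W. Hence n (x' - x) clears the denominators of the line, and its common denominator v
  is at most Q^2 |x' - x|: a line of large denominator carries only widely spaced points.\<close>

lemma spacing_on_line:
  assumes "(x, y) \<in> rational_points Q" "(x', y') \<in> rational_points Q" "x \<noteq> x'"
    and line: "y = U * x - W" "y' = U * x' - W"
  shows "real (common_den U W) / (real Q)\<^sup>2 \<le> \<bar>x - x'\<bar>" "(U, W) \<in> rational_points (common_den U W)"
proof -
  obtain n where n: "n \<in> \<int>" "0 < n" "n \<le> (real Q)\<^sup>2" "n * (x' - x) \<in> \<int>" "n * (y' - y) \<in> \<int>"
    "n * (x * y' - y * x') \<in> \<int>"
    by (rule rational_points_mult[OF assms(1,2)])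
  have "n * (x' - x) * U = n * (y' - y)" "n * (x' - x) * W = n * (x * y' - y * x')"
    unfolding line by (simp_all add: algebra_simps)
  then have *: "n * (x' - x) * U \<in> \<int>" "n * (x' - x) * W \<in> \<int>" using n(5,6) by metis+
  have nz: "n * (x' - x) \<noteq> 0" using n assms(3) by auto
  note cd = common_den_le_abs[OF n(4) nz *]
  have "real (common_den U W) \<le> \<bar>x - x'\<bar> * (real Q)\<^sup>2"
  proof -
    have "\<bar>n * (x' - x)\<bar> = \<bar>x - x'\<bar> * n" using n(2) by (simp add: abs_mult abs_minus_commute)
    also have "\<dots> \<le> \<bar>x - x'\<bar> * (real Q)\<^sup>2" using n(3) by (intro mult_left_mono) auto
    finally show ?thesis using cd(1) by linarith
  qed
  moreover have "0 < (real Q)\<^sup>2" using n(2,3) by linarith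
  ultimately show "real (common_den U W) / (real Q)\<^sup>2 \<le> \<bar>x - x'\<bar>" by (simp add: divide_le_eq)
  show "(U, W) \<in> rational_points (common_den U W)" by (rule cd(2))
qed

text \<open>The analogue for the vertical line through \<open>x\<close>, where n (y' - y) clears the
  denominator; \<open>common_den x 0\<close> is the denominator of \<open>x\<close> alone.\<close>

lemma spacing_on_fibre:
  assumes "(x, y) \<in> rational_points Q" "(x, y') \<in> rational_points Q" "y \<noteq> y'"
  shows "real (common_den x 0) / (real Q)\<^sup>2 \<le> \<bar>y - y'\<bar>" "(x, 0) \<in> rational_points (common_den x 0)"
proof -
  obtain n where n: "n \<in> \<int>" "0 < n" "n \<le> (real Q)\<^sup>2" "n * (x - x) \<in> \<int>" "n * (y' - y) \<in> \<int>"
    "n * (x * y' - y * x) \<in> \<int>"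
    by (rule rational_points_mult[OF assms(1,2)])
  have "n * (y' - y) * x = n * (x * y' - y * x)" by (simp add: algebra_simps)
  then have *: "n * (y' - y) * x \<in> \<int>" "n * (y' - y) * 0 \<in> \<int>" using n(6) by (metis, simp)
  have nz: "n * (y' - y) \<noteq> 0" using n assms(3) by auto
  note cd = common_den_le_abs[OF n(5) nz *]
  have "real (common_den x 0) \<le> \<bar>y - y'\<bar> * (real Q)\<^sup>2"
  proof -
    have "\<bar>n * (y' - y)\<bar> = \<bar>y - y'\<bar> * n" using n(2) by (simp add: abs_mult abs_minus_commute)
    also have "\<dots> \<le> \<bar>y - y'\<bar> * (real Q)\<^sup>2" using n(3) by (intro mult_left_mono) auto
    finally show ?thesis using cd(1) by linarith
  qed
  moreover have "0 < (real Q)\<^sup>2" using n(2,3) by linarith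
  ultimately show "real (common_den x 0) / (real Q)\<^sup>2 \<le> \<bar>y - y'\<bar>" by (simp add: divide_le_eq)
  show "(x, 0) \<in> rational_points (common_den x 0)" by (rule cd(2))
qed

lemma collinear_if_small_determinant:
  assumes "(x1, y1) \<in> rational_points Q" "(x2, y2) \<in> rational_points Q" "(x3, y3) \<in> rational_points Q"
    and small: "\<bar>(x2 - x1) * (y3 - y1) - (x3 - x1) * (y2 - y1)\<bar> * real Q ^ 3 < 1"
  shows "(x2 - x1) * (y3 - y1) = (x3 - x1) * (y2 - y1)"
proof -
  define D where "D = (x2 - x1) * (y3 - y1) - (x3 - x1) * (y2 - y1)"
  from assms obtain a b c where a: "a \<in> {1..Q}" "real a * x1 \<in> \<int>" "real a * y1 \<in> \<int>"
    and b: "b \<in> {1..Q}" "real b * x2 \<in> \<int>" "real b * y2 \<in> \<int>"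
    and c: "c \<in> {1..Q}" "real c * x3 \<in> \<int>" "real c * y3 \<in> \<int>"
    unfolding rational_points_def by auto
  \<comment> \<open>The product a b c D is the determinant of the integer rows (a, a x1, a y1), (b,
    b x2, b y2), (c, c x3, c y3), expanded along its first column.\<close>
  have "real a * real b * real c * D =
      real a * ((real b * x2) * (real c * y3) - (real c * x3) * (real b * y2))
    + real b * ((real c * x3) * (real a * y1) - (real a * x1) * (real c * y3))
    + real c * ((real a * x1) * (real b * y2) - (real b * x2) * (real a * y1))"
    unfolding D_def by (simp add: algebra_simps)
  moreover have "\<dots> \<in> \<int>"
    by (intro Ints_add Ints_mult Ints_diff Ints_of_nat a b c)
  ultimately have int: "real a * real b * real c * D \<in> \<int>" by simp
  have "real a * real b * real c \<le> real Q * real Q * real Q"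
    using a(1) b(1) c(1) by (intro mult_mono) auto
  then have "\<bar>real a * real b * real c * D\<bar> \<le> \<bar>D\<bar> * real Q ^ 3"
    unfolding abs_mult by (simp add: power3_eq_cube mult_right_mono mult.commute[of _ "\<bar>D\<bar>"] mult_left_mono)
  with small have "\<bar>real a * real b * real c * D\<bar> < 1" unfolding D_def by linarith
  with int have "real a * real b * real c * D = 0" using Ints_nonzero_abs_less1 by blast
  with a(1) b(1) c(1) show ?thesis unfolding D_def by auto
qed

section \<open>Reduction to points on rational lines\<close>

text \<open>Subtracting the tangent at \<open>a\<close> leaves the determinant unchanged and puts
  the three points into a box of width L and height \<open>w\<close>, so the determinant is at most
  2 L w. Multiplied by Q^3, this is 4 L d Q^3 + A (L Q)^3. The first term is small by the choice of
  L, and so is the second, because d Q^2 \<ge> 1 gives L Q \<le> L d Q^3.\<close>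

lemma arc_collinear:
  assumes uc: "uniformly_convex A f g" and d: "0 < d" "1 \<le> d * (real Q)\<^sup>2"
    and L: "L * ((8 * A + 8) * d * real Q ^ 3) = 1"
    and p: "(x1, y1) \<in> near_points f Q d z" "(x2, y2) \<in> near_points f Q d z" "(x3, y3) \<in> near_points f Q d z"
    and arc: "x1 \<in> {a..a+L}" "x2 \<in> {a..a+L}" "x3 \<in> {a..a+L}"
  shows "(x2 - x1) * (y3 - y1) = (x3 - x1) * (y2 - y1)"
proof (rule collinear_if_small_determinant[of _ _ Q])
  show "(x1, y1) \<in> rational_points Q" "(x2, y2) \<in> rational_points Q" "(x3, y3) \<in> rational_points Q"
    using p unfolding near_points_def by auto
  have A: "A \<ge> 1" using uc unfolding uniformly_convex_def by simp
  have Q: "0 < real Q" using d by (cases "Q = 0") auto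
  have L0: "0 < L"
  proof (rule ccontr)
    assume "\<not> 0 < L"
    then have "L * ((8 * A + 8) * d * real Q ^ 3) \<le> 0"
      using A d Q by (intro mult_nonpos_nonneg) auto
    with L show False by simp
  qed
  define c where "c = L * d * real Q ^ 3"
  have c: "0 < c" "c * (8 * A + 8) = 1" using L0 d Q L by (auto simp: c_def algebra_simps)
  have c16: "c \<le> 1 / 16" and Ac: "A * c \<le> 1 / 8"
  proof -
    have "c * 16 \<le> c * (8 * A + 8)" using A c(1) by (intro mult_left_mono) auto
    then show "c \<le> 1 / 16" using c(2) by simp
    have "c * (8 * A) \<le> c * (8 * A + 8)" using c(1) by (intro mult_left_mono) auto
    then show "A * c \<le> 1 / 8" using c(2) by (simp add: algebra_simps)
  qed
  define w where "w = A * L\<^sup>2 / 2 + 2 * d"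
  define t where "t x y = y - f a - g a * (x - a)" for x y
  have t: "- d \<le> t x y \<and> t x y \<le> A * L\<^sup>2 / 2 + d"
    if "(x, y) \<in> near_points f Q d z" "x \<in> {a..a+L}" for x y
  proof -
    have "\<bar>y - f x\<bar> \<le> d" using that unfolding near_points_def by simp
    moreover have "0 \<le> (x - a)\<^sup>2 / (2 * A)" using A by simp
    moreover have "A * (x - a)\<^sup>2 / 2 \<le> A * L\<^sup>2 / 2"
      using A that(2) by (auto intro!: mult_left_mono power_mono)
    ultimately show ?thesis
      using uniformly_convex_taylor[OF uc, where x = a and y = x] unfolding t_def by linarith
  qed
  have det: "\<bar>(x2 - x1) * (y3 - y1) - (x3 - x1) * (y2 - y1)\<bar> \<le> 2 * L * w"
  proof -
    have eq: "(x2 - x1) * (y3 - y1) - (x3 - x1) * (y2 - y1)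
      = (x2 - x1) * (t x3 y3 - t x1 y1) - (x3 - x1) * (t x2 y2 - t x1 y1)"
      unfolding t_def by (simp add: algebra_simps)
    have "\<bar>(x2 - x1) * (t x3 y3 - t x1 y1)\<bar> \<le> L * w"
      unfolding abs_mult by (rule mult_mono) (use arc L0 t[OF p(1) arc(1)] t[OF p(3) arc(3)] in \<open>auto simp: w_def abs_le_iff\<close>)
    moreover have "\<bar>(x3 - x1) * (t x2 y2 - t x1 y1)\<bar> \<le> L * w"
      unfolding abs_mult by (rule mult_mono) (use arc L0 t[OF p(1) arc(1)] t[OF p(2) arc(2)] in \<open>auto simp: w_def abs_le_iff\<close>)
    ultimately show ?thesis unfolding eq by linarith
  qed
  have cube: "L ^ 3 * real Q ^ 3 \<le> c ^ 3"
  proof -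
    have "1 \<le> (d * (real Q)\<^sup>2) ^ 3" using d by simp
    then have "L ^ 3 * real Q ^ 3 * 1 \<le> L ^ 3 * real Q ^ 3 * (d * (real Q)\<^sup>2) ^ 3"
      using L0 by (intro mult_left_mono) auto
    also have "\<dots> = c ^ 3" unfolding c_def by (simp add: power_mult_distrib flip: power_mult power_add)
    finally show ?thesis by simp
  qed
  have "2 * L * w * real Q ^ 3 = A * (L ^ 3 * real Q ^ 3) + 4 * c"
    unfolding w_def c_def by (simp add: algebra_simps power3_eq_cube power2_eq_square)
  also have "\<dots> \<le> A * c ^ 3 + 4 * c" using cube A by simp
  also have "A * c ^ 3 \<le> A * c * 1"
  proof -
    have "c * c \<le> 1" using c16 c(1) by (intro mult_le_one) auto
    then have "A * c * (c * c) \<le> A * c * 1" using A c(1) by (intro mult_left_mono) auto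
    then show ?thesis by (simp add: power3_eq_cube mult.assoc)
  qed
  finally have "2 * L * w * real Q ^ 3 < 1" using c16 Ac by linarith
  moreover have "\<bar>(x2 - x1) * (y3 - y1) - (x3 - x1) * (y2 - y1)\<bar> * real Q ^ 3 \<le> 2 * L * w * real Q ^ 3"
    using det by (intro mult_right_mono) auto
  ultimately show "\<bar>(x2 - x1) * (y3 - y1) - (x3 - x1) * (y2 - y1)\<bar> * real Q ^ 3 < 1" by linarith
qed

text \<open>The vertical gap between two points of a fibre is at most 2 d, so by spacing the
  abscissa has a denominator b \<le> 2 d Q^2. There are at most 2 b such abscissae in the window,
  each with O(d Q^2 / b) points above it, and summing over b gives the bound. It is harmless for d Q
  \<le> 1, being then at most a multiple of d Q^3.\<close>

lemma card_multiple_fibres: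
  assumes d: "0 < d" and P: "P = near_points f Q d z"
  shows "real (card {p \<in> P. \<exists>p'\<in>P. p' \<noteq> p \<and> fst p' = fst p}) \<le> 16 * d\<^sup>2 * real Q ^ 4"
proof -
  define V where "V = {p \<in> P. \<exists>p'\<in>P. p' \<noteq> p \<and> fst p' = fst p}"
  define B where "B = nat \<lfloor>2 * d * (real Q)\<^sup>2\<rfloor>"
  define N where "N b = {a::int. real b * z \<le> of_int a \<and> of_int a \<le> real b * (z + 1)}" for b :: nat
  define F where "F b a = {p \<in> P. fst p = of_int a / real b \<and> common_den (fst p) 0 = b}" for b :: nat and a :: int
  have B: "real B \<le> 2 * d * (real Q)\<^sup>2" unfolding B_def using d by simp
  have finP: "finite P" using near_points_trivial_bound(1)[of d] d P by simp
  have sub: "V \<subseteq> (\<Union>b\<in>{1..B}. \<Union>a\<in>N b. F b a)"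
  proof
    fix p assume "p \<in> V"
    then obtain x y y' where p: "p = (x, y)" "(x, y) \<in> P" "(x, y') \<in> P" "y \<noteq> y'"
      unfolding V_def by (cases p) (auto, metis)
    then have m: "(x, y) \<in> rational_points Q" "(x, y') \<in> rational_points Q" "z \<le> x" "x \<le> z + 1"
      "\<bar>y - f x\<bar> \<le> d" "\<bar>y' - f x\<bar> \<le> d" unfolding P near_points_def by auto
    define b where "b = common_den x 0"
    note sp = spacing_on_fibre[OF m(1,2) p(4), folded b_def]
    have Q: "0 < (real Q)\<^sup>2" using m(1) unfolding rational_points_def by auto
    have "real b / (real Q)\<^sup>2 \<le> 2 * d" using sp(1) m(5,6) by linarith
    then have "real b \<le> 2 * d * (real Q)\<^sup>2" using Q by (simp add: divide_le_eq)
    then have "b \<le> B" unfolding B_def by (simp add: le_nat_floor)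
    moreover obtain q where q: "0 < q" "real q * x \<in> \<int>" "real q * 0 \<in> \<int>"
      using sp(2) unfolding rational_points_def by (auto simp: Suc_le_eq)
    note cd = common_den_props[OF q, folded b_def]
    obtain a where a: "real b * x = of_int a" using cd(2) by (auto elim: Ints_cases)
    have "a \<in> N b" unfolding N_def using m(3,4) cd(1) by (auto simp flip: a)
    moreover have "p \<in> F b a" unfolding F_def using p a cd(1) by (auto simp: b_def[symmetric] field_simps)
    ultimately show "p \<in> (\<Union>b\<in>{1..B}. \<Union>a\<in>N b. F b a)" using cd(1) by (intro UN_I[of b]) auto
  qed
  have finF: "finite (F b a)" for b a unfolding F_def using finP by simp
  have finN: "finite (N b)" for b unfolding N_def by (rule card_int_interval)
  have cF: "real (card (F b a)) \<le> 4 * d * (real Q)\<^sup>2 / real b" if b: "b \<in> {1..B}" for a b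
  proof -
    have Q: "0 < (real Q)\<^sup>2" using b B by (cases "Q = 0") auto
    have inj: "inj_on snd (F b a)" unfolding F_def by (auto simp: inj_on_def prod_eq_iff)
    have "real (card (snd ` F b a)) \<le> (2 * d) / (real b / (real Q)\<^sup>2) + 1"
    proof (rule card_spaced_le)
      show "0 < real b / (real Q)\<^sup>2" using b Q by simp
      fix y y' assume "y \<in> snd ` F b a" "y' \<in> snd ` F b a"
      then obtain x where x: "(x, y) \<in> P" "(x, y') \<in> P" "common_den x 0 = b"
        unfolding F_def by auto
      then show "\<bar>y - y'\<bar> \<le> 2 * d" unfolding P near_points_def by auto
      assume "y \<noteq> y'"
      with x show "real b / (real Q)\<^sup>2 \<le> \<bar>y - y'\<bar>"
        using spacing_on_fibre(1)[of x y Q y'] unfolding P near_points_def by auto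
    qed (use d in simp)
    also have "\<dots> \<le> 4 * d * (real Q)\<^sup>2 / real b"
    proof -
      have "real b \<le> 2 * d * (real Q)\<^sup>2" using b B by auto
      then have "1 \<le> 2 * d * (real Q)\<^sup>2 / real b" using b by (simp add: le_divide_eq)
      moreover have "4 * d * (real Q)\<^sup>2 / real b = 2 * (2 * d * (real Q)\<^sup>2 / real b)" by simp
      moreover have "2 * d / (real b / (real Q)\<^sup>2) = 2 * d * (real Q)\<^sup>2 / real b" by simp
      ultimately show ?thesis by linarith
    qed
    finally show ?thesis using card_image[OF inj] by simp
  qed
  have "real (card V) \<le> (\<Sum>b\<in>{1..B}. \<Sum>a\<in>N b. real (card (F b a)))"
  proof -
    have "card V \<le> card (\<Union>b\<in>{1..B}. \<Union>a\<in>N b. F b a)"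
      using finF finN by (intro card_mono sub) auto
    also have "\<dots> \<le> (\<Sum>b\<in>{1..B}. card (\<Union>a\<in>N b. F b a))" by (rule card_UN_le) simp
    also have "\<dots> \<le> (\<Sum>b\<in>{1..B}. \<Sum>a\<in>N b. card (F b a))" by (intro sum_mono card_UN_le finN)
    finally have "real (card V) \<le> real (\<Sum>b\<in>{1..B}. \<Sum>a\<in>N b. card (F b a))" by (simp only: of_nat_le_iff)
    then show ?thesis by simp
  qed
  also have "\<dots> \<le> (\<Sum>b\<in>{1..B}. \<Sum>a\<in>N b. 4 * d * (real Q)\<^sup>2 / real b)"
    by (intro sum_mono cF)
  also have "\<dots> \<le> (\<Sum>b\<in>{1..B}. 8 * d * (real Q)\<^sup>2)"
  proof (intro sum_mono)
    fix b assume b: "b \<in> {1..B}"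
    have "real (card (N b)) \<le> real b + 1"
      unfolding N_def using card_int_interval(2)[of "real b * z" "real b * (z + 1)"] by (simp add: algebra_simps)
    also have "\<dots> \<le> 2 * real b" using b by simp
    finally have "real (card (N b)) * (4 * d * (real Q)\<^sup>2 / real b) \<le> 2 * real b * (4 * d * (real Q)\<^sup>2 / real b)"
      using d by (intro mult_right_mono) auto
    also have "\<dots> = 8 * d * (real Q)\<^sup>2" using b by simp
    finally show "(\<Sum>a\<in>N b. 4 * d * (real Q)\<^sup>2 / real b) \<le> 8 * d * (real Q)\<^sup>2" by simp
  qed
  also have "\<dots> = real B * (8 * d * (real Q)\<^sup>2)" by simp
  also have "\<dots> \<le> 2 * d * (real Q)\<^sup>2 * (8 * d * (real Q)\<^sup>2)"
    using B d by (intro mult_right_mono) auto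
  also have "\<dots> = 16 * d\<^sup>2 * real Q ^ 4" by (simp add: power2_eq_square power4_eq_xxxx)
  finally show ?thesis unfolding V_def .
qed

lemma card_sparse_classes_le:
  fixes \<kappa> :: "'a \<Rightarrow> int"
  assumes "finite P" "\<kappa> ` P \<subseteq> T" "finite T"
  shows "card {p \<in> P. card {p' \<in> P. \<kappa> p' = \<kappa> p} \<le> M} \<le> card T * M"
proof -
  define S where "S = {p \<in> P. card {p' \<in> P. \<kappa> p' = \<kappa> p} \<le> M}"
  have "S \<subseteq> (\<Union>k\<in>T. {p \<in> S. \<kappa> p = k})" using assms unfolding S_def by auto
  then have "card S \<le> card (\<Union>k\<in>T. {p \<in> S. \<kappa> p = k})"
    using assms by (intro card_mono) (auto simp: S_def)
  also have "\<dots> \<le> (\<Sum>k\<in>T. card {p \<in> S. \<kappa> p = k})" by (rule card_UN_le) fact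
  also have "\<dots> \<le> (\<Sum>k\<in>T. M)"
  proof (rule sum_mono)
    fix k
    show "card {p \<in> S. \<kappa> p = k} \<le> M"
    proof (cases "\<exists>p. p \<in> S \<and> \<kappa> p = k")
      case True
      then obtain p where p: "p \<in> S" "\<kappa> p = k" by auto
      have "card {p \<in> S. \<kappa> p = k} \<le> card {p' \<in> P. \<kappa> p' = \<kappa> p}"
        using assms(1) p by (intro card_mono) (auto simp: S_def)
      also have "\<dots> \<le> M" using p unfolding S_def by auto
      finally show ?thesis .
    next
      case False
      then have "{p \<in> S. \<kappa> p = k} = {}" by blast
      then show ?thesis by (simp only: card.empty)
    qed
  qed
  finally show ?thesis unfolding S_def by simp
qed

text \<open>The pair \<open>(U, W)\<close> stands for the line \<open>y = U x - W\<close>, i.e. for the dual point of that line.\<close>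
definition on_line :: "(real \<times> real) set \<Rightarrow> real \<times> real \<Rightarrow> (real \<times> real) set" where
  "on_line P l = {p \<in> P. snd p = fst l * fst p - snd l}"

text \<open>The first condition expresses that both coordinates are rational, as
  \<open>common_den\<close> is junk otherwise. Three points are demanded, not two, because the
  points of a line will be counted separately on two sides by X + 1 each: 3 \<le> 2 (X + 1) still
  bounds X below, so that the \<open>+ 1\<close> can be absorbed.\<close>

definition rich_lines :: "(real \<times> real) set \<Rightarrow> real \<Rightarrow> (real \<times> real) set" where
  "rich_lines P V = {l. l \<in> rational_points (common_den (fst l) (snd l)) \<and>
     real (common_den (fst l) (snd l)) \<le> V \<and> 3 \<le> card (on_line P l)}"

lemma finite_rich_lines:
  assumes "finite P"
  shows "finite (rich_lines P V)"
proof (rule finite_subset)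
  let ?F = "\<lambda>((x, y), (x', y')). let U = (y' - y) / (x' - x) in (U, U * x - y)"
  show "finite (?F ` (P \<times> P))" using assms by simp
  show "rich_lines P V \<subseteq> ?F ` (P \<times> P)"
  proof
    fix l :: "real \<times> real" assume l: "l \<in> rich_lines P V"
    obtain U W where UW: "l = (U, W)" by (cases l)
    have "card (on_line P l) \<ge> 3" using l unfolding rich_lines_def by auto
    then have "\<not> on_line P l \<subseteq> {p}" for p using card_mono[of "{p}" "on_line P l"] by auto
    then obtain p q where pq: "p \<in> on_line P l" "q \<in> on_line P l" "p \<noteq> q"
      by (metis insertCI subsetI)
    obtain x y x' y' where xy: "p = (x, y)" "q = (x', y')" by (cases p, cases q)
    have e: "y = U * x - W" "y' = U * x' - W" "(x, y) \<in> P" "(x', y') \<in> P"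
      using pq xy UW unfolding on_line_def by auto
    then have "x \<noteq> x'" using pq(3) xy by auto
    then have U: "(y' - y) / (x' - x) = U" using e by (simp add: field_simps)
    have "?F ((x, y), (x', y')) = (U, U * x - y)" by (simp only: prod.case Let_def U)
    then have "l = ?F ((x, y), (x', y'))" using e(1) UW by simp
    then show "l \<in> ?F ` (P \<times> P)" using e by blast
  qed
qed

text \<open>The window is cut into about 1/L arcs of length L. The three terms come from arcs with
  at most M points, from multiple fibres, and from the remaining arcs, whose points are collinear.
  More than M points within length L and with gaps at least v/Q^2 force v \<le> L Q^2 / M.\<close>

lemma line_decomposition:
  assumes uc: "uniformly_convex A f g" and d: "0 < d" "1 \<le> d * (real Q)\<^sup>2"
    and L: "L * ((8 * A + 8) * d * real Q ^ 3) = 1" and M: "2 \<le> M"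
    and P: "P = near_points f Q d z"
  shows "real (card P) \<le> real M * ((8 * A + 8) * d * real Q ^ 3 + 1) + 16 * d\<^sup>2 * real Q ^ 4
    + (\<Sum>l\<in>rich_lines P (L * (real Q)\<^sup>2 / real M). real (card (on_line P l)))"
proof -
  have A: "A \<ge> 1" using uc unfolding uniformly_convex_def by simp
  have Q: "0 < real Q" using d by (cases "Q = 0") auto
  have L1: "1 / L = (8 * A + 8) * d * real Q ^ 3" using L by (metis divide_eq_eq mult.commute mult_zero_left one_neq_zero)
  have "0 < (8 * A + 8) * d * real Q ^ 3" using A d Q by simp
  then have L0: "0 < L" using L1 by (metis zero_less_divide_1_iff)
  define R where "R = rich_lines P (L * (real Q)\<^sup>2 / real M)"
  have finP: "finite P" using near_points_trivial_bound(1)[of d] d P by simp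
  have finR: "finite R" unfolding R_def by (rule finite_rich_lines[OF finP])
  define \<kappa> where "\<kappa> p = \<lfloor>(fst p - z) / L\<rfloor>" for p :: "real \<times> real"
  define T where "T = {n::int. 0 \<le> real_of_int n \<and> of_int n \<le> 1 / L}"
  have T: "finite T" "real (card T) \<le> 1 / L + 1"
    unfolding T_def using card_int_interval(1)[of 0 "1 / L"] card_int_interval(2)[of 0 "1 / L"] L0
    by (auto simp: add_nonneg_nonneg)
  have \<kappa>T: "\<kappa> ` P \<subseteq> T"
  proof
    fix n assume "n \<in> \<kappa> ` P"
    then obtain x y where x: "n = \<lfloor>(x - z) / L\<rfloor>" "(x, y) \<in> P" unfolding \<kappa>_def by auto
    then have "0 \<le> (x - z) / L" "(x - z) / L \<le> 1 / L" using L0 unfolding P near_points_def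
      by (auto simp: divide_right_mono)
    then show "n \<in> T" unfolding T_def x(1) by (auto intro: order_trans[OF of_int_floor_le])
  qed
  define S where "S = {p \<in> P. card {p' \<in> P. \<kappa> p' = \<kappa> p} \<le> M}"
  define F where "F = {p \<in> P. \<exists>p'\<in>P. p' \<noteq> p \<and> fst p' = fst p}"
  have cover: "P \<subseteq> S \<union> F \<union> (\<Union>l\<in>R. on_line P l)"
  proof
    fix p assume pP: "p \<in> P"
    show "p \<in> S \<union> F \<union> (\<Union>l\<in>R. on_line P l)"
    proof (cases "p \<in> S \<or> p \<in> F")
      case False
      define C where "C = {p' \<in> P. \<kappa> p' = \<kappa> p}"
      have finC: "finite C" and pC: "p \<in> C" unfolding C_def using finP pP by auto
      have cC: "M < card C" using False pP unfolding S_def C_def by auto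
      then have "\<not> C \<subseteq> {p}" using card_mono[of "{p}" C] M by auto
      then obtain p' where p': "p' \<in> C" "p' \<noteq> p" by auto
      obtain x y x' y' where xy: "p = (x, y)" "p' = (x', y')" by (cases p, cases p')
      have "x \<noteq> x'" using False p' pP xy unfolding F_def C_def by auto
      define U where "U = (y' - y) / (x' - x)"
      define W where "W = U * x - y"
      have C_arc: "fst t \<in> {z + \<kappa> p * L..z + \<kappa> p * L + L}" if "t \<in> C" for t
      proof -
        have "\<kappa> p \<le> (fst t - z) / L" "(fst t - z) / L < \<kappa> p + 1"
          using that unfolding C_def \<kappa>_def by auto linarith+
        then show ?thesis using L0 by (auto simp: field_simps)
      qed
      have colC: "snd t = U * fst t - W" if t: "t \<in> C" for t
      proof -
        obtain u v where uv: "t = (u, v)" by (cases t)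
        have "(x' - x) * (v - y) = (u - x) * (y' - y)"
          by (rule arc_collinear[OF uc d L, of x y z x' y' u v])
            (use pC p' t xy uv C_arc[OF pC] C_arc[OF p'(1)] C_arc[OF t] in \<open>auto simp: C_def P\<close>)
        then have "v - y = U * (u - x)" using \<open>x \<noteq> x'\<close> unfolding U_def by (simp add: field_simps)
        then show ?thesis unfolding W_def uv by (simp add: algebra_simps)
      qed
      have Con: "C \<subseteq> on_line P (U, W)" using colC unfolding C_def on_line_def by auto
      have inj: "inj_on fst C" using colC by (auto simp: inj_on_def prod_eq_iff)
      have rat: "t \<in> rational_points Q" if "t \<in> C" for t
        using that unfolding C_def P near_points_def by auto
      define v where "v = common_den U W"
      have sp: "real v / (real Q)\<^sup>2 \<le> \<bar>x1 - x2\<bar>" if "x1 \<in> fst ` C" "x2 \<in> fst ` C" "x1 \<noteq> x2" for x1 x2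
      proof -
        from that obtain y1 y2 where "(x1, y1) \<in> C" "(x2, y2) \<in> C" by auto
        with colC[OF this(1)] colC[OF this(2)] rat that(3) show ?thesis
          unfolding v_def by (intro spacing_on_line(1)[of x1 y1 Q x2 y2]) auto
      qed
      have vr: "(U, W) \<in> rational_points v"
        unfolding v_def
        by (rule spacing_on_line(2)[of x y Q x' y'])
          (use rat[OF pC] rat[OF p'(1)] colC[OF pC] colC[OF p'(1)] xy \<open>x \<noteq> x'\<close> in auto)
      then have v0: "0 < v" unfolding rational_points_def by auto
      have "real (card (fst ` C)) \<le> L / (real v / (real Q)\<^sup>2) + 1"
      proof (rule card_spaced_le(2))
        fix x1 x2 assume "x1 \<in> fst ` C" "x2 \<in> fst ` C"
        then have "x1 \<in> {z + \<kappa> p * L..z + \<kappa> p * L + L}" "x2 \<in> {z + \<kappa> p * L..z + \<kappa> p * L + L}"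
          using C_arc by blast+
        then show "\<bar>x1 - x2\<bar> \<le> L" by auto
      qed (use v0 Q sp L0 in auto)
      \<comment> \<open>The strict inequality \<open>M < card C\<close> pays for the
        \<open>+ 1\<close> of the spacing count.\<close>
      with cC have "real M \<le> L * (real Q)\<^sup>2 / real v" unfolding card_image[OF inj] by simp
      then have "real v \<le> L * (real Q)\<^sup>2 / real M" using v0 M by (simp add: field_simps)
      moreover have "3 \<le> card (on_line P (U, W))"
      proof -
        have "card C \<le> card (on_line P (U, W))"
          using Con finP by (intro card_mono) (auto simp: on_line_def)
        then show ?thesis using cC M by linarith
      qed
      ultimately have "(U, W) \<in> R" unfolding R_def rich_lines_def using vr v_def by simp
      then show ?thesis using Con pC by blast
    qed simp
  qed
  have "card P \<le> card (S \<union> F \<union> (\<Union>l\<in>R. on_line P l))"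
    by (rule card_mono[OF _ cover]) (use finP finR in \<open>auto simp: S_def F_def on_line_def\<close>)
  also have "\<dots> \<le> card S + card F + card (\<Union>l\<in>R. on_line P l)"
    by (meson card_Un_le add_mono order_refl order_trans)
  also have "card (\<Union>l\<in>R. on_line P l) \<le> (\<Sum>l\<in>R. card (on_line P l))" by (rule card_UN_le[OF finR])
  finally have "real (card P) \<le> real (card S + card F + (\<Sum>l\<in>R. card (on_line P l)))"
    by (simp only: of_nat_le_iff)
  moreover have "real (card S) \<le> real M * ((8 * A + 8) * d * real Q ^ 3 + 1)"
  proof -
    have "real (card S) \<le> real (card T) * real M"
      unfolding S_def of_nat_mult[symmetric] of_nat_le_iff
      by (rule card_sparse_classes_le[OF finP \<kappa>T T(1)])
    also have "\<dots> \<le> (1 / L + 1) * real M" using T(2) by (intro mult_right_mono) auto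
    finally show ?thesis unfolding L1 by (simp add: mult.commute)
  qed
  moreover have "real (card F) \<le> 16 * d\<^sup>2 * real Q ^ 4"
    unfolding F_def by (rule card_multiple_fibres[OF d(1) P])
  ultimately show ?thesis unfolding R_def by simp
qed

section \<open>The number of points on a line\<close>

text \<open>At \<open>x0\<close> the tangent is parallel to the line, so
  \<open>U * x0 - f x0\<close> is the Legendre transform at U. The height of the line above the
  graph is concave with its maximum at \<open>x0\<close>. Moving outwards by \<delta> from a point
  at distance a from \<open>x0\<close> changes it by at least (a \<delta> + \<delta>^2 / 2) / A, but
  inside the strip by at most 2 d. The gap at \<open>x0\<close> is at most A a^2 / 2 + d;
  multiplying this by \<delta>^2 and inserting the bounds for a \<delta> and \<delta>^2 gives the
  claim.\<close>

lemma same_side_spread: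
  assumes uc: "uniformly_convex A f g" and d: "0 \<le> d" and x0: "g x0 = U"
    and near: "\<bar>U * x - W - f x\<bar> \<le> d" "\<bar>U * x' - W - f x'\<bar> \<le> d"
    and side: "0 \<le> (x - x0) * (x' - x)"
  shows "\<bar>x' - x\<bar> * sqrt (max \<bar>U * x0 - f x0 - W\<bar> d) \<le> 5 * A\<^sup>2 * d"
proof -
  have A: "A \<ge> 1" and mono: "\<And>x y. x \<le> y \<Longrightarrow> (y - x) / A \<le> g y - g x \<and> g y - g x \<le> A * (y - x)"
    using uc unfolding uniformly_convex_def by auto
  define a \<delta> where "a = \<bar>x - x0\<bar>" and "\<delta> = \<bar>x' - x\<bar>"
  define e where "e = max \<bar>U * x0 - f x0 - W\<bar> d"
  have slope: "a * \<delta> / A \<le> (g x - U) * (x' - x)"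
  proof (cases "x = x0")
    case True
    then show ?thesis by (simp add: a_def x0)
  next
    case False
    show ?thesis
    proof (cases "x0 < x")
      case True
      then have "0 \<le> x' - x" using side by (simp add: zero_le_mult_iff)
      moreover have "(x - x0) / A \<le> g x - U" using mono[of x0 x] True x0 by simp
      ultimately have "(x - x0) / A * (x' - x) \<le> (g x - U) * (x' - x)" by (rule mult_right_mono[rotated])
      then show ?thesis using True \<open>0 \<le> x' - x\<close> by (simp add: a_def \<delta>_def)
    next
      case F: False
      then have "0 \<le> x - x'" using side False by (simp add: zero_le_mult_iff)
      moreover have "(x0 - x) / A \<le> U - g x" using mono[of x x0] F x0 by simp
      ultimately have "(x0 - x) / A * (x - x') \<le> (U - g x) * (x - x')" by (rule mult_right_mono[rotated])
      moreover have "(U - g x) * (x - x') = (g x - U) * (x' - x)" by (simp add: algebra_simps)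
      ultimately show ?thesis using F \<open>0 \<le> x - x'\<close> by (simp add: a_def \<delta>_def)
    qed
  qed
  have "\<delta>\<^sup>2 / (2 * A) \<le> f x' - f x - g x * (x' - x)"
    using uniformly_convex_taylor(1)[OF uc, where x = x and y = x'] by (simp add: \<delta>_def)
  moreover have "f x' - f x - g x * (x' - x) + (g x - U) * (x' - x) \<le> 2 * d"
    using near by (simp add: algebra_simps abs_le_iff)
  ultimately have key: "\<delta>\<^sup>2 / (2 * A) + a * \<delta> / A \<le> 2 * d" using slope by linarith
  moreover have "0 \<le> \<delta>\<^sup>2 / (2 * A)" "0 \<le> a * \<delta> / A" using A by (auto simp: a_def \<delta>_def)
  ultimately have "\<delta>\<^sup>2 / (2 * A) \<le> 2 * d" "a * \<delta> / A \<le> 2 * d" by linarith+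
  then have \<delta>2: "\<delta>\<^sup>2 \<le> 4 * A * d" and a\<delta>: "a * \<delta> \<le> 2 * A * d" using A by (simp_all add: field_simps)
  have "\<bar>U * x0 - f x0 - W\<bar> \<le> A * a\<^sup>2 / 2 + d"
  proof -
    define T where "T = f x - f x0 - g x0 * (x - x0)"
    have "0 \<le> (x - x0)\<^sup>2 / (2 * A)" using A by simp
    then have "0 \<le> T" "T \<le> A * a\<^sup>2 / 2"
      using uniformly_convex_taylor[OF uc, where x = x0 and y = x] unfolding T_def a_def by simp_all
    moreover have "U * x0 - f x0 - W = (U * x - W - f x) + T"
      unfolding T_def x0 by (simp add: algebra_simps)
    ultimately show ?thesis using near(1) by linarith
  qed
  then have e: "e \<le> A * a\<^sup>2 / 2 + d" using A by (simp add: e_def)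
  have "(a * \<delta>)\<^sup>2 \<le> (2 * A * d)\<^sup>2" using a\<delta> by (rule power_mono) (simp add: a_def \<delta>_def)
  then have a2: "A * (a * \<delta>)\<^sup>2 / 2 \<le> 2 * A ^ 3 * d\<^sup>2"
    using A mult_left_mono[of "(a * \<delta>)\<^sup>2" "(2 * A * d)\<^sup>2" "A / 2"]
    by (simp add: power2_eq_square power3_eq_cube)
  have "\<delta>\<^sup>2 * e \<le> \<delta>\<^sup>2 * (A * a\<^sup>2 / 2 + d)" using e by (rule mult_left_mono) simp
  also have "\<dots> = A * (a * \<delta>)\<^sup>2 / 2 + \<delta>\<^sup>2 * d" by (simp add: power2_eq_square algebra_simps)
  also have "\<dots> \<le> 2 * A ^ 3 * d\<^sup>2 + 4 * A * d * d" using a2 mult_right_mono[OF \<delta>2 d] by linarith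
  also have "\<dots> \<le> (5 * A\<^sup>2 * d)\<^sup>2"
  proof -
    have "A ^ 3 * d\<^sup>2 \<le> A ^ 4 * d\<^sup>2" "A ^ 1 * d\<^sup>2 \<le> A ^ 4 * d\<^sup>2"
      using A by (intro mult_right_mono power_increasing; simp)+
    moreover have "(5 * A\<^sup>2 * d)\<^sup>2 = 25 * (A ^ 4 * d\<^sup>2)" by (simp add: power_mult_distrib flip: power_mult)
    moreover have "0 \<le> A ^ 4 * d\<^sup>2" by simp
    moreover have "2 * A ^ 3 * d\<^sup>2 + 4 * A * d * d = 2 * (A ^ 3 * d\<^sup>2) + 4 * (A ^ 1 * d\<^sup>2)" by (simp add: power2_eq_square)
    ultimately show ?thesis by linarith
  qed
  finally have "sqrt (\<delta>\<^sup>2 * e) \<le> 5 * A\<^sup>2 * d"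
    using d by (intro real_le_lsqrt) auto
  then show ?thesis by (simp add: real_sqrt_mult \<delta>_def e_def)
qed

lemma spacing_on_line_near:
  assumes P: "P = near_points f Q d z" and "x \<in> fst ` on_line P l" "x' \<in> fst ` on_line P l" "x \<noteq> x'"
  shows "real (common_den (fst l) (snd l)) / (real Q)\<^sup>2 \<le> \<bar>x - x'\<bar>"
proof -
  from assms obtain y y' where "(x, y) \<in> on_line P l" "(x', y') \<in> on_line P l" by auto
  then show ?thesis using assms(4) unfolding on_line_def P near_points_def
    by (intro spacing_on_line(1)[of x y Q x' y']) auto
qed

lemma rich_linesD:
  assumes "l \<in> rich_lines P V"
  shows "0 < common_den (fst l) (snd l)" "real (common_den (fst l) (snd l)) * fst l \<in> \<int>"
    "real (common_den (fst l) (snd l)) * snd l \<in> \<int>" "real (common_den (fst l) (snd l)) \<le> V"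
    "3 \<le> card (on_line P l)"
proof -
  obtain U W where l: "l = (U, W)" by (cases l)
  from assms have "(U, W) \<in> rational_points (common_den U W)" and *: "real (common_den U W) \<le> V" "3 \<le> card (on_line P l)"
    unfolding rich_lines_def l by auto
  then obtain q where q: "0 < q" "real q * U \<in> \<int>" "real q * W \<in> \<int>"
    unfolding rational_points_def by (auto simp: Suc_le_eq)
  show "0 < common_den (fst l) (snd l)" "real (common_den (fst l) (snd l)) * fst l \<in> \<int>"
    "real (common_den (fst l) (snd l)) * snd l \<in> \<int>" "real (common_den (fst l) (snd l)) \<le> V"
    "3 \<le> card (on_line P l)"
    using common_den_props[OF q] * l by auto
qed

lemma inj_on_fst_on_line: "inj_on fst (on_line P l)"
  by (auto simp: inj_on_def on_line_def prod_eq_iff)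

text \<open>On either side of \<open>x0\<close> the points spread over at most 5 A^2 d / \<surd>e
  and are v/Q^2 apart, which allows s + 1 of them. Three points on the line force s \<ge> 1/2. This
  absorbs the \<open>+ 1\<close> and, read as a bound on v \<surd>e, is the second conclusion, which
  limits the range of the dyadic sum.\<close>

lemma card_on_line_flat:
  assumes uc: "uniformly_convex A f g" and d: "0 < d" and x0: "g x0 = fst l"
    and P: "P = near_points f Q d z" and l: "l \<in> rich_lines P V"
    and v: "v = real (common_den (fst l) (snd l))" and e: "e = max \<bar>fst l * x0 - f x0 - snd l\<bar> d"
  shows "real (card (on_line P l)) \<le> 30 * A\<^sup>2 * d * (real Q)\<^sup>2 / (v * sqrt e)"
    and "v * sqrt e \<le> 10 * A\<^sup>2 * d * (real Q)\<^sup>2"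
proof -
  have A: "A \<ge> 1" using uc unfolding uniformly_convex_def by simp
  note lD = rich_linesD[OF l]
  have v0: "0 < v" using lD(1) v by simp
  have e0: "0 < sqrt e" using d e by auto
  have finP: "finite P" using near_points_trivial_bound(1)[of d] d P by simp
  have "on_line P l \<noteq> {}" using lD(5) by auto
  then have Q: "0 < (real Q)\<^sup>2" unfolding on_line_def P near_points_def rational_points_def by auto
  define s where "s = 5 * A\<^sup>2 * d * (real Q)\<^sup>2 / (v * sqrt e)"
  define S where "S = fst ` on_line P l"
  have nearS: "\<bar>fst l * x - snd l - f x\<bar> \<le> d" if "x \<in> S" for x
    using that unfolding S_def on_line_def P near_points_def by auto
  have side: "real (card T) \<le> s + 1"
    if T: "T \<subseteq> S" "(\<forall>x\<in>T. x0 \<le> x) \<or> (\<forall>x\<in>T. x \<le> x0)" for T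
  proof -
    have "real (card T) \<le> (5 * A\<^sup>2 * d / sqrt e) / (v / (real Q)\<^sup>2) + 1"
    proof (rule card_spaced_le(2))
      fix x x' assume x: "x \<in> T" "x' \<in> T"
      show "\<bar>x - x'\<bar> \<le> 5 * A\<^sup>2 * d / sqrt e"
      proof -
        have "0 \<le> (x - x0) * (x' - x) \<or> 0 \<le> (x' - x0) * (x - x')"
          using T(2) x by (auto simp: zero_le_mult_iff)
        moreover have n: "\<bar>fst l * x - snd l - f x\<bar> \<le> d" "\<bar>fst l * x' - snd l - f x'\<bar> \<le> d"
          using nearS T(1) x by blast+
        moreover have "0 \<le> d" using d by simp
        ultimately have "\<bar>x' - x\<bar> * sqrt e \<le> 5 * A\<^sup>2 * d \<or> \<bar>x - x'\<bar> * sqrt e \<le> 5 * A\<^sup>2 * d"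
          unfolding e
          by (elim disjE) (rule disjI1 disjI2, rule same_side_spread[OF uc _ x0]; assumption)+
        then have "\<bar>x - x'\<bar> * sqrt e \<le> 5 * A\<^sup>2 * d" by (simp only: abs_minus_commute disj_absorb)
        then show ?thesis using e0 by (simp add: le_divide_eq)
      qed
      assume "x \<noteq> x'"
      then show "v / (real Q)\<^sup>2 \<le> \<bar>x - x'\<bar>"
        using x T(1) unfolding v S_def by (intro spacing_on_line_near[OF P]) auto
    qed (use v0 Q e0 d A in auto)
    then show ?thesis unfolding s_def by (simp add: field_simps)
  qed
  have "S = {x \<in> S. x0 \<le> x} \<union> {x \<in> S. x \<le> x0}" by auto
  then have "card S \<le> card {x \<in> S. x0 \<le> x} + card {x \<in> S. x \<le> x0}" by (metis card_Un_le)
  then have "real (card S) \<le> 2 * (s + 1)"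
    using side[of "{x \<in> S. x0 \<le> x}"] side[of "{x \<in> S. x \<le> x0}"] by auto
  then have n: "real (card (on_line P l)) \<le> 2 * (s + 1)"
    unfolding S_def using card_image[OF inj_on_fst_on_line] by metis
  moreover have "3 \<le> real (card (on_line P l))" using lD(5) by simp
  ultimately have "3 \<le> 2 * (s + 1)" by (rule order_trans[rotated])
  then have "1 \<le> 2 * s" by simp
  then show "v * sqrt e \<le> 10 * A\<^sup>2 * d * (real Q)\<^sup>2"
    using v0 e0 unfolding s_def by (simp add: field_simps)
  have "2 * (s + 1) \<le> 6 * s" using \<open>1 \<le> 2 * s\<close> by simp
  with n have "real (card (on_line P l)) \<le> 6 * s" by (rule order_trans)
  then show "real (card (on_line P l)) \<le> 30 * A\<^sup>2 * d * (real Q)\<^sup>2 / (v * sqrt e)"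
    unfolding s_def by simp
qed

text \<open>Over the unit window \<open>g\<close> varies by at most A, so if the slope differs from
  \<open>g z\<close> by m > 2 A, it differs from \<open>g\<close> by at least m/2 throughout. The
  curvature takes back at most m/4, and the line stays in the strip only over a length 8 d / m. The
  last conclusion confines W; its 7/4 is 1 from the slope, 1/4 from the curvature and 1/2 from d
  \<le> 1 \<le> m/2.\<close>

lemma card_on_line_steep:
  assumes uc: "uniformly_convex A f g" and d: "0 < d" "d \<le> 1" and steep: "2 * A < \<bar>fst l - g z\<bar>"
    and P: "P = near_points f Q d z" and l: "l \<in> rich_lines P V"
    and v: "v = real (common_den (fst l) (snd l))" and r: "r = v * \<bar>fst l - g z\<bar>"
  shows "real (card (on_line P l)) \<le> 12 * d * (real Q)\<^sup>2 / r" and "r \<le> 4 * d * (real Q)\<^sup>2"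
    and "\<bar>v * snd l - v * (fst l * z - f z)\<bar> \<le> 7 / 4 * r"
proof -
  have A: "A \<ge> 1" and mono: "\<And>x y. x \<le> y \<Longrightarrow> (y - x) / A \<le> g y - g x \<and> g y - g x \<le> A * (y - x)"
    using uc unfolding uniformly_convex_def by auto
  note lD = rich_linesD[OF l]
  have v0: "0 < v" using lD(1) v by simp
  have ne: "on_line P l \<noteq> {}" using lD(5) by auto
  then have Q: "0 < (real Q)\<^sup>2" unfolding on_line_def P near_points_def rational_points_def by auto
  define m where "m = \<bar>fst l - g z\<bar>"
  have m: "2 * A < m" using steep by (simp add: m_def)
  have r0: "0 < r" using v0 m A unfolding r m_def[symmetric] by simp
  define S where "S = fst ` on_line P l"
  have nearS: "\<bar>fst l * x - snd l - f x\<bar> \<le> d" "z \<le> x" "x \<le> z + 1" if "x \<in> S" for x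
    using that unfolding S_def on_line_def P near_points_def by auto
  have spread: "(x' - x) \<le> 8 * d / m" if x: "x \<in> S" "x' \<in> S" "x \<le> x'" for x x'
  proof -
    define T where "T = f x' - f x - g x * (x' - x)"
    have "0 \<le> (x' - x)\<^sup>2 / (2 * A)" using A by simp
    then have T: "0 \<le> T" "T \<le> A * (x' - x)\<^sup>2 / 2"
      using uniformly_convex_taylor[OF uc, where x = x and y = x'] unfolding T_def by linarith+
    have "(x' - x)\<^sup>2 \<le> 1 * (x' - x)" unfolding power2_eq_square
      using nearS[OF x(1)] nearS[OF x(2)] x(3) by (intro mult_right_mono) auto
    then have "A * (x' - x)\<^sup>2 / 2 \<le> A * (x' - x) / 2" using A by simp
    moreover have "A * (x' - x) \<le> m / 2 * (x' - x)" using m x(3) by (intro mult_right_mono) auto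
    ultimately have T2: "T \<le> m / 4 * (x' - x)" using T by simp
    have "\<bar>g x - g z\<bar> \<le> A"
    proof -
      have "0 \<le> (x - z) / A" using A nearS[OF x(1)] by simp
      then have "\<bar>g x - g z\<bar> \<le> A * (x - z)" using mono[of z x] nearS[OF x(1)] by auto
      also have "\<dots> \<le> A * 1" using A nearS[OF x(1)] by (intro mult_left_mono) auto
      finally show ?thesis by simp
    qed
    moreover have "m \<le> \<bar>g x - fst l\<bar> + \<bar>g x - g z\<bar>" unfolding m_def by linarith
    ultimately have "m / 2 \<le> \<bar>g x - fst l\<bar>" using m by linarith
    then have "m / 2 * (x' - x) \<le> \<bar>g x - fst l\<bar> * (x' - x)" using x(3) by (intro mult_right_mono) auto
    also have "\<dots> = \<bar>(g x - fst l) * (x' - x)\<bar>" using x(3) by (simp add: abs_mult)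
    finally have a: "m / 2 * (x' - x) \<le> \<bar>(g x - fst l) * (x' - x)\<bar>" .
    have b: "\<bar>(g x - fst l) * (x' - x) + T\<bar> \<le> 2 * d"
    proof -
      have "(g x - fst l) * (x' - x) + T = (fst l * x - snd l - f x) - (fst l * x' - snd l - f x')"
        unfolding T_def by (simp add: algebra_simps)
      then show ?thesis using nearS(1)[OF x(1)] nearS(1)[OF x(2)] by linarith
    qed
    have "m / 2 * (x' - x) - m / 4 * (x' - x) \<le> 2 * d" using a b T T2 by linarith
    then have "(x' - x) * m \<le> 8 * d" by (simp add: field_simps)
    then show ?thesis using m A by (simp add: le_divide_eq)
  qed
  have "real (card S) \<le> (8 * d / m) / (v / (real Q)\<^sup>2) + 1"
  proof (rule card_spaced_le(2))
    fix x x' assume x: "x \<in> S" "x' \<in> S"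
    show "\<bar>x - x'\<bar> \<le> 8 * d / m" using spread[OF x] spread[OF x(2,1)] by (cases "x \<le> x'") auto
    assume "x \<noteq> x'"
    then show "v / (real Q)\<^sup>2 \<le> \<bar>x - x'\<bar>"
      using x unfolding v S_def by (intro spacing_on_line_near[OF P]) auto
  qed (use v0 Q d m A in auto)
  also have "(8 * d / m) / (v / (real Q)\<^sup>2) = 8 * d * (real Q)\<^sup>2 / r" unfolding r m_def by simp
  finally have n: "real (card (on_line P l)) \<le> 8 * d * (real Q)\<^sup>2 / r + 1"
    unfolding S_def using card_image[OF inj_on_fst_on_line] by metis
  moreover have "3 \<le> real (card (on_line P l))" using lD(5) by simp
  ultimately have two: "2 \<le> 8 * d * (real Q)\<^sup>2 / r" by linarith
  then show "r \<le> 4 * d * (real Q)\<^sup>2" using r0 by (simp add: field_simps)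
  define X where "X = 4 * d * (real Q)\<^sup>2 / r"
  have X: "8 * d * (real Q)\<^sup>2 / r = 2 * X" "12 * d * (real Q)\<^sup>2 / r = 3 * X"
    unfolding X_def by simp_all
  have "8 * d * (real Q)\<^sup>2 / r + 1 \<le> 12 * d * (real Q)\<^sup>2 / r" using two unfolding X by simp
  with n show "real (card (on_line P l)) \<le> 12 * d * (real Q)\<^sup>2 / r" by (rule order_trans)
  from ne obtain x where x: "x \<in> S" unfolding S_def by auto
  define T where "T = f x - f z - g z * (x - z)"
  have "0 \<le> (x - z)\<^sup>2 / (2 * A)" using A by simp
  then have T: "0 \<le> T" "T \<le> A * (x - z)\<^sup>2 / 2"
    using uniformly_convex_taylor[OF uc, where x = z and y = x] unfolding T_def by linarith+
  have "A * (x - z)\<^sup>2 \<le> A * 1" using A nearS[OF x] by (intro mult_left_mono) (auto intro: power_le_one)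
  then have T2: "\<bar>T\<bar> \<le> m / 4" using T m by linarith
  have "\<bar>(fst l - g z) * (x - z)\<bar> \<le> m * 1" unfolding abs_mult m_def using nearS[OF x] by (intro mult_left_mono) auto
  moreover have "snd l - (fst l * z - f z) = (fst l - g z) * (x - z) - T - (fst l * x - snd l - f x)"
    unfolding T_def by (simp add: algebra_simps)
  ultimately have "\<bar>snd l - (fst l * z - f z)\<bar> \<le> m + m / 4 + d" using T2 nearS(1)[OF x] by linarith
  also have "\<dots> \<le> 7 / 4 * m" using d m A by linarith
  finally have "v * \<bar>snd l - (fst l * z - f z)\<bar> \<le> v * (7 / 4 * m)" using v0 by (intro mult_left_mono) auto
  moreover have "v * \<bar>snd l - (fst l * z - f z)\<bar> = \<bar>v * snd l - v * (fst l * z - f z)\<bar>"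
    using v0 by (simp add: right_diff_distrib[symmetric] abs_mult)
  ultimately show "\<bar>v * snd l - v * (fst l * z - f z)\<bar> \<le> 7 / 4 * r" unfolding r m_def by simp
qed

lemma sum_steep_lines:
  assumes uc: "uniformly_convex A f g" and d: "0 < d" "d \<le> 1" "1 \<le> d * (real Q)\<^sup>2"
    and P: "P = near_points f Q d z" and V: "0 \<le> V"
  shows "(\<Sum>l\<in>{l \<in> rich_lines P V. 2 * A < \<bar>fst l - g z\<bar>}. real (card (on_line P l)))
    \<le> 432 * V * (d * (real Q)\<^sup>2)\<^sup>2"
proof -
  define D where "D = d * (real Q)\<^sup>2"
  define \<Lambda> where "\<Lambda> = {l \<in> rich_lines P V. 2 * A < \<bar>fst l - g z\<bar>}"
  define v where "v l = common_den (fst l) (snd l)" for l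
  define \<iota> where "\<iota> l = (v l, \<lfloor>real (v l) * fst l\<rfloor>, \<lfloor>real (v l) * snd l\<rfloor>)" for l
  define r where "r b u = \<bar>real_of_int u - real b * g z\<bar>" for b :: nat and u :: int
  define Us where "Us b = {u::int. real b * g z - 4 * D \<le> of_int u \<and> of_int u \<le> real b * g z + 4 * D}" for b :: nat
  define Us' where "Us' b = Us b \<inter> {u. 2 < r b u}" for b
  define c where "c b u = of_int u * z - real b * f z" for b :: nat and u :: int
  define Ws where "Ws b u = {w::int. c b u - 7 / 4 * r b u \<le> of_int w \<and> of_int w \<le> c b u + 7 / 4 * r b u}" for b u
  define B where "B = nat \<lfloor>V\<rfloor>"
  define T where "T = (SIGMA b:{1..B}. SIGMA u:Us' b. Ws b u)"
  define wt where "wt = (\<lambda>(b, u, w::int). 12 * D / r b u)"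
  have A: "A \<ge> 1" using uc unfolding uniformly_convex_def by simp
  have finP: "finite P" using near_points_trivial_bound(1)[of d] d P by simp
  have finU: "finite (Us' b)" and finW: "finite (Ws b u)" for b u
    unfolding Us'_def Us_def Ws_def by (intro finite_Int disjI1 card_int_interval(1))+
  have finT: "finite T" unfolding T_def using finU finW by auto
  have int: "real (v l) * fst l = of_int \<lfloor>real (v l) * fst l\<rfloor>" "real (v l) * snd l = of_int \<lfloor>real (v l) * snd l\<rfloor>"
    if "l \<in> \<Lambda>" for l
    using rich_linesD(2,3)[of l P V] that unfolding \<Lambda>_def v_def by (auto simp: of_int_floor)
  have rv: "r (v l) \<lfloor>real (v l) * fst l\<rfloor> = real (v l) * \<bar>fst l - g z\<bar>" if "l \<in> \<Lambda>" for l
    using int(1)[OF that] unfolding r_def by (simp add: right_diff_distrib[symmetric] abs_mult)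
  have inj: "inj_on \<iota> \<Lambda>"
  proof (rule inj_onI)
    fix l l' assume l: "l \<in> \<Lambda>" "l' \<in> \<Lambda>" "\<iota> l = \<iota> l'"
    have "0 < v l" using rich_linesD(1) l(1) unfolding \<Lambda>_def v_def by auto
    then show "l = l'" using l(3) int[OF l(1)] int[OF l(2)] unfolding \<iota>_def by (auto simp: prod_eq_iff)
  qed
  have main: "\<iota> l \<in> T \<and> real (card (on_line P l)) \<le> wt (\<iota> l)" if l: "l \<in> \<Lambda>" for l
  proof -
    have l': "l \<in> rich_lines P V" "2 * A < \<bar>fst l - g z\<bar>" using l unfolding \<Lambda>_def by auto
    note s = card_on_line_steep[OF uc d(1,2) l'(2) P l'(1), folded v_def, OF refl refl, folded rv[OF l]]
    have v0: "1 \<le> real (v l)" using rich_linesD(1)[OF l'(1)] unfolding v_def by simp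
    have "v l \<le> B" unfolding B_def using rich_linesD(4)[OF l'(1)] by (simp add: le_nat_floor v_def)
    moreover have "2 < r (v l) \<lfloor>real (v l) * fst l\<rfloor>"
    proof -
      have "2 < \<bar>fst l - g z\<bar>" using l'(2) A by linarith
      also have "\<dots> \<le> real (v l) * \<bar>fst l - g z\<bar>" using v0 mult_right_mono[of 1 "real (v l)" "\<bar>fst l - g z\<bar>"] by simp
      finally show ?thesis using rv[OF l] by simp
    qed
    moreover have "\<lfloor>real (v l) * fst l\<rfloor> \<in> Us (v l)"
      using s(2) unfolding Us_def r_def D_def by (auto simp: abs_le_iff)
    moreover have "\<lfloor>real (v l) * snd l\<rfloor> \<in> Ws (v l) \<lfloor>real (v l) * fst l\<rfloor>"
    proof -
      have "real (v l) * (fst l * z - f z) = c (v l) \<lfloor>real (v l) * fst l\<rfloor>"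
        unfolding c_def int(1)[OF l, symmetric] by (simp add: algebra_simps)
      then show ?thesis using s(3) unfolding Ws_def int(2)[OF l, symmetric] mem_Collect_eq by linarith
    qed
    ultimately have "\<iota> l \<in> T" using v0 unfolding \<iota>_def T_def Us'_def by simp
    moreover have "real (card (on_line P l)) \<le> wt (\<iota> l)" using s(1) unfolding wt_def \<iota>_def D_def by simp
    ultimately show ?thesis by simp
  qed
  have "(\<Sum>l\<in>\<Lambda>. real (card (on_line P l))) \<le> (\<Sum>l\<in>\<Lambda>. wt (\<iota> l))" using main by (intro sum_mono) auto
  also have "\<dots> = sum wt (\<iota> ` \<Lambda>)" using sum.reindex[OF inj, of wt] by simp
  also have "\<dots> \<le> sum wt T"
    using main finT d unfolding wt_def D_def r_def by (intro sum_mono2) auto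
  also have "\<dots> = (\<Sum>b\<in>{1..B}. \<Sum>u\<in>Us' b. \<Sum>w\<in>Ws b u. 12 * D / r b u)"
    unfolding T_def wt_def using finU finW by (simp add: sum.Sigma[symmetric])
  also have "\<dots> \<le> (\<Sum>b\<in>{1..B}. \<Sum>u\<in>Us' b. 48 * D)"
  proof (intro sum_mono)
    fix b u assume "u \<in> Us' b"
    then have r: "2 < r b u" unfolding Us'_def by simp
    have "real (card (Ws b u)) \<le> 4 * r b u"
      unfolding Ws_def using card_int_interval(2)[of "c b u - 7 / 4 * r b u" "c b u + 7 / 4 * r b u"] r by simp
    then have "real (card (Ws b u)) * (12 * D / r b u) \<le> 4 * r b u * (12 * D / r b u)"
      using r d unfolding D_def by (intro mult_right_mono) auto
    then show "(\<Sum>w\<in>Ws b u. 12 * D / r b u) \<le> 48 * D" using r by simp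
  qed
  also have "\<dots> \<le> (\<Sum>b\<in>{1..B}. 9 * D * (48 * D))"
  proof (intro sum_mono)
    fix b
    have "card (Us' b) \<le> card (Us b)" unfolding Us'_def Us_def by (intro card_mono card_int_interval(1)) auto
    also have "real (card (Us b)) \<le> 9 * D"
      unfolding Us_def using card_int_interval(2)[of "real b * g z - 4 * D" "real b * g z + 4 * D"] d(3)
      by (simp add: D_def)
    finally have "real (card (Us' b)) \<le> 9 * D" by simp
    then show "(\<Sum>u\<in>Us' b. 48 * D) \<le> 9 * D * (48 * D)"
      using d mult_right_mono[of "real (card (Us' b))" "9 * D" "48 * D"] by (simp add: D_def)
  qed
  also have "\<dots> = real B * (432 * D\<^sup>2)" by (simp add: power2_eq_square)
  also have "\<dots> \<le> V * (432 * D\<^sup>2)" unfolding B_def using V by (intro mult_right_mono) auto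
  finally show ?thesis unfolding \<Lambda>_def D_def by simp
qed

section \<open>Dyadic summation over the lines\<close>

lemma sum_powers_le_if_bounded:
  fixes \<rho> B :: real
  assumes "1 < \<rho>" "finite S" "0 \<le> B" "\<And>m. m \<in> S \<Longrightarrow> \<rho> ^ m \<le> B"
  shows "(\<Sum>m\<in>S. \<rho> ^ m) \<le> \<rho> / (\<rho> - 1) * B"
proof (cases "S = {}")
  case True
  then show ?thesis using assms by simp
next
  case False
  define n where "n = Max S"
  have n: "n \<in> S" "S \<subseteq> {..<Suc n}" unfolding n_def using False assms(2) by (auto simp: less_Suc_eq_le)
  have "(\<Sum>m\<in>S. \<rho> ^ m) \<le> (\<Sum>m<Suc n. \<rho> ^ m)" using n(2) assms(1) by (intro sum_mono2) auto
  also have "\<dots> = (\<rho> ^ Suc n - 1) / (\<rho> - 1)" using assms(1) by (subst geometric_sum) auto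
  also have "\<dots> \<le> (\<rho> * B) / (\<rho> - 1)"
  proof (rule divide_right_mono)
    have "\<rho> * \<rho> ^ n \<le> \<rho> * B" using assms(1) assms(4)[OF n(1)] by (intro mult_left_mono) auto
    then show "\<rho> ^ Suc n - 1 \<le> \<rho> * B" unfolding power_Suc by linarith
  qed (use assms(1) in simp)
  finally show ?thesis by simp
qed

lemma sum_powers_le_if_less_one:
  fixes \<rho> :: real
  assumes "0 < \<rho>" "\<rho> < 1" "finite S"
  shows "(\<Sum>m\<in>S. \<rho> ^ m) \<le> 1 / (1 - \<rho>)"
proof -
  have "(\<Sum>m\<in>S. \<rho> ^ m) \<le> (\<Sum>m. \<rho> ^ m)"
    using assms by (intro sum_le_suminf summable_geometric) auto
  then show ?thesis using assms by (simp add: suminf_geometric)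
qed

lemma dyadic_bracket:
  fixes x :: real
  assumes "1 \<le> x"
  obtains n :: nat where "2 ^ n \<le> x" "x < 2 * 2 ^ n"
proof -
  have "1 \<le> nat \<lfloor>x\<rfloor>" using assms by linarith
  then obtain n where n: "2 ^ n \<le> nat \<lfloor>x\<rfloor>" "nat \<lfloor>x\<rfloor> < 2 ^ (n + 1)"
    using ex_power_ivl1[of 2 "nat \<lfloor>x\<rfloor>"] by auto
  have "2 ^ n \<le> real (nat \<lfloor>x\<rfloor>)" using n(1) by (metis of_nat_le_iff of_nat_numeral of_nat_power)
  moreover have "real (nat \<lfloor>x\<rfloor>) \<le> x" using assms by simp
  moreover have "real (nat \<lfloor>x\<rfloor>) + 1 \<le> 2 * 2 ^ n"
  proof -
    have "nat \<lfloor>x\<rfloor> + 1 \<le> 2 * 2 ^ n" using n(2) by simp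
    then have "real (nat \<lfloor>x\<rfloor> + 1) \<le> real (2 * 2 ^ n)" by (simp only: of_nat_le_iff)
    then show ?thesis by simp
  qed
  moreover have "x < real (nat \<lfloor>x\<rfloor>) + 1" using assms by linarith
  ultimately show thesis by (intro that[of n]) linarith+
qed

text \<open>Collects the geometric series for the second and third terms of the counting bound:
  2^(1-\<epsilon>) against 2^(-2\<epsilon>), and 2^\<epsilon> against 1/2, the latter series having
  the sum 2 that turns a factor 4 into 8.\<close>

definition dyadic_const :: "real \<Rightarrow> real" where
  "dyadic_const \<epsilon> = 8 * (2 powr (1 - \<epsilon>) / (2 powr (1 - \<epsilon>) - 1)) * (1 / (1 - 2 powr (- 2 * \<epsilon>)))
     + 8 * (2 powr \<epsilon> / (2 powr \<epsilon> - 1))"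

lemma dyadic_const_parts_nonneg:
  fixes \<epsilon> :: real
  assumes "0 < \<epsilon>" "\<epsilon> < 1 / 2"
  shows "0 \<le> 8 * (2 powr (1 - \<epsilon>) / (2 powr (1 - \<epsilon>) - 1)) * (1 / (1 - 2 powr (- 2 * \<epsilon>)))"
    and "0 \<le> 8 * (2 powr \<epsilon> / (2 powr \<epsilon> - 1))"
proof -
  have "1 < 2 powr (1 - \<epsilon>)" "1 < 2 powr \<epsilon>" using assms by (intro gr_one_powr; simp)+
  moreover have "2 powr (- 2 * \<epsilon>) < 1" using powr_less_mono[of "- 2 * \<epsilon>" 0 2] assms by simp
  ultimately show "0 \<le> 8 * (2 powr (1 - \<epsilon>) / (2 powr (1 - \<epsilon>) - 1)) * (1 / (1 - 2 powr (- 2 * \<epsilon>)))"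
    and "0 \<le> 8 * (2 powr \<epsilon> / (2 powr \<epsilon> - 1))"
    by (intro mult_nonneg_nonneg divide_nonneg_nonneg; linarith)+
qed

text \<open>The first term is the expected order, the width of the strip times q^3. The other two
  are errors which agree at D = q^-2, where they exceed the first by q^\<epsilon>. With \<epsilon> =
  0 the dyadic summation would lose logarithms: the second term would have no decay in the distance
  and the third no growth in the denominator.\<close>

definition counting_bound :: "real \<Rightarrow> real \<Rightarrow> real \<Rightarrow> real" where
  "counting_bound \<epsilon> q D = D * q ^ 3 + D powr (1/2 - \<epsilon>) * q powr (2 - \<epsilon>) + q powr (1 + \<epsilon>)"

lemma two_powr_power: "(2 ^ n) powr a = ((2::real) powr a) ^ n"
  by (simp add: powr_realpow[symmetric] powr_powr mult.commute)

text \<open>The contribution of one dyadic cell, where the denominators are about x and the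
  distances about y^2 d: the count at the upper ends of the cell times the weight at the lower
  ends.\<close>

lemma dyadic_term:
  assumes \<epsilon>: "0 < \<epsilon>" "\<epsilon> < 1 / 2" and pos: "0 < d" "0 < x" "0 < y"
  shows "counting_bound \<epsilon> (2 * x) (4 * y\<^sup>2 * d) / (x * y * sqrt d)
    \<le> 32 * sqrt d * (y * x\<^sup>2) + 8 * d powr - \<epsilon> * (y powr (- 2 * \<epsilon>) * x powr (1 - \<epsilon>))
      + 4 * d powr (- 1/2) * (x powr \<epsilon> * y powr (- 1))"
proof -
  have xy: "x * y * sqrt d = x powr 1 * y powr 1 * d powr (1/2)" using pos by (simp add: powr_half_sqrt)
  have d1: "d = sqrt d * sqrt d" using pos by simp
  have sd: "sqrt d > 0" using pos by simp
  have t1: "(4 * y\<^sup>2 * d) * (2 * x) ^ 3 = (32 * sqrt d * (y * x\<^sup>2)) * (x * y * sqrt d)"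
    by (subst d1) (simp add: power2_eq_square power3_eq_cube)
  have c2: "4 powr (1/2 - \<epsilon>) * 2 powr (2 - \<epsilon>) \<le> (8::real)"
  proof -
    have "4 powr (1/2 - \<epsilon>) \<le> (4::real) powr (1/2)" using \<epsilon> by (intro powr_mono) auto
    also have "(4::real) powr (1/2) = 2" by (simp add: powr_half_sqrt)
    finally have a: "4 powr (1/2 - \<epsilon>) \<le> (2::real)" .
    have "2 powr (2 - \<epsilon>) \<le> (2::real) powr 2" using \<epsilon> by (intro powr_mono) auto
    then have "2 powr (2 - \<epsilon>) \<le> (4::real)" by simp
    with a show ?thesis using mult_mono[of "4 powr (1/2 - \<epsilon>)" "2::real" "2 powr (2 - \<epsilon>)" 4] by simp
  qed
  have y2: "(y\<^sup>2) powr (1/2 - \<epsilon>) = y powr (1 - 2 * \<epsilon>)"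
    using pos by (simp add: powr_powr algebra_simps flip: powr_numeral)
  have "(4 * y\<^sup>2 * d) powr (1/2 - \<epsilon>) * (2 * x) powr (2 - \<epsilon>)
     = (4 powr (1/2 - \<epsilon>) * 2 powr (2 - \<epsilon>)) * (y powr (1 - 2 * \<epsilon>) * d powr (1/2 - \<epsilon>) * x powr (2 - \<epsilon>))"
    using pos by (simp add: powr_mult y2)
  also have "\<dots> \<le> 8 * (y powr (1 - 2 * \<epsilon>) * d powr (1/2 - \<epsilon>) * x powr (2 - \<epsilon>))"
    by (rule mult_right_mono[OF c2]) simp
  also have "\<dots> = 8 * d powr - \<epsilon> * (y powr (- 2 * \<epsilon>) * x powr (1 - \<epsilon>)) * (x * y * sqrt d)"
  proof -
    have "y powr (1 - 2 * \<epsilon>) = y powr (- 2 * \<epsilon>) * y powr 1" "d powr (1/2 - \<epsilon>) = d powr - \<epsilon> * d powr (1/2)"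
      "x powr (2 - \<epsilon>) = x powr (1 - \<epsilon>) * x powr 1" unfolding powr_add[symmetric] by simp_all
    then show ?thesis unfolding xy by simp
  qed
  finally have t2: "(4 * y\<^sup>2 * d) powr (1/2 - \<epsilon>) * (2 * x) powr (2 - \<epsilon>)
    \<le> 8 * d powr - \<epsilon> * (y powr (- 2 * \<epsilon>) * x powr (1 - \<epsilon>)) * (x * y * sqrt d)" .
  have "2 powr (1 + \<epsilon>) \<le> (2::real) powr 2" using \<epsilon> by (intro powr_mono) auto
  then have "(2 * x) powr (1 + \<epsilon>) \<le> 4 * x powr (1 + \<epsilon>)" using pos by (simp add: powr_mult)
  also have "\<dots> = 4 * d powr (- 1/2) * (x powr \<epsilon> * y powr (- 1)) * (x * y * sqrt d)"
  proof -
    have "x powr (1 + \<epsilon>) = x powr \<epsilon> * x powr 1"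
      unfolding powr_add[symmetric] by (simp add: add.commute)
    moreover have "y powr (- 1) * y powr 1 = 1" "d powr (- 1/2) * d powr (1/2) = 1"
      unfolding powr_add[symmetric] using pos by simp_all
    ultimately show ?thesis unfolding xy using pos by (simp add: mult_ac)
  qed
  finally have t3: "(2 * x) powr (1 + \<epsilon>) \<le> 4 * d powr (- 1/2) * (x powr \<epsilon> * y powr (- 1)) * (x * y * sqrt d)" .
  have "counting_bound \<epsilon> (2 * x) (4 * y\<^sup>2 * d) \<le> (32 * sqrt d * (y * x\<^sup>2) + 8 * d powr - \<epsilon> * (y powr (- 2 * \<epsilon>) * x powr (1 - \<epsilon>))
      + 4 * d powr (- 1/2) * (x powr \<epsilon> * y powr (- 1))) * (x * y * sqrt d)"
    unfolding counting_bound_def distrib_right using t1 t2 t3 by linarith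
  then show ?thesis using pos sd by (subst pos_divide_le_eq) auto
qed

text \<open>Stated for an abstract family with denominators \<open>v\<close> and distances
  \<open>e\<close>. The cells are dyadic in \<open>v\<close> and in \<surd>(e/d), which is at least
  1, and the given count is applied once in each cell.\<close>

lemma dyadic_sum:
  fixes v :: "'a \<Rightarrow> nat" and e :: "'a \<Rightarrow> real"
  assumes \<epsilon>: "0 < \<epsilon>" "\<epsilon> < 1 / 2" and d: "0 < d" and fin: "finite \<Lambda>" and G: "0 \<le> G" and V0: "0 \<le> V" and R0: "0 \<le> R"
    and v: "\<And>l. l \<in> \<Lambda> \<Longrightarrow> 0 < v l" "\<And>l. l \<in> \<Lambda> \<Longrightarrow> real (v l) \<le> V"
    and e: "\<And>l. l \<in> \<Lambda> \<Longrightarrow> d \<le> e l" "\<And>l. l \<in> \<Lambda> \<Longrightarrow> real (v l) * sqrt (e l) \<le> R * sqrt d"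
    and count: "\<And>q D. 1 \<le> q \<Longrightarrow> real q \<le> 2 * V \<Longrightarrow> d \<le> D \<Longrightarrow>
      real (card {l \<in> \<Lambda>. v l \<le> q \<and> e l \<le> D}) \<le> G * counting_bound \<epsilon> (real q) D"
  shows "(\<Sum>l\<in>\<Lambda>. 1 / (real (v l) * sqrt (e l)))
    \<le> G * (128 * sqrt d * V * R + dyadic_const \<epsilon> * (d powr - \<epsilon> * V powr (1 - \<epsilon>) + d powr (- 1/2) * V powr \<epsilon>))"
proof -
  have "\<exists>n. 2 ^ n \<le> real (v l) \<and> real (v l) < 2 * 2 ^ n" if "l \<in> \<Lambda>" for l
    using dyadic_bracket[of "real (v l)"] v(1)[OF that] by (metis One_nat_def Suc_leI of_nat_1 of_nat_le_iff)
  then obtain \<alpha> :: "'a \<Rightarrow> nat" where \<alpha>: "\<And>l. l \<in> \<Lambda> \<Longrightarrow> 2 ^ \<alpha> l \<le> real (v l) \<and> real (v l) < 2 * 2 ^ \<alpha> l" by metis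
  have "\<exists>n. 2 ^ n \<le> sqrt (e l / d) \<and> sqrt (e l / d) < 2 * 2 ^ n" if "l \<in> \<Lambda>" for l
    using dyadic_bracket[of "sqrt (e l / d)"] e(1)[OF that] d by (metis le_divide_eq_1_pos real_sqrt_ge_1_iff)
  then obtain \<beta> :: "'a \<Rightarrow> nat" where \<beta>: "\<And>l. l \<in> \<Lambda> \<Longrightarrow> 2 ^ \<beta> l \<le> sqrt (e l / d) \<and> sqrt (e l / d) < 2 * 2 ^ \<beta> l" by metis
  have sd: "0 < sqrt d" using d by simp
  have sqe: "sqrt (e l) = sqrt (e l / d) * sqrt d" for l using d by (simp add: real_sqrt_divide)
  define I where "I = {i::nat. 2 ^ i \<le> V}"
  define J where "J i = {j::nat. 2 ^ i * 2 ^ j \<le> R}" for i :: nat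
  have finpow: "finite {i::nat. 2 ^ i \<le> (X::real)}" for X
  proof (rule finite_subset)
    show "{i::nat. 2 ^ i \<le> X} \<subseteq> {..nat \<lceil>X\<rceil>}"
    proof
      fix i :: nat assume "i \<in> {i::nat. 2 ^ i \<le> X}"
      then have "2 ^ i \<le> X" by simp
      moreover have "real i < 2 ^ i" by (rule of_nat_less_two_power)
      ultimately have "real i \<le> X" by linarith
      then show "i \<in> {..nat \<lceil>X\<rceil>}" by simp linarith
    qed
  qed simp
  have finI: "finite I" unfolding I_def by (rule finpow)
  have finJ: "finite (J i)" for i
    unfolding J_def by (rule finite_subset[OF _ finpow[of "R / 2 ^ i"]]) (auto simp: field_simps)
  define T where "T = Sigma I J"
  have finT: "finite T" unfolding T_def using finI finJ by auto
  have img: "(\<lambda>l. (\<alpha> l, \<beta> l)) ` \<Lambda> \<subseteq> T"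
  proof (rule image_subsetI)
    fix l assume l: "l \<in> \<Lambda>"
    have "2 ^ \<alpha> l * 2 ^ \<beta> l \<le> real (v l) * sqrt (e l / d)" using \<alpha>[OF l] \<beta>[OF l] by (intro mult_mono) auto
    moreover have "real (v l) * sqrt (e l / d) * sqrt d \<le> R * sqrt d" using e(2)[OF l] sqe[of l] by simp
    then have "real (v l) * sqrt (e l / d) \<le> R" using sd by (rule mult_right_le_imp_le)
    moreover have "2 ^ \<alpha> l \<le> V" using \<alpha>[OF l] v(2)[OF l] by (meson order_trans)
    ultimately show "(\<alpha> l, \<beta> l) \<in> T" unfolding T_def I_def J_def by auto
  qed
  define h where "h l = 1 / (real (v l) * sqrt (e l))" for l
  define b1 where "b1 i j = 32 * sqrt d * (2 ^ i * 2 ^ i * 2 ^ j)" for i j :: nat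
  define b2 where "b2 i j = 8 * d powr - \<epsilon> * ((2 powr (1 - \<epsilon>)) ^ i * (2 powr (- 2 * \<epsilon>)) ^ j)" for i j :: nat
  define b3 where "b3 i j = 4 * d powr (- 1/2) * ((2 powr \<epsilon>) ^ i * (2 powr - 1) ^ j)" for i j :: nat
  have cell: "sum h {l \<in> \<Lambda>. (\<alpha> l, \<beta> l) = t} \<le> (\<lambda>(i, j). G * (b1 i j + b2 i j + b3 i j)) t" if t: "t \<in> T" for t
  proof -
    obtain i j where ij: "t = (i, j)" "i \<in> I" "j \<in> J i" using t unfolding T_def by auto
    define x y :: real where "x = 2 ^ i" and "y = 2 ^ j"
    have xy: "0 < x" "0 < y" "1 \<le> y" unfolding x_def y_def by auto
    define C where "C = {l \<in> \<Lambda>. (\<alpha> l, \<beta> l) = t}"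
    have C: "l \<in> \<Lambda>" "x \<le> real (v l)" "real (v l) < 2 * x" "y \<le> sqrt (e l / d)" "sqrt (e l / d) < 2 * y" if "l \<in> C" for l
      using that \<alpha>[of l] \<beta>[of l] unfolding C_def ij x_def y_def by auto
    have "sum h C \<le> (\<Sum>l\<in>C. 1 / (x * y * sqrt d))"
    proof (rule sum_mono)
      fix l assume l: "l \<in> C"
      have "x * (y * sqrt d) \<le> real (v l) * sqrt (e l)"
        unfolding sqe[of l] using C[OF l] xy sd by (intro mult_mono mult_right_mono) auto
      moreover have "0 < x * (y * sqrt d)" using xy sd by simp
      ultimately have "inverse (real (v l) * sqrt (e l)) \<le> inverse (x * (y * sqrt d))" by (rule le_imp_inverse_le)
      then show "h l \<le> 1 / (x * y * sqrt d)" unfolding h_def by (simp add: inverse_eq_divide mult.assoc)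
    qed
    also have "\<dots> = real (card C) / (x * y * sqrt d)" by simp
    also have "\<dots> \<le> G * counting_bound \<epsilon> (2 * x) (4 * y\<^sup>2 * d) / (x * y * sqrt d)"
    proof (rule divide_right_mono)
      define q where "q = 2 * (2::nat) ^ i"
      have q: "real q = 2 * x" "1 \<le> q" unfolding q_def x_def by auto
      have "C \<subseteq> {l \<in> \<Lambda>. v l \<le> q \<and> e l \<le> 4 * y\<^sup>2 * d}"
      proof
        fix l assume l: "l \<in> C"
        have "real (v l) \<le> real q" using C(3)[OF l] q by simp
        moreover have "e l / d \<le> (2 * y)\<^sup>2"
        proof -
          have "0 \<le> e l / d" using e(1)[OF C(1)[OF l]] d by simp
          then have "e l / d = (sqrt (e l / d))\<^sup>2" "0 \<le> sqrt (e l / d)" by simp_all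
          note this(1)
          also have "(sqrt (e l / d))\<^sup>2 \<le> (2 * y)\<^sup>2"
            by (rule power_mono[OF less_imp_le[OF C(5)[OF l]] \<open>0 \<le> sqrt (e l / d)\<close>])
          finally show ?thesis .
        qed
        ultimately show "l \<in> {l \<in> \<Lambda>. v l \<le> q \<and> e l \<le> 4 * y\<^sup>2 * d}"
          using C(1)[OF l] d by (simp add: divide_le_eq power_mult_distrib)
      qed
      then have "card C \<le> card {l \<in> \<Lambda>. v l \<le> q \<and> e l \<le> 4 * y\<^sup>2 * d}" using fin by (intro card_mono) auto
      moreover have "real (card {l \<in> \<Lambda>. v l \<le> q \<and> e l \<le> 4 * y\<^sup>2 * d}) \<le> G * counting_bound \<epsilon> (real q) (4 * y\<^sup>2 * d)"
      proof (rule count[OF q(2)])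
        show "real q \<le> 2 * V" using ij(2) unfolding q I_def x_def by simp
        have "1 \<le> y\<^sup>2" using xy by simp
        then show "d \<le> 4 * y\<^sup>2 * d" using d by simp
      qed
      ultimately show "real (card C) \<le> G * counting_bound \<epsilon> (2 * x) (4 * y\<^sup>2 * d)" unfolding q by (meson of_nat_mono order_trans)
      show "0 \<le> x * y * sqrt d" using xy sd by simp
    qed
    also have "\<dots> = G * (counting_bound \<epsilon> (2 * x) (4 * y\<^sup>2 * d) / (x * y * sqrt d))" by simp
    also have "\<dots> \<le> G * (b1 i j + b2 i j + b3 i j)"
    proof (rule mult_left_mono[OF _ G])
      have "b1 i j + b2 i j + b3 i j = 32 * sqrt d * (y * x\<^sup>2) + 8 * d powr - \<epsilon> * (y powr (- 2 * \<epsilon>) * x powr (1 - \<epsilon>))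
      + 4 * d powr (- 1/2) * (x powr \<epsilon> * y powr (- 1))"
        unfolding b1_def b2_def b3_def x_def y_def two_powr_power power2_eq_square by simp
      then show "counting_bound \<epsilon> (2 * x) (4 * y\<^sup>2 * d) / (x * y * sqrt d) \<le> b1 i j + b2 i j + b3 i j"
        using dyadic_term[OF \<epsilon> d xy(1,2)] by simp
    qed
    finally show ?thesis unfolding C_def ij by simp
  qed
  \<comment> \<open>This term grows in both indices, and only the constraint 2^i 2^j \<le> R keeps
    it under control: the sum over j is at most 2 R / 2^i, which leaves a single factor 2^i.\<close>
  have s1: "(\<Sum>i\<in>I. \<Sum>j\<in>J i. b1 i j) \<le> 128 * sqrt d * V * R"
  proof -
    have "(\<Sum>j\<in>J i. b1 i j) \<le> 64 * sqrt d * R * 2 ^ i" for i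
    proof -
      have "(\<Sum>j\<in>J i. (2::real) ^ j) \<le> 2 / (2 - 1) * (R / 2 ^ i)"
        by (rule sum_powers_le_if_bounded[OF _ finJ]) (use R0 in \<open>auto simp: J_def field_simps\<close>)
      then have "32 * sqrt d * (2 ^ i * 2 ^ i) * (\<Sum>j\<in>J i. (2::real) ^ j) \<le> 32 * sqrt d * (2 ^ i * 2 ^ i) * (2 * (R / 2 ^ i))"
        using d by (intro mult_left_mono) auto
      also have "\<dots> = 64 * sqrt d * R * 2 ^ i" by simp
      finally show ?thesis unfolding b1_def sum_distrib_left by (simp add: mult_ac)
    qed
    then have "(\<Sum>i\<in>I. \<Sum>j\<in>J i. b1 i j) \<le> (\<Sum>i\<in>I. 64 * sqrt d * R * 2 ^ i)" by (intro sum_mono)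
    also have "\<dots> = 64 * sqrt d * R * (\<Sum>i\<in>I. 2 ^ i)" by (simp add: sum_distrib_left)
    also have "\<dots> \<le> 64 * sqrt d * R * (2 / (2 - 1) * V)"
      using d R0 V0 by (intro mult_left_mono sum_powers_le_if_bounded finI) (auto simp: I_def)
    finally show ?thesis by (simp add: mult_ac)
  qed
  have prodsum: "(\<Sum>i\<in>I. \<Sum>j\<in>J i. \<rho> ^ i * \<sigma> ^ j) \<le> \<rho> / (\<rho> - 1) * V powr a * (1 / (1 - \<sigma>))"
    if \<rho>: "\<rho> = 2 powr a" "0 < a" and \<sigma>: "0 < \<sigma>" "\<sigma> < 1" for \<rho> \<sigma> a :: real
  proof -
    have \<rho>1: "1 < \<rho>" using \<rho> powr_less_mono[of 0 a 2] by simp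
    have "(\<Sum>i\<in>I. \<Sum>j\<in>J i. \<rho> ^ i * \<sigma> ^ j) \<le> (\<Sum>i\<in>I. \<rho> ^ i * (1 / (1 - \<sigma>)))"
      unfolding sum_distrib_left[symmetric]
      using \<rho>1 \<sigma> by (intro sum_mono mult_left_mono sum_powers_le_if_less_one finJ) auto
    also have "\<dots> = (\<Sum>i\<in>I. \<rho> ^ i) * (1 / (1 - \<sigma>))" by (simp only: sum_distrib_right)
    also have "\<dots> \<le> \<rho> / (\<rho> - 1) * V powr a * (1 / (1 - \<sigma>))"
    proof (intro mult_right_mono sum_powers_le_if_bounded finI \<rho>1)
      fix m assume "m \<in> I"
      then show "\<rho> ^ m \<le> V powr a" unfolding \<rho>(1) two_powr_power[symmetric] I_def
        using \<rho>(2) by (intro powr_mono2) auto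
    qed (use \<sigma> in auto)
    finally show ?thesis .
  qed
  \<comment> \<open>Geometric growth in i, up to the bound V, but decay in j; the positive
    \<epsilon> is what provides the decay.\<close>
  have s2: "(\<Sum>i\<in>I. \<Sum>j\<in>J i. b2 i j)
    \<le> 8 * d powr - \<epsilon> * (2 powr (1 - \<epsilon>) / (2 powr (1 - \<epsilon>) - 1) * V powr (1 - \<epsilon>) * (1 / (1 - 2 powr (- 2 * \<epsilon>))))"
  proof -
    have "(\<Sum>i\<in>I. \<Sum>j\<in>J i. b2 i j) = 8 * d powr - \<epsilon> * (\<Sum>i\<in>I. \<Sum>j\<in>J i. (2 powr (1 - \<epsilon>)) ^ i * (2 powr (- 2 * \<epsilon>)) ^ j)"
      by (simp only: b2_def sum_distrib_left)
    also have "\<dots> \<le> 8 * d powr - \<epsilon> * (2 powr (1 - \<epsilon>) / (2 powr (1 - \<epsilon>) - 1) * V powr (1 - \<epsilon>) * (1 / (1 - 2 powr (- 2 * \<epsilon>))))"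
      using \<epsilon> powr_less_mono[of "- 2 * \<epsilon>" 0 2] by (intro mult_left_mono prodsum) auto
    finally show ?thesis .
  qed
  have s3: "(\<Sum>i\<in>I. \<Sum>j\<in>J i. b3 i j)
    \<le> 4 * d powr (- 1/2) * (2 powr \<epsilon> / (2 powr \<epsilon> - 1) * V powr \<epsilon> * (1 / (1 - 2 powr - 1)))"
  proof -
    have "(\<Sum>i\<in>I. \<Sum>j\<in>J i. b3 i j) = 4 * d powr (- 1/2) * (\<Sum>i\<in>I. \<Sum>j\<in>J i. (2 powr \<epsilon>) ^ i * (2 powr - 1) ^ j)"
      by (simp only: b3_def sum_distrib_left)
    also have "\<dots> \<le> 4 * d powr (- 1/2) * (2 powr \<epsilon> / (2 powr \<epsilon> - 1) * V powr \<epsilon> * (1 / (1 - 2 powr - 1)))"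
      using \<epsilon> by (intro mult_left_mono prodsum) (auto simp: powr_minus)
    finally show ?thesis .
  qed
  define c2 c3 where "c2 = 8 * (2 powr (1 - \<epsilon>) / (2 powr (1 - \<epsilon>) - 1)) * (1 / (1 - 2 powr (- 2 * \<epsilon>)))"
    and "c3 = 8 * (2 powr \<epsilon> / (2 powr \<epsilon> - 1))"
  have c23: "0 \<le> c2" "0 \<le> c3"
    unfolding c2_def c3_def using dyadic_const_parts_nonneg[OF \<epsilon>] by auto
  have s2': "(\<Sum>i\<in>I. \<Sum>j\<in>J i. b2 i j) \<le> c2 * (d powr - \<epsilon> * V powr (1 - \<epsilon>))"
    using s2 unfolding c2_def by (simp add: mult_ac)
  have s3': "(\<Sum>i\<in>I. \<Sum>j\<in>J i. b3 i j) \<le> c3 * (d powr (- 1/2) * V powr \<epsilon>)"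
    using s3 unfolding c3_def by (simp add: mult_ac powr_minus)
  have dc: "dyadic_const \<epsilon> = c2 + c3" unfolding dyadic_const_def c2_def c3_def by simp
  have "0 \<le> c3 * (d powr - \<epsilon> * V powr (1 - \<epsilon>))" "0 \<le> c2 * (d powr (- 1/2) * V powr \<epsilon>)"
    using c23 by auto
  then have tot: "(\<Sum>i\<in>I. \<Sum>j\<in>J i. b1 i j + b2 i j + b3 i j)
    \<le> 128 * sqrt d * V * R + dyadic_const \<epsilon> * (d powr - \<epsilon> * V powr (1 - \<epsilon>) + d powr (- 1/2) * V powr \<epsilon>)"
    unfolding dc sum.distrib using s1 s2' s3' by (simp add: algebra_simps)
  have "sum h \<Lambda> = (\<Sum>t\<in>T. sum h {l \<in> \<Lambda>. (\<alpha> l, \<beta> l) = t})"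
    using sum.group[OF fin finT img, of h] by simp
  also have "\<dots> \<le> (\<Sum>t\<in>T. (\<lambda>(i, j). G * (b1 i j + b2 i j + b3 i j)) t)" by (rule sum_mono[OF cell])
  also have "\<dots> = G * (\<Sum>i\<in>I. \<Sum>j\<in>J i. b1 i j + b2 i j + b3 i j)"
    unfolding T_def using finI finJ by (simp add: sum.Sigma[symmetric] sum_distrib_left)
  also have "\<dots> \<le> G * (128 * sqrt d * V * R + dyadic_const \<epsilon> * (d powr - \<epsilon> * V powr (1 - \<epsilon>) + d powr (- 1/2) * V powr \<epsilon>))"
    using tot G by (rule mult_left_mono)
  finally show ?thesis unfolding h_def .
qed

section \<open>The counting theorem\<close>

lemma card_near_points_long_interval:
  assumes D: "0 \<le> D" and l: "0 \<le> l" and B: "\<And>z. real (card (near_points f q D z)) \<le> B"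
  shows "finite {(x, y) \<in> rational_points q. a \<le> x \<and> x \<le> a + l \<and> \<bar>y - f x\<bar> \<le> D}"
    and "real (card {(x, y) \<in> rational_points q. a \<le> x \<and> x \<le> a + l \<and> \<bar>y - f x\<bar> \<le> D}) \<le> (l + 1) * B"
proof -
  let ?S = "{(x, y) \<in> rational_points q. a \<le> x \<and> x \<le> a + l \<and> \<bar>y - f x\<bar> \<le> D}"
  define K where "K = {k::int. 0 \<le> real_of_int k \<and> of_int k \<le> l}"
  have K: "finite K" "real (card K) \<le> l + 1"
    unfolding K_def using card_int_interval(1)[of 0 l] card_int_interval(2)[of 0 l] l by auto
  have sub: "?S \<subseteq> (\<Union>k\<in>K. near_points f q D (a + of_int k))"
  proof
    fix p assume "p \<in> ?S"
    then obtain x y where p: "p = (x, y)" "(x, y) \<in> rational_points q" "a \<le> x" "x \<le> a + l" "\<bar>y - f x\<bar> \<le> D" by auto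
    then have "\<lfloor>x - a\<rfloor> \<in> K" unfolding K_def by (auto intro: order_trans[OF of_int_floor_le])
    moreover have "p \<in> near_points f q D (a + of_int \<lfloor>x - a\<rfloor>)"
      using p unfolding near_points_def by auto linarith+
    ultimately show "p \<in> (\<Union>k\<in>K. near_points f q D (a + of_int k))" by blast
  qed
  have fin: "finite (\<Union>k\<in>K. near_points f q D (a + of_int k))"
    using K(1) near_points_trivial_bound(1)[OF D] by auto
  then show "finite ?S" using sub finite_subset by blast
  have "card ?S \<le> card (\<Union>k\<in>K. near_points f q D (a + of_int k))" by (rule card_mono[OF fin sub])
  also have "\<dots> \<le> (\<Sum>k\<in>K. card (near_points f q D (a + of_int k)))" by (rule card_UN_le[OF K(1)])
  finally have "real (card ?S) \<le> real (\<Sum>k\<in>K. card (near_points f q D (a + of_int k)))" by (simp only: of_nat_le_iff)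
  also have "\<dots> = (\<Sum>k\<in>K. real (card (near_points f q D (a + of_int k))))" by simp
  also have "\<dots> \<le> (\<Sum>k\<in>K. B)" by (rule sum_mono) (rule B)
  also have "\<dots> = real (card K) * B" by simp
  also have "\<dots> \<le> (l + 1) * B"
  proof (rule mult_right_mono[OF K(2)])
    show "0 \<le> B" using B[of 0] by (meson of_nat_0_le_iff order_trans)
  qed
  finally show "real (card ?S) \<le> (l + 1) * B" .
qed

text \<open>This is where the induction hypothesis is applied to the dual function.\<close>
lemma sum_flat_lines:
  assumes uc: "uniformly_convex A f g" and \<epsilon>: "0 < \<epsilon>" "\<epsilon> < 1 / 2" and d: "0 < d"
    and P: "P = near_points f Q d z" and V: "0 \<le> V" and H: "0 \<le> H"
    and IH: "\<And>f g q z D. uniformly_convex A f g \<Longrightarrow> real q \<le> 2 * V \<Longrightarrow> 0 < D \<Longrightarrow>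
      real (card (near_points f q D z)) \<le> H * counting_bound \<epsilon> (real q) D"
  shows "(\<Sum>l\<in>{l \<in> rich_lines P V. \<not> 2 * A < \<bar>fst l - g z\<bar>}. real (card (on_line P l)))
    \<le> 150 * A ^ 3 * (d * (real Q)\<^sup>2) * H * (1280 * A\<^sup>2 * d * V * (real Q)\<^sup>2
      + dyadic_const \<epsilon> * (d powr - \<epsilon> * V powr (1 - \<epsilon>) + d powr (- 1/2) * V powr \<epsilon>))"
proof -
  have A: "A \<ge> 1" using uc unfolding uniformly_convex_def by simp
  obtain h where h: "\<And>u. g (h u) = u" "\<And>x. h (g x) = x" "uniformly_convex A (\<lambda>u. u * h u - f (h u)) h"
    using uniformly_convex_dual[OF uc] by blast
  define F where "F u = u * h u - f (h u)" for u
  have ucF: "uniformly_convex A F h" using h(3) unfolding F_def .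
  define \<Lambda> where "\<Lambda> = {l \<in> rich_lines P V. \<not> 2 * A < \<bar>fst l - g z\<bar>}"
  define v where "v l = common_den (fst l) (snd l)" for l
  define e where "e l = max \<bar>F (fst l) - snd l\<bar> d" for l
  have finP: "finite P" using near_points_trivial_bound(1)[of d] d P by simp
  have fin\<Lambda>: "finite \<Lambda>" unfolding \<Lambda>_def using finite_rich_lines[OF finP] by simp
  define R where "R = 10 * A\<^sup>2 * sqrt d * (real Q)\<^sup>2"
  have sdd: "sqrt d * sqrt d = d" using d by simp
  have line: "real (card (on_line P l)) \<le> 30 * A\<^sup>2 * d * (real Q)\<^sup>2 * (1 / (real (v l) * sqrt (e l)))"
    "real (v l) * sqrt (e l) \<le> R * sqrt d" if l: "l \<in> \<Lambda>" for l
  proof -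
    have l': "l \<in> rich_lines P V" using l unfolding \<Lambda>_def by simp
    have e: "e l = max \<bar>fst l * h (fst l) - f (h (fst l)) - snd l\<bar> d" unfolding e_def F_def ..
    note c = card_on_line_flat[OF uc d h(1) P l' refl e, folded v_def]
    show "real (card (on_line P l)) \<le> 30 * A\<^sup>2 * d * (real Q)\<^sup>2 * (1 / (real (v l) * sqrt (e l)))" using c(1) by simp
    have "R * sqrt d = 10 * A\<^sup>2 * (sqrt d * sqrt d) * (real Q)\<^sup>2" unfolding R_def by simp
    then show "real (v l) * sqrt (e l) \<le> R * sqrt d" using c(2) unfolding sdd by simp
  qed
  have cbn: "0 \<le> counting_bound \<epsilon> (real q) D" if "0 < D" for q D
    using that unfolding counting_bound_def by auto
  have "(\<Sum>l\<in>\<Lambda>. 1 / (real (v l) * sqrt (e l)))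
    \<le> (5 * A * H) * (128 * sqrt d * V * R + dyadic_const \<epsilon> * (d powr - \<epsilon> * V powr (1 - \<epsilon>) + d powr (- 1/2) * V powr \<epsilon>))"
  proof (rule dyadic_sum[OF \<epsilon> d fin\<Lambda> _ V])
    show "0 \<le> 5 * A * H" "0 \<le> R" using A H d unfolding R_def by auto
    fix l assume l: "l \<in> \<Lambda>"
    then have l': "l \<in> rich_lines P V" unfolding \<Lambda>_def by simp
    show "0 < v l" "real (v l) \<le> V" using rich_linesD[OF l'] unfolding v_def by auto
    show "d \<le> e l" unfolding e_def by simp
    show "real (v l) * sqrt (e l) \<le> R * sqrt d" by (rule line(2)[OF l])
  next
    fix q :: nat and D :: real assume q: "1 \<le> q" "real q \<le> 2 * V" and D: "d \<le> D"
    \<comment> \<open>Flatness puts the first coordinate of the dual point into an interval of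
      length 4 A about \<open>g z\<close>, hence into at most 4 A + 1 \<le> 5 A unit windows for the
      dual function. This is why steep lines had to be split off.\<close>
    define S where "S = {(x, y) \<in> rational_points q. (g z - 2 * A) \<le> x \<and> x \<le> (g z - 2 * A) + 4 * A \<and> \<bar>y - F x\<bar> \<le> D}"
    have D0: "0 < D" using d D by simp
    have b: "real (card (near_points F q D z')) \<le> H * counting_bound \<epsilon> (real q) D" for z'
      by (rule IH[OF ucF q(2) D0])
    have S: "finite S" "real (card S) \<le> (4 * A + 1) * (H * counting_bound \<epsilon> (real q) D)"
      unfolding S_def using card_near_points_long_interval[OF _ _ b, of "4 * A" "g z - 2 * A"] D0 A by auto
    have "{l \<in> \<Lambda>. v l \<le> q \<and> e l \<le> D} \<subseteq> S"
    proof
      fix l assume l: "l \<in> {l \<in> \<Lambda>. v l \<le> q \<and> e l \<le> D}"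
      obtain U W where UW: "l = (U, W)" by (cases l)
      have l': "l \<in> rich_lines P V" "\<bar>U - g z\<bar> \<le> 2 * A" "v l \<le> q" "\<bar>F U - W\<bar> \<le> D"
        using l unfolding \<Lambda>_def e_def UW by auto
      have "l \<in> rational_points q"
        using rich_linesD(1-3)[OF l'(1)] l'(3) unfolding UW v_def rational_points_def
        by (auto intro!: bexI[of _ "common_den U W"])
      then show "l \<in> S" unfolding S_def UW using l'(2,4) by (auto simp: abs_le_iff)
    qed
    then have "card {l \<in> \<Lambda>. v l \<le> q \<and> e l \<le> D} \<le> card S" by (rule card_mono[OF S(1)])
    then have "real (card {l \<in> \<Lambda>. v l \<le> q \<and> e l \<le> D}) \<le> real (card S)" by (simp only: of_nat_le_iff)
    also have "\<dots> \<le> (4 * A + 1) * (H * counting_bound \<epsilon> (real q) D)" by (rule S(2))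
    also have "\<dots> \<le> (5 * A) * (H * counting_bound \<epsilon> (real q) D)"
      using A H cbn[OF D0] by (intro mult_right_mono) auto
    finally show "real (card {l \<in> \<Lambda>. v l \<le> q \<and> e l \<le> D}) \<le> 5 * A * H * counting_bound \<epsilon> (real q) D" by simp
  qed
  also have "128 * sqrt d * V * R = 1280 * A\<^sup>2 * (sqrt d * sqrt d) * V * (real Q)\<^sup>2" unfolding R_def by simp
  finally have main: "(\<Sum>l\<in>\<Lambda>. 1 / (real (v l) * sqrt (e l)))
    \<le> (5 * A * H) * (1280 * A\<^sup>2 * d * V * (real Q)\<^sup>2 + dyadic_const \<epsilon> * (d powr - \<epsilon> * V powr (1 - \<epsilon>) + d powr (- 1/2) * V powr \<epsilon>))"
    (is "_ \<le> _ * ?X") unfolding sdd .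
  have "(\<Sum>l\<in>\<Lambda>. real (card (on_line P l))) \<le> (\<Sum>l\<in>\<Lambda>. 30 * A\<^sup>2 * d * (real Q)\<^sup>2 * (1 / (real (v l) * sqrt (e l))))"
    by (rule sum_mono) (rule line(1))
  also have "\<dots> = 30 * A\<^sup>2 * d * (real Q)\<^sup>2 * (\<Sum>l\<in>\<Lambda>. 1 / (real (v l) * sqrt (e l)))" by (simp only: sum_distrib_left)
  also have "\<dots> \<le> 30 * A\<^sup>2 * d * (real Q)\<^sup>2 * ((5 * A * H) * ?X)"
    using main d by (intro mult_left_mono) auto
  also have "\<dots> = 150 * A ^ 3 * (d * (real Q)\<^sup>2) * H * ?X" by (simp add: power2_eq_square power3_eq_cube)
  finally show ?thesis unfolding \<Lambda>_def .
qed

text \<open>Passing to the dual points interchanges the last two terms of \<open>counting_bound\<close>, so both are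
  needed in the induction hypothesis; for \<open>D q^2 \<ge> 1\<close> the last one is dominated by the other.\<close>
definition main_terms :: "real \<Rightarrow> real \<Rightarrow> real \<Rightarrow> real" where
  "main_terms \<epsilon> q D = D * q ^ 3 + D powr (1/2 - \<epsilon>) * q powr (2 - \<epsilon>)"

lemma powr_le_second_main_term:
  fixes \<epsilon> d q :: real
  assumes "0 < \<epsilon>" "\<epsilon> < 1 / 2" "0 < d" "0 < q" "1 \<le> d * q\<^sup>2"
  shows "q powr (1 + \<epsilon>) \<le> d powr (1/2 - \<epsilon>) * q powr (2 - \<epsilon>)"
proof -
  have "1 \<le> (d * q\<^sup>2) powr (1/2 - \<epsilon>)" using assms by (intro ge_one_powr_ge_zero) auto
  also have "\<dots> = d powr (1/2 - \<epsilon>) * q powr (1 - 2 * \<epsilon>)"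
    using assms by (simp add: powr_mult powr_powr algebra_simps flip: powr_numeral)
  finally have "1 * q powr (1 + \<epsilon>) \<le> d powr (1/2 - \<epsilon>) * q powr (1 - 2 * \<epsilon>) * q powr (1 + \<epsilon>)"
    by (rule mult_right_mono) simp
  also have "\<dots> = d powr (1/2 - \<epsilon>) * (q powr (1 - 2 * \<epsilon>) * q powr (1 + \<epsilon>))" by simp
  also have "q powr (1 - 2 * \<epsilon>) * q powr (1 + \<epsilon>) = q powr (2 - \<epsilon>)"
    unfolding powr_add[symmetric] by (simp add: algebra_simps)
  finally show ?thesis by simp
qed

text \<open>The hypothesis is for all D > 0, the conclusion only for 1/Q^2 \<le> d \<le> 1/Q. What
  does not come from the dual count is O(M d Q^3), with 448 = 16 + 432 from multiple fibres and
  steep lines. What does come from it carries the gain M^-\<epsilon> in front of H.\<close>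

lemma induction_step:
  assumes uc: "uniformly_convex A f g" and \<epsilon>: "0 < \<epsilon>" "\<epsilon> < 1 / 2"
    and d: "0 < d" "1 \<le> d * (real Q)\<^sup>2" "d * real Q \<le> 1" and M: "2 \<le> M" and H: "0 \<le> H"
    and IH: "\<And>f g q z D. uniformly_convex A f g \<Longrightarrow> q < Q \<Longrightarrow> 0 < D \<Longrightarrow>
      real (card (near_points f q D z)) \<le> H * counting_bound \<epsilon> (real q) D"
  shows "real (card (near_points f Q d z)) \<le> (real M * (8 * A + 9) + 448) * (d * real Q ^ 3)
    + 300 * A ^ 3 * (1280 * A\<^sup>2 + dyadic_const \<epsilon>) * real M powr - \<epsilon> * H * main_terms \<epsilon> (real Q) d"
proof -
  have A: "A \<ge> 1" using uc unfolding uniformly_convex_def by simp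
  have Q: "0 < real Q" using d by (cases "Q = 0") auto
  have Q1: "1 \<le> real Q" using Q by simp
  have M0: "0 < real M" using M by simp
  define P where "P = near_points f Q d z"
  define L where "L = 1 / ((8 * A + 8) * d * real Q ^ 3)"
  define V where "V = L * (real Q)\<^sup>2 / real M"
  have pos: "0 < (8 * A + 8) * d * real Q ^ 3" using A d Q by simp
  then have L: "L * ((8 * A + 8) * d * real Q ^ 3) = 1" unfolding L_def by (metis divide_self less_irrefl times_divide_eq_left mult_1)
  have Veq: "V * (real M * (8 * A + 8) * d * real Q) = 1"
  proof -
    have "V * (real M * (8 * A + 8) * d * real Q) = L * ((8 * A + 8) * d * real Q ^ 3) * (real M / real M)"
      unfolding V_def by (simp add: power2_eq_square power3_eq_cube mult_ac)
    then show ?thesis using L M0 by simp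
  qed
  have V0: "0 < V" unfolding V_def L_def using pos Q M0 by simp
  have Vbound: "V * (real M * d * real Q) \<le> 1"
  proof -
    have "V * (real M * d * real Q) * 1 \<le> V * (real M * d * real Q) * (8 * A + 8)"
      using V0 M0 d Q A by (intro mult_left_mono) auto
    then show ?thesis using Veq by (simp add: mult_ac)
  qed
  have dd: "1 \<le> d * (real Q)\<^sup>2" by fact
  have cube: "1 \<le> d * real Q ^ 3"
  proof -
    have "1 * 1 \<le> (d * (real Q)\<^sup>2) * real Q" using dd Q1 by (intro mult_mono) auto
    then show ?thesis by (simp add: power2_eq_square power3_eq_cube mult.assoc)
  qed
  have "d * 1 \<le> d * real Q" using Q1 d(1) by (intro mult_left_mono) auto
  then have d1: "d \<le> 1" using d(3) by linarith
  \<comment> \<open>The dyadic cells use denominators up to 2 V, so this is the decrease on which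
    strong induction rests. V is at most 1 / (M d Q), and 1 / (d Q) \<le> Q by d Q^2 \<ge>
    1.\<close>
  have smallV: "2 * V < real Q"
  proof -
    have "2 * V * 16 * (d * real Q) \<le> V * (real M * (8 * A + 8) * d * real Q)"
    proof -
      have "2 * 16 \<le> real M * (8 * A + 8)" using M A by (intro mult_mono) auto
      then have "2 * 16 * (V * d * real Q) \<le> real M * (8 * A + 8) * (V * d * real Q)"
        using V0 d Q by (intro mult_right_mono) auto
      then show ?thesis by (simp add: mult_ac)
    qed
    also have "\<dots> = 1" by (rule Veq)
    also have "1 < 16 * real Q * (d * real Q)" using dd by (simp add: power2_eq_square mult_ac)
    finally have "2 * V * 16 * (d * real Q) < real Q * 16 * (d * real Q)" by (simp add: mult_ac)
    then show ?thesis using d Q by (simp add: mult_less_cancel_right)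
  qed
  have dq: "d\<^sup>2 * real Q ^ 4 \<le> d * real Q ^ 3"
  proof -
    have "(d * real Q) * (d * real Q ^ 3) \<le> 1 * (d * real Q ^ 3)" using d Q by (intro mult_right_mono) auto
    then show ?thesis by (simp add: power2_eq_square power3_eq_cube power4_eq_xxxx mult_ac)
  qed
  have VdQ: "V * (d * (real Q)\<^sup>2)\<^sup>2 * real M \<le> d * real Q ^ 3"
  proof -
    have "V * (real M * d * real Q) * (d * real Q ^ 3) \<le> 1 * (d * real Q ^ 3)"
      using Vbound d Q by (intro mult_right_mono) auto
    then show ?thesis by (simp add: power2_eq_square power3_eq_cube mult_ac)
  qed
  have dec: "real (card P) \<le> real M * ((8 * A + 8) * d * real Q ^ 3 + 1) + 16 * d\<^sup>2 * real Q ^ 4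
    + (\<Sum>l\<in>rich_lines P V. real (card (on_line P l)))"
    unfolding V_def by (rule line_decomposition[OF uc d(1,2) L M P_def])
  have finP: "finite P" using near_points_trivial_bound(1)[of d] d P_def by simp
  have split: "(\<Sum>l\<in>rich_lines P V. real (card (on_line P l)))
    = (\<Sum>l\<in>{l \<in> rich_lines P V. 2 * A < \<bar>fst l - g z\<bar>}. real (card (on_line P l)))
    + (\<Sum>l\<in>{l \<in> rich_lines P V. \<not> 2 * A < \<bar>fst l - g z\<bar>}. real (card (on_line P l)))"
    using finite_rich_lines[OF finP]
    by (subst sum.union_disjoint[symmetric]) (auto intro!: sum.cong)
  have steep: "(\<Sum>l\<in>{l \<in> rich_lines P V. 2 * A < \<bar>fst l - g z\<bar>}. real (card (on_line P l))) \<le> 432 * (d * real Q ^ 3)"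
  proof -
    have "(\<Sum>l\<in>{l \<in> rich_lines P V. 2 * A < \<bar>fst l - g z\<bar>}. real (card (on_line P l))) \<le> 432 * V * (d * (real Q)\<^sup>2)\<^sup>2"
      by (rule sum_steep_lines[OF uc d(1) d1 d(2) P_def]) (use V0 in simp)
    also have "V * (d * (real Q)\<^sup>2)\<^sup>2 * 1 \<le> V * (d * (real Q)\<^sup>2)\<^sup>2 * real M"
      using V0 M by (intro mult_left_mono) auto
    then have "432 * V * (d * (real Q)\<^sup>2)\<^sup>2 \<le> 432 * (d * real Q ^ 3)" using VdQ by simp
    finally show ?thesis .
  qed
  define DC where "DC = dyadic_const \<epsilon>"
  have DC: "0 \<le> DC"
    unfolding DC_def dyadic_const_def
    by (intro add_nonneg_nonneg dyadic_const_parts_nonneg \<epsilon>)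
  define m where "m = real M powr - \<epsilon>"
  have m0: "0 \<le> m" unfolding m_def by simp
  define B where "B = counting_bound \<epsilon> (real Q) d"
  have flat: "(\<Sum>l\<in>{l \<in> rich_lines P V. \<not> 2 * A < \<bar>fst l - g z\<bar>}. real (card (on_line P l)))
    \<le> 150 * A ^ 3 * H * ((1280 * A\<^sup>2 + DC) * m * B)"
  proof -
    have t1: "d * (real Q)\<^sup>2 * (d * V * (real Q)\<^sup>2) \<le> m * (d * real Q ^ 3)"
    proof -
      have "V * (d * (real Q)\<^sup>2)\<^sup>2 \<le> d * real Q ^ 3 / real M" using VdQ M0 by (simp add: le_divide_eq)
      also have "\<dots> = d * real Q ^ 3 * real M powr - 1" using M0 by (simp add: powr_minus divide_inverse)
      also have "\<dots> \<le> d * real Q ^ 3 * m" unfolding m_def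
        using \<epsilon> M d Q by (intro mult_left_mono powr_mono) auto
      finally show ?thesis by (simp add: power2_eq_square mult_ac)
    qed
    have Vp: "V powr a * (d powr a * real Q powr a) \<le> real M powr - a" if a: "0 < a" for a
    proof -
      have "(V * (real M * d * real Q)) powr a \<le> 1 powr a" using Vbound V0 M0 d Q a by (intro powr_mono2) auto
      then have "V powr a * (d powr a * real Q powr a) * real M powr a \<le> 1"
        using V0 M0 d Q by (simp add: powr_mult mult_ac)
      then have "V powr a * (d powr a * real Q powr a) \<le> 1 / real M powr a"
        using M0 by (subst pos_le_divide_eq) auto
      then show ?thesis by (simp add: powr_minus_divide)
    qed
    \<comment> \<open>The second term of the hypothesis becomes the third: V M d Q \<le> 1 turns (V
      d Q)^(1-\<epsilon>) into M^-(1-\<epsilon>), which is at most M^-\<epsilon> as \<epsilon> <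
      1/2, and Q^(1+\<epsilon>) remains.\<close>
    have t2: "d * (real Q)\<^sup>2 * (d powr - \<epsilon> * V powr (1 - \<epsilon>)) \<le> m * real Q powr (1 + \<epsilon>)"
    proof -
      have "d * d powr - \<epsilon> = d powr (1 - \<epsilon>)" using d powr_add[of d 1 "- \<epsilon>"] by simp
      moreover have "(real Q)\<^sup>2 = real Q powr (1 - \<epsilon>) * real Q powr (1 + \<epsilon>)"
        unfolding powr_add[symmetric] using Q by (simp add: powr_numeral)
      ultimately have "d * (real Q)\<^sup>2 * (d powr - \<epsilon> * V powr (1 - \<epsilon>))
        = (V powr (1 - \<epsilon>) * (d powr (1 - \<epsilon>) * real Q powr (1 - \<epsilon>))) * real Q powr (1 + \<epsilon>)"
        by (simp add: mult_ac)
      also have "\<dots> \<le> real M powr - (1 - \<epsilon>) * real Q powr (1 + \<epsilon>)"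
        using Vp[of "1 - \<epsilon>"] \<epsilon> by (intro mult_right_mono) auto
      also have "\<dots> \<le> m * real Q powr (1 + \<epsilon>)" unfolding m_def
        using \<epsilon> M by (intro mult_right_mono powr_mono) auto
      finally show ?thesis .
    qed
    \<comment> \<open>The third term becomes the second. Here (V d Q)^\<epsilon> yields exactly
      M^-\<epsilon>, so this term limits the gain.\<close>
    have t3: "d * (real Q)\<^sup>2 * (d powr (- 1/2) * V powr \<epsilon>) \<le> m * (d powr (1/2 - \<epsilon>) * real Q powr (2 - \<epsilon>))"
    proof -
      have "d * d powr (- 1/2) = d powr (1/2 - \<epsilon>) * d powr \<epsilon>"
        using d powr_add[of d 1 "- 1/2"] powr_add[of d "1/2 - \<epsilon>" \<epsilon>] by simp
      moreover have "(real Q)\<^sup>2 = real Q powr (2 - \<epsilon>) * real Q powr \<epsilon>"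
        unfolding powr_add[symmetric] using Q by (simp add: powr_numeral)
      ultimately have "d * (real Q)\<^sup>2 * (d powr (- 1/2) * V powr \<epsilon>)
        = (V powr \<epsilon> * (d powr \<epsilon> * real Q powr \<epsilon>)) * (d powr (1/2 - \<epsilon>) * real Q powr (2 - \<epsilon>))"
        by (simp add: mult_ac)
      also have "\<dots> \<le> m * (d powr (1/2 - \<epsilon>) * real Q powr (2 - \<epsilon>))" unfolding m_def
        using Vp[of \<epsilon>] \<epsilon> by (intro mult_right_mono) auto
      finally show ?thesis .
    qed
    have "(\<Sum>l\<in>{l \<in> rich_lines P V. \<not> 2 * A < \<bar>fst l - g z\<bar>}. real (card (on_line P l)))
      \<le> 150 * A ^ 3 * (d * (real Q)\<^sup>2) * H * (1280 * A\<^sup>2 * d * V * (real Q)\<^sup>2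
      + DC * (d powr - \<epsilon> * V powr (1 - \<epsilon>) + d powr (- 1/2) * V powr \<epsilon>))"
      unfolding DC_def
    proof (rule sum_flat_lines[OF uc \<epsilon> d(1) P_def _ H])
      fix f g q z D assume "uniformly_convex A f g" "real q \<le> 2 * V" "0 < (D::real)"
      with smallV IH show "real (card (near_points f q D z)) \<le> H * counting_bound \<epsilon> (real q) D" by force
    qed (use V0 in simp)
    also have "\<dots> = 150 * A ^ 3 * H * (1280 * A\<^sup>2 * (d * (real Q)\<^sup>2 * (d * V * (real Q)\<^sup>2))
      + DC * (d * (real Q)\<^sup>2 * (d powr - \<epsilon> * V powr (1 - \<epsilon>)) + d * (real Q)\<^sup>2 * (d powr (- 1/2) * V powr \<epsilon>)))"
      by (simp add: algebra_simps)
    also have "\<dots> \<le> 150 * A ^ 3 * H * (1280 * A\<^sup>2 * (m * B) + DC * (m * B))"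
    proof (intro mult_left_mono add_mono)
      have nn: "0 \<le> d * real Q ^ 3" "0 \<le> d powr (1/2 - \<epsilon>) * real Q powr (2 - \<epsilon>)" "0 \<le> real Q powr (1 + \<epsilon>)"
        using d by auto
      have "d * (real Q)\<^sup>2 * (d * V * (real Q)\<^sup>2) \<le> m * (d * real Q ^ 3)" by (rule t1)
      also have "\<dots> \<le> m * B" unfolding B_def counting_bound_def using nn by (intro mult_left_mono m0) linarith
      finally show "d * (real Q)\<^sup>2 * (d * V * (real Q)\<^sup>2) \<le> m * B" .
      have "d * (real Q)\<^sup>2 * (d powr - \<epsilon> * V powr (1 - \<epsilon>)) + d * (real Q)\<^sup>2 * (d powr (- 1/2) * V powr \<epsilon>)
        \<le> m * (real Q powr (1 + \<epsilon>) + d powr (1/2 - \<epsilon>) * real Q powr (2 - \<epsilon>))"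
        using t2 t3 by (simp add: distrib_left)
      also have "\<dots> \<le> m * B" unfolding B_def counting_bound_def using nn by (intro mult_left_mono m0) linarith
      finally show "d * (real Q)\<^sup>2 * (d powr - \<epsilon> * V powr (1 - \<epsilon>)) + d * (real Q)\<^sup>2 * (d powr (- 1/2) * V powr \<epsilon>) \<le> m * B" .
    qed (use A H DC in auto)
    finally show ?thesis by (simp add: algebra_simps)
  qed
  have "B \<le> 2 * main_terms \<epsilon> (real Q) d"
    using powr_le_second_main_term[OF \<epsilon> d(1) Q d(2)] d
    unfolding B_def counting_bound_def main_terms_def by (smt (verit) mult_nonneg_nonneg zero_le_power of_nat_0_le_iff)
  then have "150 * A ^ 3 * H * ((1280 * A\<^sup>2 + DC) * m * B) \<le> 150 * A ^ 3 * H * ((1280 * A\<^sup>2 + DC) * m * (2 * main_terms \<epsilon> (real Q) d))"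
    using A H DC m0 by (intro mult_left_mono) auto
  also have "\<dots> = 300 * A ^ 3 * (1280 * A\<^sup>2 + DC) * m * H * main_terms \<epsilon> (real Q) d" by simp
  finally have flat': "150 * A ^ 3 * H * ((1280 * A\<^sup>2 + DC) * m * B) \<le> 300 * A ^ 3 * (1280 * A\<^sup>2 + DC) * m * H * main_terms \<epsilon> (real Q) d" .
  have "real M * ((8 * A + 8) * d * real Q ^ 3 + 1) \<le> real M * ((8 * A + 9) * (d * real Q ^ 3))"
    using cube by (intro mult_left_mono) (auto simp: algebra_simps)
  moreover have "(real M * (8 * A + 9) + 448) * (d * real Q ^ 3)
    = real M * ((8 * A + 9) * (d * real Q ^ 3)) + 16 * (d * real Q ^ 3) + 432 * (d * real Q ^ 3)"
    by (simp add: algebra_simps)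
  ultimately show ?thesis
    using dec split steep flat flat' dq unfolding P_def[symmetric] m_def[symmetric] DC_def[symmetric] by linarith
qed

text \<open>Below D = q^-2 the strip is enlarged to d = q^-2, where the main terms are at most 2
  q^(1+\<epsilon>). The third term of the counting bound is thus the price for dropping the
  condition D q^2 \<ge> 1.\<close>

lemma counting_bound_from_main_terms:
  assumes \<epsilon>: "0 < \<epsilon>" "\<epsilon> < 1 / 2" and K: "0 \<le> K" and D: "0 < D"
    and bound: "\<And>d. 0 < d \<Longrightarrow> 1 \<le> d * (real q)\<^sup>2 \<Longrightarrow> real (card (near_points f q d z)) \<le> K * main_terms \<epsilon> (real q) d"
  shows "real (card (near_points f q D z)) \<le> 2 * K * counting_bound \<epsilon> (real q) D"
proof (cases "q = 0")
  case True
  then have "near_points f q D z = {}" unfolding near_points_def rational_points_def by auto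
  then show ?thesis using K D unfolding counting_bound_def by simp
next
  case False
  then have q: "0 < real q" "1 \<le> real q" by auto
  have nn: "0 \<le> D * real q ^ 3" "0 \<le> D powr (1/2 - \<epsilon>) * real q powr (2 - \<epsilon>)" "0 \<le> real q powr (1 + \<epsilon>)"
    using D by auto
  show ?thesis
  proof (cases "1 \<le> D * (real q)\<^sup>2")
    case True
    have "main_terms \<epsilon> (real q) D \<le> 2 * counting_bound \<epsilon> (real q) D"
    proof -
      have "a + b \<le> 2 * (a + b + c)" if "0 \<le> a" "0 \<le> b" "0 \<le> c" for a b c :: real using that by simp
      from this[OF nn] show ?thesis unfolding main_terms_def counting_bound_def .
    qed
    then have "K * main_terms \<epsilon> (real q) D \<le> K * (2 * counting_bound \<epsilon> (real q) D)"
      using K by (rule mult_left_mono)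
    then show ?thesis using bound[OF D True] by simp
  next
    case F: False
    define d where "d = 1 / (real q)\<^sup>2"
    have d: "0 < d" "d * (real q)\<^sup>2 = 1" unfolding d_def using q by auto
    have "D \<le> d" using F q unfolding d_def by (simp add: field_simps)
    then have "card (near_points f q D z) \<le> card (near_points f q d z)"
      using d by (intro card_mono near_points_mono near_points_trivial_bound(1)) auto
    then have "real (card (near_points f q D z)) \<le> K * main_terms \<epsilon> (real q) d"
      using bound[of d] d by linarith
    also have "main_terms \<epsilon> (real q) d \<le> 2 * real q powr (1 + \<epsilon>)"
    proof -
      have "d * real q ^ 3 = (d * (real q)\<^sup>2) * real q" by (simp add: power2_eq_square power3_eq_cube)
      also have "\<dots> = real q powr 1" using d q by simp
      also have "\<dots> \<le> real q powr (1 + \<epsilon>)" using \<epsilon> q by (intro powr_mono) auto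
      finally have a: "d * real q ^ 3 \<le> real q powr (1 + \<epsilon>)" .
      have "d = real q powr - 2" unfolding d_def using q by (simp add: powr_minus divide_inverse powr_numeral)
      then have "d powr (1/2 - \<epsilon>) * real q powr (2 - \<epsilon>) = real q powr (1 + \<epsilon>)"
        using q by (simp add: powr_powr powr_add[symmetric] algebra_simps)
      with a show ?thesis unfolding main_terms_def by linarith
    qed
    also have "2 * real q powr (1 + \<epsilon>) \<le> 2 * counting_bound \<epsilon> (real q) D"
      unfolding counting_bound_def using nn(1,2) by simp
    finally show ?thesis using K by (simp add: mult_left_mono)
  qed
qed

text \<open>Closes the induction. \<open>M\<close> is fixed by \<open>A\<close> and \<epsilon>
  alone, before the constant \<open>K\<close>, so the direct contribution \<open>C\<close> is a
  constant as well; K = 2 C reserves one half of the bound for it and the other half for the dual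
  count.\<close>

lemma near_points_bound:
  assumes A: "1 \<le> A" and \<epsilon>: "0 < \<epsilon>" "\<epsilon> < 1 / 2"
  obtains K where "0 \<le> K"
    and "\<And>f g Q d z. uniformly_convex A f g \<Longrightarrow> 0 < d \<Longrightarrow> 1 \<le> d * (real Q)\<^sup>2 \<Longrightarrow>
      real (card (near_points f Q d z)) \<le> K * main_terms \<epsilon> (real Q) d"
proof -
  \<comment> \<open>The factor 1200 is the 300 of the induction step, times 2 from extending the
    bound to all D > 0, times 2 from K = 2 C. With M^\<epsilon> \<ge> X the dual count contributes
    at most C.\<close>
  define X where "X = 1200 * A ^ 3 * (1280 * A\<^sup>2 + dyadic_const \<epsilon>)"
  have "0 \<le> dyadic_const \<epsilon>" unfolding dyadic_const_def
    by (intro add_nonneg_nonneg dyadic_const_parts_nonneg \<epsilon>)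
  then have X: "0 < X" unfolding X_def using A by (intro mult_pos_pos add_pos_nonneg) auto
  define M where "M = nat \<lceil>X powr (1 / \<epsilon>)\<rceil> + 2"
  have M: "2 \<le> M" unfolding M_def by simp
  have "X powr (1 / \<epsilon>) \<le> real M" unfolding M_def by linarith
  then have "(X powr (1 / \<epsilon>)) powr \<epsilon> \<le> real M powr \<epsilon>" using \<epsilon> by (intro powr_mono2) auto
  then have XM: "X \<le> real M powr \<epsilon>" using X \<epsilon> by (simp add: powr_powr)
  have small: "X * real M powr - \<epsilon> \<le> 1"
  proof -
    have "X * real M powr - \<epsilon> \<le> real M powr \<epsilon> * real M powr - \<epsilon>" using XM by (intro mult_right_mono) auto
    also have "\<dots> = 1" using M by (simp add: powr_add[symmetric])
    finally show ?thesis .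
  qed
  define C where "C = real M * (8 * A + 9) + 448"
  have C: "448 \<le> C" unfolding C_def using A by simp
  define K where "K = 2 * C"
  have K: "0 \<le> K" using C unfolding K_def by simp
  have main: "real (card (near_points f Q d z)) \<le> K * main_terms \<epsilon> (real Q) d"
    if "uniformly_convex A f g" "0 < d" "1 \<le> d * (real Q)\<^sup>2" for f g Q d z
    using that
  proof (induction Q arbitrary: f g d z rule: less_induct)
    case (less Q)
    have nn: "0 \<le> d * real Q ^ 3" "0 \<le> d powr (1/2 - \<epsilon>) * real Q powr (2 - \<epsilon>)" using less.prems by auto
    have mt: "d * real Q ^ 3 \<le> main_terms \<epsilon> (real Q) d" unfolding main_terms_def using nn by linarith
    then have mt0: "0 \<le> main_terms \<epsilon> (real Q) d" using nn by linarith
    show ?case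
    proof (cases "1 \<le> d * real Q")
      case True
      have "real (card (near_points f Q d z)) \<le> 6 * d * real Q ^ 3" by (rule near_points_bound_large[OF True])
      also have "\<dots> \<le> 6 * main_terms \<epsilon> (real Q) d" using mt by simp
      also have "\<dots> \<le> K * main_terms \<epsilon> (real Q) d" using mt0 C unfolding K_def by (intro mult_right_mono) auto
      finally show ?thesis .
    next
      case False
      have "real (card (near_points f Q d z)) \<le> C * (d * real Q ^ 3)
        + 300 * A ^ 3 * (1280 * A\<^sup>2 + dyadic_const \<epsilon>) * real M powr - \<epsilon> * (2 * K) * main_terms \<epsilon> (real Q) d"
        unfolding C_def
      proof (rule induction_step[OF less.prems(1) \<epsilon> less.prems(2,3) _ M])
        fix f g q z D assume *: "uniformly_convex A f g" "q < Q" "0 < (D::real)"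
        show "real (card (near_points f q D z)) \<le> 2 * K * counting_bound \<epsilon> (real q) D"
          by (rule counting_bound_from_main_terms[OF \<epsilon> K *(3)]) (rule less.IH[OF *(2,1)])
      qed (use False K in auto)
      also have "300 * A ^ 3 * (1280 * A\<^sup>2 + dyadic_const \<epsilon>) * real M powr - \<epsilon> * (2 * K) * main_terms \<epsilon> (real Q) d
        = (X * real M powr - \<epsilon>) * (C * main_terms \<epsilon> (real Q) d)" unfolding X_def K_def by simp
      also have "\<dots> \<le> 1 * (C * main_terms \<epsilon> (real Q) d)"
        using small mt0 C by (intro mult_right_mono) auto
      also have "C * (d * real Q ^ 3) \<le> C * main_terms \<epsilon> (real Q) d" using mt C by (intro mult_left_mono) auto
      finally show ?thesis unfolding K_def by simp
    qed
  qed
  show thesis by (rule that[OF K main])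
qed

text \<open>For d \<ge> Q^(\<eta> - 2) the second main term is absorbed by the first, which amounts
  to d^(1/2+\<epsilon>) Q^(1+\<epsilon>) \<ge> 1. With \<epsilon> = \<eta>/4 the exponent of Q at
  the lower end of the range is (\<eta> + \<eta>^2) / 4 > 0.\<close>

lemma near_points_bound_neighbourhood:
  assumes A: "1 \<le> A" and \<eta>: "0 < \<eta>" "\<eta> < 1"
  obtains K where "0 \<le> K"
    and "\<And>f g Q d z. uniformly_convex A f g \<Longrightarrow> 0 < Q \<Longrightarrow> real Q powr - (2 - \<eta>) \<le> d \<Longrightarrow>
      real (card (near_points f Q d z)) \<le> K * d * real Q ^ 3"
proof -
  define \<epsilon> where "\<epsilon> = \<eta> / 4"
  have \<epsilon>: "0 < \<epsilon>" "\<epsilon> < 1 / 2" using \<eta> unfolding \<epsilon>_def by auto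
  obtain K where K: "0 \<le> K" "\<And>f g Q d z. uniformly_convex A f g \<Longrightarrow> 0 < d \<Longrightarrow> 1 \<le> d * (real Q)\<^sup>2 \<Longrightarrow>
      real (card (near_points f Q d z)) \<le> K * main_terms \<epsilon> (real Q) d"
    using near_points_bound[OF A \<epsilon>] by blast
  show thesis
  proof (rule that[of "2 * K"])
    fix f g :: "real \<Rightarrow> real" and Q :: nat and d z :: real
    assume uc: "uniformly_convex A f g" and Q: "0 < Q" and d: "real Q powr - (2 - \<eta>) \<le> d"
    have q: "0 < real Q" "1 \<le> real Q" using Q by auto
    have "0 < real Q powr - (2 - \<eta>)" using q by simp
    then have d0: "0 < d" using d by (rule less_le_trans)
    have "1 = real Q powr 0" using q by simp
    also have "\<dots> \<le> real Q powr (- (2 - \<eta>) + 2)" using q \<eta> by (intro powr_mono) auto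
    also have "\<dots> = real Q powr - (2 - \<eta>) * (real Q)\<^sup>2" unfolding powr_add using q by (simp add: powr_numeral)
    also have "\<dots> \<le> d * (real Q)\<^sup>2" using d by (intro mult_right_mono) auto
    finally have d1: "1 \<le> d * (real Q)\<^sup>2" .
    have "1 = real Q powr 0" using q by simp
    also have "\<dots> \<le> real Q powr (- (2 - \<eta>) * (1/2 + \<epsilon>) + (1 + \<epsilon>))"
    proof (rule powr_mono)
      have "- (2 - \<eta>) * (1/2 + \<epsilon>) + (1 + \<epsilon>) = \<eta> / 4 + \<eta> * \<eta> / 4" unfolding \<epsilon>_def by (simp add: field_simps)
      then show "0 \<le> - (2 - \<eta>) * (1/2 + \<epsilon>) + (1 + \<epsilon>)" using \<eta> by simp
    qed (use q in simp)
    also have "\<dots> = (real Q powr - (2 - \<eta>)) powr (1/2 + \<epsilon>) * real Q powr (1 + \<epsilon>)"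
      by (simp only: powr_add[of _ "- (2 - \<eta>) * (1/2 + \<epsilon>)" "1 + \<epsilon>"] powr_powr)
    also have "\<dots> \<le> d powr (1/2 + \<epsilon>) * real Q powr (1 + \<epsilon>)"
      using d \<epsilon> by (intro mult_right_mono powr_mono2) auto
    finally have "1 * (d powr (1/2 - \<epsilon>) * real Q powr (2 - \<epsilon>)) \<le>
      (d powr (1/2 + \<epsilon>) * real Q powr (1 + \<epsilon>)) * (d powr (1/2 - \<epsilon>) * real Q powr (2 - \<epsilon>))"
      by (intro mult_right_mono) auto
    also have "\<dots> = (d powr (1/2 + \<epsilon>) * d powr (1/2 - \<epsilon>)) * (real Q powr (1 + \<epsilon>) * real Q powr (2 - \<epsilon>))"
      by (simp only: mult_ac)
    also have "\<dots> = d powr 1 * real Q powr 3" unfolding powr_add[symmetric] by simp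
    also have "\<dots> = d * real Q ^ 3" using d0 q by (simp add: powr_numeral)
    finally have "main_terms \<epsilon> (real Q) d \<le> 2 * (d * real Q ^ 3)" unfolding main_terms_def by simp
    then have "K * main_terms \<epsilon> (real Q) d \<le> K * (2 * (d * real Q ^ 3))" using K(1) by (rule mult_left_mono)
    then show "real (card (near_points f Q d z)) \<le> 2 * K * d * real Q ^ 3"
      using K(2)[OF uc d0 d1, of z] by simp
  qed (use K in simp)
qed

section \<open>Hausdorff content\<close>

text \<open>It has the same null sets as the measure for \<open>s > 0\<close>, and no mesh size to keep track of.\<close>
definition hausdorff_content :: "real \<Rightarrow> 'a::metric_space set \<Rightarrow> ennreal" where
  "hausdorff_content s E =
     (INF U \<in> {U :: nat \<Rightarrow> 'a set. E \<subseteq> (\<Union>i. U i) \<and> (\<forall>i. bounded (U i))}. (\<Sum>i. hausdorff_gauge s (U i)))"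

lemma hausdorff_gauge_empty [simp]: "hausdorff_gauge s {} = 0"
  by (simp add: hausdorff_gauge_def)

lemma hausdorff_content_le:
  assumes "E \<subseteq> (\<Union>i. U i)" "\<And>i. bounded (U i)"
  shows "hausdorff_content s E \<le> (\<Sum>i. hausdorff_gauge s (U i))"
  unfolding hausdorff_content_def using assms by (intro INF_lower) auto

lemma hausdorff_content_less_cover:
  assumes "hausdorff_content s E < c"
  obtains U where "E \<subseteq> (\<Union>i. U i)" "\<And>i. bounded (U i)" "(\<Sum>i. hausdorff_gauge s (U i)) < c"
  using assms unfolding hausdorff_content_def INF_less_iff by auto

lemma hausdorff_content_mono: "E \<subseteq> F \<Longrightarrow> hausdorff_content s E \<le> hausdorff_content s F"
  unfolding hausdorff_content_def by (rule INF_superset_mono) auto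

lemma hausdorff_content_le_gauge:
  assumes "bounded E"
  shows "hausdorff_content s E \<le> hausdorff_gauge s E"
proof -
  define U where "U i = (if i = 0 then E else {})" for i :: nat
  have "hausdorff_content s E \<le> (\<Sum>i. hausdorff_gauge s (U i))"
    using assms by (intro hausdorff_content_le) (auto simp: U_def)
  also have "\<dots> = (\<Sum>i\<in>{0}. hausdorff_gauge s (U i))"
    by (rule suminf_finite) (auto simp: U_def)
  finally show ?thesis by (simp add: U_def)
qed

lemma hausdorff_content_empty [simp]: "hausdorff_content s {} = 0"
  using hausdorff_content_le_gauge[of "{}" s] by simp

lemma hausdorff_content_UN:
  fixes E :: "nat \<Rightarrow> 'a::metric_space set"
  shows "hausdorff_content s (\<Union>n. E n) \<le> (\<Sum>n. hausdorff_content s (E n))"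
proof (cases "\<exists>n. hausdorff_content s (E n) = top")
  case True
  then obtain n where "hausdorff_content s (E n) = top" by blast
  moreover have "hausdorff_content s (E n) \<le> (\<Sum>n. hausdorff_content s (E n))"
    using sum_le_suminf[of "\<lambda>n. hausdorff_content s (E n)" "{n}"] by simp
  ultimately show ?thesis by (simp add: top_unique)
next
  case False
  show ?thesis
  proof (rule ennreal_le_epsilon)
    fix e :: real assume e: "0 < e"
    define c where "c n = hausdorff_content s (E n) + ennreal (e * (1/2) ^ Suc n)" for n
    have "hausdorff_content s (E n) < c n" for n
    proof -
      have "0 < ennreal (e * (1/2) ^ Suc n)" using e by (simp del: power_Suc)
      then have "hausdorff_content s (E n) + 0 < c n" unfolding c_def
        using False by (subst ennreal_add_left_cancel_less) (auto simp: less_top)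
      then show ?thesis by simp
    qed
    then have "\<exists>U. E n \<subseteq> (\<Union>i. U i) \<and> (\<forall>i. bounded (U i)) \<and> (\<Sum>i. hausdorff_gauge s (U i)) < c n" for n
      using hausdorff_content_less_cover[of s "E n" "c n"] by metis
    then obtain U where U: "\<And>n. E n \<subseteq> (\<Union>i. U n i)" "\<And>n i. bounded (U n i)" "\<And>n. (\<Sum>i. hausdorff_gauge s (U n i)) < c n"
      by metis
    define W where "W i = (\<lambda>(n, j). U n j) (prod_decode i)" for i
    have "(\<Union>n. E n) \<subseteq> (\<Union>i. W i)"
    proof
      fix x assume "x \<in> (\<Union>n. E n)"
      then obtain n j where "x \<in> U n j" using U(1) by blast
      then have "x \<in> W (prod_encode (n, j))" unfolding W_def by simp
      then show "x \<in> (\<Union>i. W i)" by blast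
    qed
    then have "hausdorff_content s (\<Union>n. E n) \<le> (\<Sum>i. hausdorff_gauge s (W i))"
      using U(2) by (intro hausdorff_content_le) (auto simp: W_def split: prod.split)
    also have "\<dots> = (\<Sum>i. (\<lambda>(n, j). hausdorff_gauge s (U n j)) (prod_decode i))"
      unfolding W_def by (simp add: case_prod_unfold)
    also have "\<dots> = (\<Sum>n. \<Sum>j. hausdorff_gauge s (U n j))"
      by (subst suminf_ennreal_2dimen) auto
    also have "\<dots> \<le> (\<Sum>n. c n)" using U(3) by (intro suminf_le) (auto intro: less_imp_le)
    also have "\<dots> = (\<Sum>n. hausdorff_content s (E n)) + (\<Sum>n. ennreal (e * (1/2) ^ Suc n))"
      unfolding c_def by (rule suminf_add[symmetric]) auto
    also have "(\<Sum>n. ennreal (e * (1/2) ^ Suc n)) = ennreal e"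
      using sums_mult[OF power_half_series, of e] e by (intro suminf_ennreal_eq) (auto simp del: power_Suc)
    finally show "hausdorff_content s (\<Union>n. E n) \<le> (\<Sum>n. hausdorff_content s (E n)) + ennreal e" .
  qed
qed

lemma hausdorff_content_Un:
  fixes A B :: "'a::metric_space set"
  shows "hausdorff_content s (A \<union> B) \<le> hausdorff_content s A + hausdorff_content s B"
proof -
  define E where "E n = (if n = 0 then A else if n = 1 then B else {})" for n :: nat
  have "A \<union> B \<subseteq> (\<Union>n. E n)"
  proof
    fix x assume "x \<in> A \<union> B"
    then have "x \<in> E 0 \<or> x \<in> E 1" by (auto simp: E_def)
    then show "x \<in> (\<Union>n. E n)" by blast
  qed
  then have "hausdorff_content s (A \<union> B) \<le> hausdorff_content s (\<Union>n. E n)" by (rule hausdorff_content_mono)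
  also have "\<dots> \<le> (\<Sum>n. hausdorff_content s (E n))" by (rule hausdorff_content_UN)
  also have "\<dots> = (\<Sum>n\<in>{0,1}. hausdorff_content s (E n))" by (rule suminf_finite) (auto simp: E_def)
  finally show ?thesis by (simp add: E_def)
qed

lemma hausdorff_content_finite_UN:
  assumes "finite N"
  shows "hausdorff_content s (\<Union>p\<in>N. B p) \<le> (\<Sum>p\<in>N. hausdorff_content s (B p))"
  using assms
proof (induction N)
  case (insert p N)
  have "hausdorff_content s (B p \<union> (\<Union>p\<in>N. B p)) \<le> hausdorff_content s (B p) + hausdorff_content s (\<Union>p\<in>N. B p)"
    by (rule hausdorff_content_Un)
  also have "\<dots> \<le> hausdorff_content s (B p) + (\<Sum>p\<in>N. hausdorff_content s (B p))"
    using insert.IH by (rule add_left_mono)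
  finally show ?case using insert.hyps by simp
qed simp

lemma hausdorff_content_countable_null:
  assumes "countable N" "\<And>p. p \<in> N \<Longrightarrow> hausdorff_content s (B p) = 0"
  shows "hausdorff_content s (\<Union>p\<in>N. B p) = 0"
proof (cases "N = {}")
  case False
  have "(\<Union>p\<in>N. B p) \<subseteq> (\<Union>n. B (from_nat_into N n))"
  proof
    fix x assume "x \<in> (\<Union>p\<in>N. B p)"
    then obtain p where p: "p \<in> N" "x \<in> B p" by blast
    obtain n where "from_nat_into N n = p" using from_nat_into_surj[OF assms(1) p(1)] by blast
    with p(2) show "x \<in> (\<Union>n. B (from_nat_into N n))" by blast
  qed
  then have "hausdorff_content s (\<Union>p\<in>N. B p) \<le> hausdorff_content s (\<Union>n. B (from_nat_into N n))"
    by (rule hausdorff_content_mono)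
  also have "\<dots> \<le> (\<Sum>n. hausdorff_content s (B (from_nat_into N n)))" by (rule hausdorff_content_UN)
  also have "\<dots> = 0" using assms(2) from_nat_into[OF False] by simp
  finally show ?thesis by simp
qed simp

lemma hausdorff_content_null_subset:
  "E \<subseteq> F \<Longrightarrow> hausdorff_content s F = 0 \<Longrightarrow> hausdorff_content s E = 0"
  using hausdorff_content_mono[of E F s] by simp

lemma hausdorff_content_singleton: "0 < s \<Longrightarrow> hausdorff_content s {x} = 0"
  using hausdorff_content_le_gauge[of "{x}" s] by (simp add: hausdorff_gauge_def)

text \<open>The Hausdorff-Cantelli lemma: the levels k \<ge> K already cover \<open>E\<close>, and
  their total cost is at most a tail of a convergent series.\<close>

lemma hausdorff_content_limsup_null:
  fixes B :: "nat \<Rightarrow> 'b \<Rightarrow> 'a::metric_space set"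
  assumes s: "0 < s" and fin: "\<And>k. finite (N k)"
    and B: "\<And>k p. bounded (B k p)" "\<And>k p. diameter (B k p) \<le> \<rho> k" and \<rho>: "\<And>k. 0 \<le> \<rho> k"
    and b: "\<And>k. real (card (N k)) * \<rho> k powr s \<le> b k" "summable b"
    and cover: "\<And>K x. x \<in> E \<Longrightarrow> \<exists>k\<ge>K. \<exists>p\<in>N k. x \<in> B k p"
  shows "hausdorff_content s E = 0"
proof -
  have b0: "0 \<le> b k" for k using b(1)[of k] by (rule order_trans[rotated]) simp
  have level: "hausdorff_content s (\<Union>p\<in>N k. B k p) \<le> ennreal (b k)" for k
  proof -
    have "hausdorff_content s (\<Union>p\<in>N k. B k p) \<le> (\<Sum>p\<in>N k. hausdorff_content s (B k p))"
      by (rule hausdorff_content_finite_UN[OF fin])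
    also have "\<dots> \<le> (\<Sum>p\<in>N k. ennreal (\<rho> k powr s))"
    proof (rule sum_mono)
      fix p
      have "hausdorff_content s (B k p) \<le> hausdorff_gauge s (B k p)" by (rule hausdorff_content_le_gauge[OF B(1)])
      also have "\<dots> \<le> ennreal (\<rho> k powr s)"
        unfolding hausdorff_gauge_def using s B diameter_ge_0[OF B(1)]
        by (auto intro!: ennreal_leI powr_mono2)
      finally show "hausdorff_content s (B k p) \<le> ennreal (\<rho> k powr s)" .
    qed
    also have "\<dots> = ennreal (real (card (N k)) * \<rho> k powr s)"
      by (simp add: ennreal_mult ennreal_of_nat_eq_real_of_nat)
    also have "\<dots> \<le> ennreal (b k)" using b(1) by (rule ennreal_leI)
    finally show ?thesis .
  qed
  have tail: "hausdorff_content s E \<le> ennreal (\<Sum>k. b (k + K))" for K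
  proof -
    have "E \<subseteq> (\<Union>k. \<Union>p\<in>N (k + K). B (k + K) p)"
    proof
      fix x assume "x \<in> E"
      then obtain k p where "k \<ge> K" "p \<in> N k" "x \<in> B k p" using cover by blast
      then show "x \<in> (\<Union>k. \<Union>p\<in>N (k + K). B (k + K) p)" by (intro UN_I[of "k - K"]) auto
    qed
    then have "hausdorff_content s E \<le> hausdorff_content s (\<Union>k. \<Union>p\<in>N (k + K). B (k + K) p)"
      by (rule hausdorff_content_mono)
    also have "\<dots> \<le> (\<Sum>k. hausdorff_content s (\<Union>p\<in>N (k + K). B (k + K) p))" by (rule hausdorff_content_UN)
    also have "\<dots> \<le> (\<Sum>k. ennreal (b (k + K)))" using level by (intro suminf_le) auto
    also have "\<dots> = ennreal (\<Sum>k. b (k + K))"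
      using b0 b(2) by (intro suminf_ennreal2) (auto simp: summable_iff_shift)
    finally show ?thesis .
  qed
  have "(\<lambda>K. \<Sum>k. b (k + K)) \<longlonglongrightarrow> 0" by (rule suminf_exist_split2[OF b(2)])
  then have "(\<lambda>K. ennreal (\<Sum>k. b (k + K))) \<longlonglongrightarrow> ennreal 0" by (rule tendsto_ennrealI)
  then have "hausdorff_content s E \<le> ennreal 0"
    by (rule LIMSEQ_le_const) (use tail in auto)
  then show ?thesis by simp
qed

text \<open>The covering sets are cut down to \<open>E\<close> before they are mapped, because the
  Lipschitz bound holds on \<open>E\<close> only; the total cost grows by C^s.\<close>

lemma hausdorff_content_lipschitz_image_null:
  fixes F :: "'a::metric_space \<Rightarrow> 'b::metric_space"
  assumes s: "0 < s" and C: "0 < C" and lip: "\<And>x y. x \<in> E \<Longrightarrow> y \<in> E \<Longrightarrow> dist (F x) (F y) \<le> C * dist x y"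
    and null: "hausdorff_content s E = 0"
  shows "hausdorff_content s (F ` E) = 0"
proof -
  have bd: "hausdorff_content s (F ` E) \<le> 0 + ennreal e" if e: "0 < e" for e
  proof -
    have "0 < ennreal (e / C powr s)" using e C by simp
    then obtain U where U: "E \<subseteq> (\<Union>i. U i)" "\<And>i. bounded (U i)" "(\<Sum>i. hausdorff_gauge s (U i)) < ennreal (e / C powr s)"
      using hausdorff_content_less_cover[of s E] null by metis
    define W where "W i = F ` (U i \<inter> E)" for i
    have W: "bounded (W i) \<and> diameter (W i) \<le> C * diameter (U i)" for i
    proof (cases "W i = {}")
      case True
      then show ?thesis using C diameter_ge_0[OF U(2)[of i]] by simp
    next
      case False
      have d: "dist p q \<le> C * diameter (U i)" if "p \<in> W i" "q \<in> W i" for p q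
      proof -
        obtain x y where xy: "x \<in> U i" "x \<in> E" "p = F x" "y \<in> U i" "y \<in> E" "q = F y"
          using \<open>p \<in> W i\<close> \<open>q \<in> W i\<close> unfolding W_def by auto
        have "dist p q \<le> C * dist x y" using lip xy by simp
        also have "\<dots> \<le> C * diameter (U i)"
          using C diameter_bounded_bound[OF U(2) xy(1,4)] by (intro mult_left_mono) auto
        finally show ?thesis .
      qed
      have "bounded (W i)" using d False by (meson bounded_def ex_in_conv)
      moreover have "diameter (W i) \<le> C * diameter (U i)"
        unfolding diameter_def[of "W i"] if_not_P[OF False] using d False
        by (intro cSUP_least) (simp, clarify, blast)
      ultimately show ?thesis by simp
    qed
    have "F ` E \<subseteq> (\<Union>i. W i)" using U(1) unfolding W_def by blast
    then have "hausdorff_content s (F ` E) \<le> (\<Sum>i. hausdorff_gauge s (W i))" using W by (intro hausdorff_content_le) auto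
    also have "\<dots> \<le> (\<Sum>i. ennreal (C powr s) * hausdorff_gauge s (U i))"
    proof (intro suminf_le)
      fix i
      show "hausdorff_gauge s (W i) \<le> ennreal (C powr s) * hausdorff_gauge s (U i)"
      proof (cases "W i = {}")
        case False
        then have "U i \<noteq> {}" unfolding W_def by auto
        have "diameter (W i) powr s \<le> (C * diameter (U i)) powr s"
          using W[of i] s diameter_ge_0[of "W i"] by (intro powr_mono2) auto
        also have "\<dots> = C powr s * diameter (U i) powr s" using C diameter_ge_0[OF U(2)] by (simp add: powr_mult)
        finally show ?thesis unfolding hausdorff_gauge_def using False \<open>U i \<noteq> {}\<close> s
          by (simp add: ennreal_mult[symmetric] ennreal_leI)
      qed simp
    qed auto
    also have "\<dots> = ennreal (C powr s) * (\<Sum>i. hausdorff_gauge s (U i))" by simp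
    also have "\<dots> \<le> ennreal (C powr s) * ennreal (e / C powr s)" using U(3) by (intro mult_left_mono) auto
    also have "\<dots> = ennreal e" using C e by (simp add: ennreal_mult[symmetric])
    finally show ?thesis by simp
  qed
  have "hausdorff_content s (F ` E) \<le> 0" by (rule ennreal_le_epsilon) (rule bd)
  then show ?thesis by simp
qed

section \<open>Comparison of content, measure and dimension\<close>

lemma hausdorff_gauge_le_suminf: "hausdorff_gauge s (U i) \<le> (\<Sum>i. hausdorff_gauge s (U i))"
  using sum_le_suminf[of "\<lambda>i. hausdorff_gauge s (U i)" "{i}"] by simp

text \<open>A cheap cover is automatically fine: if the total cost is at most \<delta>^s, then each
  single diameter is at most \<delta>, because s > 0.\<close>

lemma hausdorff_measure_eq_0_if_content:
  assumes s: "0 < s" and null: "hausdorff_content s E = 0"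
  shows "hausdorff_measure s E = 0"
proof -
  have "hausdorff_premeasure s \<delta> E \<le> 0" if \<delta>: "0 < \<delta>" for \<delta>
  proof (rule ennreal_le_epsilon)
    fix e :: real assume e: "0 < e"
    define c where "c = min e (\<delta> powr s)"
    have "0 < ennreal c" using e \<delta> unfolding c_def by simp
    then obtain U where U: "E \<subseteq> (\<Union>i. U i)" "\<And>i. bounded (U i)" "(\<Sum>i. hausdorff_gauge s (U i)) < ennreal c"
      using hausdorff_content_less_cover[of s E] null by metis
    have "diameter (U i) \<le> \<delta>" for i
    proof (cases "U i = {}")
      case False
      have "hausdorff_gauge s (U i) \<le> ennreal c" using hausdorff_gauge_le_suminf[of s U i] U(3) by simp
      then have "ennreal (diameter (U i) powr s) \<le> ennreal c" using False s by (simp add: hausdorff_gauge_def)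
      moreover have "0 \<le> c" using e unfolding c_def by simp
      ultimately have "diameter (U i) powr s \<le> \<delta> powr s" unfolding c_def by (simp add: ennreal_le_iff)
      then show ?thesis using powr_less_mono2[of s \<delta> "diameter (U i)"] s \<delta> by force
    qed (use \<delta> in simp)
    then have "hausdorff_premeasure s \<delta> E \<le> (\<Sum>i. hausdorff_gauge s (U i))"
      unfolding hausdorff_premeasure_def using U(1,2) by (intro INF_lower) auto
    also have "\<dots> \<le> ennreal c" using U(3) by simp
    also have "\<dots> \<le> 0 + ennreal e" unfolding c_def by (simp add: ennreal_leI)
    finally show "hausdorff_premeasure s \<delta> E \<le> 0 + ennreal e" .
  qed
  then show ?thesis unfolding hausdorff_measure_def by (simp add: SUP_eq_iff)
qed

lemma hausdorff_content_eq_0_if_measure: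
  assumes "hausdorff_measure s E = 0"
  shows "hausdorff_content s E = 0"
proof -
  have "hausdorff_content s E \<le> hausdorff_premeasure s 1 E"
    unfolding hausdorff_content_def hausdorff_premeasure_def by (rule INF_superset_mono) auto
  also have "\<dots> \<le> hausdorff_measure s E"
    unfolding hausdorff_measure_def by (rule SUP_upper) simp
  finally show ?thesis using assms by simp
qed

lemma hausdorff_content_null_increasing:
  assumes t: "0 \<le> t" "t < s" and null: "hausdorff_content t E = 0"
  shows "hausdorff_content s E = 0"
proof -
  have bd: "hausdorff_content s E \<le> 0 + ennreal e" if e: "0 < e" for e
  proof -
    \<comment> \<open>A total below 1 makes all diameters at most 1, so that the larger exponent
      gives the smaller cost. For t = 0 it excludes nonempty covering sets, as each of them would
      cost 1.\<close>
    define c where "c = min e (1/2)"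
    have "0 < ennreal c" using e unfolding c_def by simp
    then obtain U where U: "E \<subseteq> (\<Union>i. U i)" "\<And>i. bounded (U i)" "(\<Sum>i. hausdorff_gauge t (U i)) < ennreal c"
      using hausdorff_content_less_cover[of t E] null by metis
    have "hausdorff_gauge s (U i) \<le> hausdorff_gauge t (U i)" for i
    proof (cases "U i = {}")
      case False
      have le: "hausdorff_gauge t (U i) < ennreal c" using hausdorff_gauge_le_suminf[of t U i] U(3) by simp
      have "t \<noteq> 0"
      proof
        assume "t = 0"
        then have "ennreal 1 < ennreal c" using le False by (simp add: hausdorff_gauge_def)
        then show False unfolding c_def by (simp add: ennreal_less_iff)
      qed
      then have "ennreal (diameter (U i) powr t) < ennreal c" using le False by (simp add: hausdorff_gauge_def)
      then have "diameter (U i) powr t < 1" unfolding c_def by (simp add: ennreal_less_iff)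
      then have "diameter (U i) \<le> 1" using ge_one_powr_ge_zero[of "diameter (U i)" t] t by force
      then have "diameter (U i) powr s \<le> diameter (U i) powr t"
        using t diameter_ge_0[OF U(2)[of i]] by (intro powr_mono') auto
      then show ?thesis using False t \<open>t \<noteq> 0\<close> by (simp add: hausdorff_gauge_def ennreal_leI)
    qed simp
    then have "(\<Sum>i. hausdorff_gauge s (U i)) \<le> (\<Sum>i. hausdorff_gauge t (U i))" by (intro suminf_le) auto
    also have "\<dots> \<le> ennreal c" using U(3) by simp
    also have "\<dots> \<le> ennreal e" unfolding c_def by (simp add: ennreal_leI)
    finally show ?thesis using hausdorff_content_le[OF U(1,2), of s] by simp
  qed
  have "hausdorff_content s E \<le> 0" by (rule ennreal_le_epsilon) (rule bd)
  then show ?thesis by simp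
qed

lemma hausdorff_content_eq_0_if_dim:
  assumes "hausdorff_dim E \<le> ennreal r" "0 \<le> r" "r < s"
  shows "hausdorff_content s E = 0"
proof -
  have "hausdorff_dim E < ennreal s" using assms by (meson ennreal_lessI le_less_trans order_le_less_trans)
  then obtain t where "0 \<le> t" "hausdorff_measure t E = 0" "ennreal t < ennreal s"
    unfolding hausdorff_dim_def Inf_less_iff by auto
  then show ?thesis
    using hausdorff_content_null_increasing[of t s E] hausdorff_content_eq_0_if_measure[of t E] by (simp add: ennreal_less_iff)
qed

section \<open>Approximable points on a curve\<close>

lemma dist_nearest_int_lessE:
  assumes "dist_nearest_int x < r"
  obtains p :: int where "\<bar>x - of_int p\<bar> < r"
proof -
  have "(INF a\<in>\<int>. dist x a) < r" using assms unfolding dist_nearest_int_def infdist_def by (auto split: if_splits)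
  then obtain a where "a \<in> \<int>" "dist x a < r"
    by (subst (asm) cINF_less_iff) (auto intro: bdd_belowI[of _ 0])
  then show thesis using that by (auto simp: dist_real_def elim: Ints_cases)
qed

lemma dist_nearest_int_minus: "dist_nearest_int (- x) = dist_nearest_int x"
proof -
  have "(\<lambda>a. dist (- x) a) ` \<int> = (\<lambda>a. dist x a) ` \<int>"
  proof -
    have "(\<lambda>a. dist (- x) a) ` \<int> = (\<lambda>a. dist (- x) (- a)) ` \<int>"
      by (auto simp: image_iff) (metis Ints_minus minus_minus)+
    moreover have "dist (- x) (- a) = dist x a" for a by (simp add: dist_real_def)
    ultimately show ?thesis by simp
  qed
  then show ?thesis unfolding dist_nearest_int_def infdist_def by simp
qed

text \<open>Cauchy condensation, done by blocks because the terms need not be monotone: on a block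
  the power of t is bounded below by its value at the left end, and \<psi> by its value at the right
  end.\<close>

lemma summable_dyadic:
  fixes \<psi> :: "real \<Rightarrow> real"
  assumes s: "s < 1" "0 < s" and \<psi>: "approximating_function \<psi>"
    and sum: "summable (\<lambda>t. real (Suc t) powr (1 - s) * \<psi> (real (Suc t)) powr (s + 1))"
  shows "summable (\<lambda>k. (2 ^ k) powr (2 - s) * \<psi> (2 ^ k) powr (1 + s))"
proof -
  define a where "a t = real t powr (1 - s) * \<psi> (real t) powr (1 + s)" for t :: nat
  have a0: "0 \<le> a t" for t unfolding a_def by simp
  have \<psi>_pos: "\<And>t. 0 < t \<Longrightarrow> 0 < \<psi> t" and \<psi>_anti: "\<And>t u. 0 < t \<Longrightarrow> t \<le> u \<Longrightarrow> \<psi> u \<le> \<psi> t"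
    using \<psi> unfolding approximating_function_def by (auto simp: monotone_on_def)
  have suma: "summable (\<lambda>t. a (Suc t))" using sum unfolding a_def by (simp add: add.commute)
  have block: "(2 ^ Suc k) powr (2 - s) * \<psi> (2 ^ Suc k) powr (1 + s) \<le> 4 * (\<Sum>t\<in>{2 ^ k..<2 ^ Suc k}. a (Suc t))" for k
  proof -
    have "(2 ^ k) powr (1 - s) * \<psi> (2 ^ Suc k) powr (1 + s) \<le> a (Suc t)" if t: "t \<in> {2 ^ k..<2 ^ Suc k}" for t
      unfolding a_def
    proof (intro mult_mono powr_mono2)
      have "real (2 ^ k) \<le> real (Suc t)" using t by (subst of_nat_le_iff) auto
      then show "2 ^ k \<le> real (Suc t)" by simp
      have "real (Suc t) \<le> real (2 ^ Suc k)" using t by (subst of_nat_le_iff) auto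
      then show "\<psi> (2 ^ Suc k) \<le> \<psi> (real (Suc t))" by (intro \<psi>_anti) auto
    qed (use s \<psi>_pos[of "2 ^ Suc k"] in auto)
    then have "(\<Sum>t\<in>{2 ^ k..<2 ^ Suc k::nat}. (2 ^ k) powr (1 - s) * \<psi> (2 ^ Suc k) powr (1 + s))
      \<le> (\<Sum>t\<in>{2 ^ k..<2 ^ Suc k}. a (Suc t))" by (rule sum_mono)
    then have "2 ^ k * ((2 ^ k) powr (1 - s) * \<psi> (2 ^ Suc k) powr (1 + s)) \<le> (\<Sum>t\<in>{2 ^ k..<2 ^ Suc k}. a (Suc t))"
      by simp
    moreover have "(2 ^ Suc k) powr (2 - s) \<le> 4 * (2 ^ k * (2 ^ k) powr (1 - s))"
    proof -
      have "(2 ^ Suc k) powr (2 - s) = 2 powr (2 - s) * ((2::real) ^ k) powr (2 - s)" by (simp add: powr_mult)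
      also have "((2::real) ^ k) powr (2 - s) = 2 ^ k * (2 ^ k) powr (1 - s)"
        using powr_add[of "(2::real) ^ k" 1 "1 - s"] by simp
      also have "2 powr (2 - s) \<le> (2::real) powr 2" using s by (intro powr_mono) auto
      finally show ?thesis by simp
    qed
    then have "(2 ^ Suc k) powr (2 - s) * \<psi> (2 ^ Suc k) powr (1 + s)
      \<le> 4 * (2 ^ k * (2 ^ k) powr (1 - s)) * \<psi> (2 ^ Suc k) powr (1 + s)" by (rule mult_right_mono) simp
    ultimately show ?thesis by (simp add: mult.assoc)
  qed
  have "summable (\<lambda>k. (2 ^ Suc k) powr (2 - s) * \<psi> (2 ^ Suc k) powr (1 + s))"
  proof (rule summableI_nonneg_bounded)
    fix n
    have part: "(\<Sum>k<n. \<Sum>t\<in>{2 ^ k..<2 ^ Suc k}. a (Suc t)) = (\<Sum>t\<in>{1..<2 ^ n}. a (Suc t))"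
    proof (induction n)
      case (Suc n)
      have "{1..<2 ^ Suc n} = {1..<2 ^ n} \<union> {2 ^ n..<2 ^ Suc n::nat}" by (auto simp: le_simps)
      then show ?case using Suc by (simp add: sum.union_disjoint ivl_disj_int)
    qed simp
    have "(\<Sum>k<n. (2 ^ Suc k) powr (2 - s) * \<psi> (2 ^ Suc k) powr (1 + s)) \<le> (\<Sum>k<n. 4 * (\<Sum>t\<in>{2 ^ k..<2 ^ Suc k}. a (Suc t)))"
      by (rule sum_mono) (rule block)
    also have "\<dots> = 4 * (\<Sum>t\<in>{1..<2 ^ n}. a (Suc t))" unfolding part[symmetric] by (simp only: sum_distrib_left)
    also have "\<dots> \<le> 4 * (\<Sum>t. a (Suc t))"
      using suma a0 by (intro mult_left_mono sum_le_suminf) auto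
    finally show "(\<Sum>k<n. (2 ^ Suc k) powr (2 - s) * \<psi> (2 ^ Suc k) powr (1 + s)) \<le> 4 * (\<Sum>t. a (Suc t))" .
  qed simp
  then show ?thesis by (rule summable_Suc_iff[THEN iffD1])
qed

text \<open>At level k there are O(\<phi> 4^k) centres, by the counting theorem with d of order
  \<phi> / 2^k and Q = 2^(k+1). Each costs O((\<phi> / 2^k)^s), so the level costs O(2^(k(2-s))
  \<phi>^(1+s)). This splits into the condensed series and a geometric one, according to which entry
  of the maximum \<phi> is attained.\<close>

lemma convex_curve_null:
  assumes s: "1/2 < s" "s < 1" and \<psi>: "approximating_function \<psi>"
    and sum: "summable (\<lambda>t. real (Suc t) powr (1 - s) * \<psi> (real (Suc t)) powr (s + 1))"
    and uc: "uniformly_convex A f g" and ab: "a \<le> b"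
  shows "hausdorff_content s (graph_curve {a..b} f \<inter> simul_approximable \<psi>) = 0"
proof -
  have A: "A \<ge> 1" and der: "\<And>x. (f has_real_derivative g x) (at x)"
    and mono: "\<And>x y. x \<le> y \<Longrightarrow> (y - x) / A \<le> g y - g x \<and> g y - g x \<le> A * (y - x)"
    using uc unfolding uniformly_convex_def by auto
  have \<psi>_pos: "\<And>t. 0 < t \<Longrightarrow> 0 < \<psi> t" and \<psi>_anti: "\<And>t u. 0 < t \<Longrightarrow> t \<le> u \<Longrightarrow> \<psi> u \<le> \<psi> t"
    using \<psi> unfolding approximating_function_def by (auto simp: monotone_on_def)
  \<comment> \<open>Raising \<psi> to the floor adds a series with exponent 1 - 2 s + \<eta> (1 +
    s); this \<eta> uses up half of the room and leaves (1 - 2 s) / 2 < 0.\<close>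
  define \<eta> where "\<eta> = (2 * s - 1) / (2 * (1 + s))"
  have \<eta>: "0 < \<eta>" "\<eta> < 1" "\<eta> * (1 + s) = (2 * s - 1) / 2"
    using s unfolding \<eta>_def by (auto simp: field_simps)
  obtain K where K: "0 \<le> K" "\<And>f g Q d z. uniformly_convex A f g \<Longrightarrow> 0 < Q \<Longrightarrow> real Q powr - (2 - \<eta>) \<le> d \<Longrightarrow>
      real (card (near_points f Q d z)) \<le> K * d * real Q ^ 3"
    using near_points_bound_neighbourhood[OF A \<eta>(1,2)] by blast
  \<comment> \<open>A bound for the slope on [a - 1, b + 1]: the abscissa of the approximating
    rational point may lie outside [a, b], but by at most 1 once k is large.\<close>
  define G where "G = \<bar>g a\<bar> + A * (b - a + 2)"
  have G0: "0 \<le> G" unfolding G_def using A ab by simp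
  have gG: "\<bar>g t\<bar> \<le> G" if t: "a - 1 \<le> t" "t \<le> b + 1" for t
  proof -
    have "\<bar>g t - g a\<bar> \<le> A * \<bar>t - a\<bar>"
    proof (cases "a \<le> t")
      case True
      then have "0 \<le> (t - a) / A" using A by simp
      then show ?thesis using mono[OF True] True by simp
    next
      case False
      then have "0 \<le> (a - t) / A" using A by simp
      then show ?thesis using mono[of t a] False by simp
    qed
    also have "\<dots> \<le> A * (b - a + 2)" using A t ab by (intro mult_left_mono) (auto simp: abs_le_iff)
    finally show ?thesis unfolding G_def by linarith
  qed
  have lip: "\<bar>f x - f y\<bar> \<le> G * \<bar>x - y\<bar>" if "x \<in> {a - 1..b + 1}" "y \<in> {a - 1..b + 1}" for x y
  proof -
    have "norm (f x - f y) \<le> G * norm (x - y)"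
    proof (rule field_differentiable_bound[where S = "{a - 1..b + 1}" and f' = g])
      fix t assume "t \<in> {a - 1..b + 1}"
      then show "norm (g t) \<le> G" using gG by auto
      show "(f has_field_derivative g t) (at t within {a - 1..b + 1})" using der by (rule has_field_derivative_at_within)
    qed (use that in auto)
    then show ?thesis by simp
  qed
  define \<phi> where "\<phi> k = max (\<psi> (2 ^ k)) ((2 ^ k) powr - (1 - \<eta>))" for k :: nat
  have \<phi>0: "0 < \<phi> k" for k unfolding \<phi>_def by (simp add: less_max_iff_disj)
  \<comment> \<open>The vertical error \<phi> / 2^k, plus at most G times as much from passing to
    the abscissa of the rational point.\<close>
  define d where "d k = (1 + G) * (\<phi> k / 2 ^ k)" for k :: nat
  define Q :: "nat \<Rightarrow> nat" where "Q k = 2 ^ Suc k" for k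
  have d0: "0 \<le> d k" for k unfolding d_def using G0 \<phi>0[of k] by simp
  define N where "N k = {(x, y) \<in> rational_points (Q k). a - 1 \<le> x \<and> x \<le> a - 1 + (b - a + 2) \<and> \<bar>y - f x\<bar> \<le> d k}" for k
  have Q: "0 < Q k" "real (Q k) = 2 * 2 ^ k" for k unfolding Q_def by auto
  have card1: "real (card (near_points f (Q k) (d k) z)) \<le> K * d k * real (Q k) ^ 3" for k z
  proof (rule K(2)[OF uc Q(1)])
    have "real (Q k) powr - (2 - \<eta>) \<le> (2 ^ k) powr - (2 - \<eta>)"
      unfolding Q(2) using \<eta> by (intro powr_mono2') auto
    also have "\<dots> = (2 ^ k) powr - (1 - \<eta>) / 2 ^ k"
      using powr_add[of "(2::real) ^ k" "- (1 - \<eta>)" "- 1"] by (simp add: powr_minus divide_inverse)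
    also have "\<dots> \<le> \<phi> k / 2 ^ k" unfolding \<phi>_def by (intro divide_right_mono) auto
    also have "\<dots> \<le> d k" unfolding d_def using G0 \<phi>0[of k] mult_right_mono[of 1 "1 + G" "\<phi> k / 2 ^ k"] by simp
    finally show "real (Q k) powr - (2 - \<eta>) \<le> d k" .
  qed
  have finN: "finite (N k)" and cardN: "real (card (N k)) \<le> (b - a + 3) * (K * d k * real (Q k) ^ 3)" for k
    unfolding N_def using card_near_points_long_interval[OF d0[of k] _ card1[of k], where l = "b - a + 2" and a = "a - 1"] ab
    by (auto simp: add.commute)
  define C where "C = (b - a + 3) * K * (1 + G) * 8 * 4 powr s"
  have C0: "0 \<le> C" unfolding C_def using ab K G0 by simp
  define e where "e k = (2 ^ k) powr (2 - s) * \<psi> (2 ^ k) powr (1 + s) + (2 powr ((1 - 2 * s) / 2)) ^ k" for k :: nat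
  have sume: "summable (\<lambda>k. C * e k)"
    unfolding e_def
  proof (intro summable_mult summable_add)
    show "summable (\<lambda>k. (2 ^ k) powr (2 - s) * \<psi> (2 ^ k) powr (1 + s))"
      by (rule summable_dyadic[OF s(2) _ \<psi> sum]) (use s in simp)
    have "2 powr ((1 - 2 * s) / 2) < (2::real) powr 0" using s by (intro powr_less_mono) auto
    then show "summable (\<lambda>k. (2 powr ((1 - 2 * s) / 2)) ^ k :: real)" by (intro summable_geometric) simp
  qed
  show ?thesis
  proof (rule hausdorff_content_limsup_null[where N = N and B = "\<lambda>k p. cball p (2 * \<phi> k / 2 ^ k)"
        and \<rho> = "\<lambda>k. 4 * \<phi> k / 2 ^ k" and b = "\<lambda>k. C * e k"])
    show "0 < s" using s by simp
    show "finite (N k)" for k by (rule finN)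
    show "bounded (cball p (2 * \<phi> k / 2 ^ k))" for k and p :: "real \<times> real" by (rule bounded_cball)
    show "diameter (cball p (2 * \<phi> k / 2 ^ k)) \<le> 4 * \<phi> k / 2 ^ k" for k and p :: "real \<times> real"
      using diameter_cball[of p "2 * \<phi> k / 2 ^ k"] \<phi>0[of k] by simp
    show "0 \<le> 4 * \<phi> k / 2 ^ k" for k using \<phi>0[of k] by simp
    show "summable (\<lambda>k. C * e k)" by (rule sume)
  next
    fix k
    define T :: real where "T = 2 ^ k"
    have T: "0 < T" unfolding T_def by simp
    have "real (card (N k)) * (4 * \<phi> k / 2 ^ k) powr s
      \<le> ((b - a + 3) * (K * d k * real (Q k) ^ 3)) * (4 * \<phi> k / 2 ^ k) powr s"
      by (intro mult_right_mono cardN) simp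
    also have "\<dots> = C * (T powr (2 - s) * \<phi> k powr (1 + s))"
    proof -
      have "(4 * \<phi> k / 2 ^ k) powr s = 4 powr s * \<phi> k powr s * T powr - s"
        using \<phi>0[of k] T unfolding T_def[symmetric] by (simp add: powr_mult powr_divide powr_minus_divide)
      moreover have "K * d k * real (Q k) ^ 3 = K * (1 + G) * 8 * (\<phi> k powr 1 * T powr 2)"
        unfolding d_def Q(2) T_def[symmetric] using \<phi>0[of k] T
        by (simp add: power3_eq_cube powr_numeral power2_eq_square)
      moreover have "\<phi> k powr (1 + s) = \<phi> k powr 1 * \<phi> k powr s" "T powr (2 - s) = T powr 2 * T powr - s"
        unfolding powr_add[symmetric] by simp_all
      ultimately show ?thesis unfolding C_def by (simp only: mult_ac)
    qed
    also have "\<dots> \<le> C * e k"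
    proof (rule mult_left_mono[OF _ C0])
      have "\<phi> k powr (1 + s) \<le> \<psi> T powr (1 + s) + (T powr - (1 - \<eta>)) powr (1 + s)"
        unfolding \<phi>_def T_def[symmetric] max_def by auto
      then have "T powr (2 - s) * \<phi> k powr (1 + s) \<le> T powr (2 - s) * (\<psi> T powr (1 + s) + (T powr - (1 - \<eta>)) powr (1 + s))"
        by (rule mult_left_mono) simp
      also have "\<dots> = T powr (2 - s) * \<psi> T powr (1 + s) + T powr (2 - s) * T powr (- (1 - \<eta>) * (1 + s))"
        by (simp only: distrib_left powr_powr)
      also have "T powr (2 - s) * T powr (- (1 - \<eta>) * (1 + s)) = T powr ((2 - s) + (- (1 - \<eta>) * (1 + s)))"
        by (simp only: powr_add)
      also have "(2 - s) + (- (1 - \<eta>) * (1 + s)) = (1 - 2 * s) / 2"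
        using \<eta>(3) by (simp add: algebra_simps)
      also have "T powr ((1 - 2 * s) / 2) = (2 powr ((1 - 2 * s) / 2)) ^ k" unfolding T_def by (rule two_powr_power)
      finally show "T powr (2 - s) * \<phi> k powr (1 + s) \<le> e k" unfolding e_def T_def .
    qed
    finally show "real (card (N k)) * (4 * \<phi> k / 2 ^ k) powr s \<le> C * e k" .
  next
    fix k0 :: nat and w assume w: "w \<in> graph_curve {a..b} f \<inter> simul_approximable \<psi>"
    then obtain x where x: "w = (x, f x)" "a \<le> x" "x \<le> b" unfolding graph_curve_def by auto
    define S where "S = {q::nat. 0 < q \<and> max (dist_nearest_int (real q * x)) (dist_nearest_int (real q * f x)) < \<psi> (real q)}"
    have "infinite S" using w x(1) unfolding simul_approximable_def S_def by auto
    \<comment> \<open>Ensures k \<ge> \<open>k0\<close>, and also \<psi>(2^k) \<le> \<psi>(1) \<le>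
      k < 2^k, so that the displacement \<phi> / 2^k is at most 1.\<close>
    define m where "m = max k0 (nat \<lceil>max 1 (\<psi> 1)\<rceil>)"
    obtain q where q: "q \<in> S" "2 ^ m \<le> q"
      using \<open>infinite S\<close> unfolding infinite_nat_iff_unbounded_le by blast
    then have "1 \<le> q" by (metis one_le_numeral one_le_power order_trans)
    then obtain k where k: "2 ^ k \<le> q" "q < 2 ^ (k + 1)" using ex_power_ivl1[of 2 q] by auto
    have "m \<le> k"
    proof -
      have "(2::nat) ^ m < 2 ^ (k + 1)" using q(2) k(2) by linarith
      then have "m < k + 1" by (rule power_less_imp_less_exp[rotated]) simp
      then show ?thesis by simp
    qed
    then have k0: "k0 \<le> k" and km: "max 1 (\<psi> 1) \<le> real k" unfolding m_def by linarith+
    have rk: "2 ^ k \<le> real q" using k(1) by (metis of_nat_le_iff of_nat_numeral of_nat_power)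
    have q0: "0 < real q" using \<open>1 \<le> q\<close> by simp
    have \<psi>q: "\<psi> (real q) \<le> \<phi> k" using \<psi>_anti[of "2 ^ k" "real q"] rk unfolding \<phi>_def by simp
    have small: "\<phi> k / 2 ^ k \<le> 1"
    proof -
      have "\<psi> (2 ^ k) \<le> \<psi> 1" by (rule \<psi>_anti) auto
      moreover have kp: "real k < 2 ^ k" by (rule of_nat_less_two_power)
      ultimately have "\<psi> (2 ^ k) \<le> 2 ^ k" using km by linarith
      have "(2 ^ k) powr - (1 - \<eta>) \<le> (2 ^ k) powr (0::real)" using \<eta> by (intro powr_mono) auto
      also have "\<dots> = 1" by simp
      also have "1 \<le> (2::real) ^ k" by simp
      finally have "\<phi> k \<le> 2 ^ k" unfolding \<phi>_def using \<open>\<psi> (2 ^ k) \<le> 2 ^ k\<close> by (rule max.boundedI[rotated])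
      then show ?thesis by simp
    qed
    obtain p where p: "\<bar>real q * x - of_int p\<bar> < \<psi> (real q)"
      using q(1) dist_nearest_int_lessE unfolding S_def by (metis (mono_tags, lifting) max_less_iff_conj mem_Collect_eq)
    obtain r where r: "\<bar>real q * f x - of_int r\<bar> < \<psi> (real q)"
      using q(1) dist_nearest_int_lessE unfolding S_def by (metis (mono_tags, lifting) max_less_iff_conj mem_Collect_eq)
    define X Y where "X = of_int p / real q" and "Y = of_int r / real q"
    have close: "\<bar>t - of_int n / real q\<bar> \<le> \<phi> k / 2 ^ k" if "\<bar>real q * t - of_int n\<bar> < \<psi> (real q)" for t and n :: int
    proof -
      have "t - of_int n / real q = (real q * t - of_int n) / real q" using q0 by (simp add: field_simps)
      then have "\<bar>t - of_int n / real q\<bar> = \<bar>real q * t - of_int n\<bar> / real q" using q0 by (simp add: abs_divide)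
      also have "\<dots> \<le> \<phi> k / 2 ^ k" using that \<psi>q rk q0 by (intro frac_le) auto
      finally show ?thesis .
    qed
    have X: "\<bar>x - X\<bar> \<le> \<phi> k / 2 ^ k" and Y: "\<bar>f x - Y\<bar> \<le> \<phi> k / 2 ^ k"
      unfolding X_def Y_def using close p r by blast+
    have "\<bar>x - X\<bar> \<le> 1" using X small by (rule order_trans)
    then have X1: "X \<in> {a - 1..b + 1}" using x(2,3) by auto
    have "\<bar>f x - f X\<bar> \<le> G * (\<phi> k / 2 ^ k)"
      using lip[of x X] X1 x mult_left_mono[OF X G0] by auto
    moreover have "d k = \<phi> k / 2 ^ k + G * (\<phi> k / 2 ^ k)" unfolding d_def by (simp only: distrib_right mult_1)
    ultimately have "\<bar>Y - f X\<bar> \<le> d k" using Y by linarith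
    moreover have "(X, Y) \<in> rational_points (Q k)"
      unfolding rational_points_def X_def Y_def Q_def using k(2) q0 \<open>1 \<le> q\<close>
      by (auto intro!: bexI[of _ q])
    ultimately have "(X, Y) \<in> N k" unfolding N_def using X1 by auto
    moreover have "w \<in> cball (X, Y) (2 * \<phi> k / 2 ^ k)"
    proof -
      have "dist (X, Y) w \<le> \<bar>X - x\<bar> + \<bar>Y - f x\<bar>"
        unfolding x(1) dist_Pair_Pair dist_real_def by (rule sqrt_sum_squares_le_sum_abs[of "\<bar>X - x\<bar>" "\<bar>Y - f x\<bar>", simplified abs_abs])
      then show ?thesis using X Y by (simp add: abs_minus_commute)
    qed
    ultimately show "\<exists>k\<ge>k0. \<exists>p\<in>N k. w \<in> cball p (2 * \<phi> k / 2 ^ k)" using k0 by blast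
  qed
qed

section \<open>Localisation to arcs with nonvanishing second derivative\<close>

lemma uniformly_convex_extension:
  assumes ab: "a < b" and A: "1 \<le> A"
    and f: "\<And>t. t \<in> {a..b} \<Longrightarrow> (f has_real_derivative g t) (at t)"
    and g: "\<And>t. t \<in> {a..b} \<Longrightarrow> (g has_real_derivative h t) (at t)"
    and h: "\<And>t. t \<in> {a..b} \<Longrightarrow> 1 / A \<le> h t \<and> h t \<le> A"
  obtains F G where "uniformly_convex A F G" "\<And>t. t \<in> {a..b} \<Longrightarrow> F t = f t"
proof -
  define c where "c t = max a (min b t)" for t
  have c: "c t \<in> {a..b}" for t using ab unfolding c_def by auto
  have c_id: "c t = t" if "t \<in> {a..b}" for t using that unfolding c_def by auto
  \<comment> \<open>Outside the interval the derivative is continued with slope 1, which lies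
    between 1/A and A, so the increment bounds persist. \<open>c\<close> is the projection onto the
    interval, and the extension of \<open>f\<close> is an antiderivative of
    \<open>G\<close>.\<close>
  define G where "G t = g (c t) + (t - c t)" for t
  have "continuous_on {a..b} g" using g by (meson DERIV_continuous continuous_at_imp_continuous_on)
  then have "continuous_on UNIV (\<lambda>t. g (c t))"
    by (rule continuous_on_compose2[where s = "UNIV"]) (use c in \<open>auto simp: c_def intro!: continuous_intros\<close>)
  then have "continuous_on UNIV G"
    unfolding G_def c_def by (intro continuous_intros)
  then have "isCont G t" for t by (simp add: continuous_on_eq_continuous_at)
  then obtain F0 where F0: "\<And>x. (F0 has_vector_derivative G x) (at x)"
    using einterval_antiderivative[of "- \<infinity>" "\<infinity>" G] by auto
  define F where "F t = F0 t + (f a - F0 a)" for t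
  have F: "(F has_real_derivative G t) (at t)" for t
    unfolding F_def using F0[of t] unfolding has_real_derivative_iff_has_vector_derivative[symmetric]
    by (auto intro!: derivative_eq_intros)
  have bilip: "(u - t) / A \<le> G u - G t \<and> G u - G t \<le> A * (u - t)" if tu: "t \<le> u" for t u
  proof -
    have le: "c t \<le> c u" and rest: "0 \<le> (u - t) - (c u - c t)"
      using tu ab unfolding c_def by (auto simp: max_def min_def)
    have mid: "(c u - c t) / A \<le> g (c u) - g (c t) \<and> g (c u) - g (c t) \<le> A * (c u - c t)"
    proof (cases "c t = c u")
      case False
      then have lt: "c t < c u" using le by simp
      have "\<And>x. c t \<le> x \<Longrightarrow> x \<le> c u \<Longrightarrow> (g has_real_derivative h x) (at x)"
        using g c[of t] c[of u] by auto
      from MVT2[OF lt this] obtain z where z: "c t < z" "z < c u" "g (c u) - g (c t) = (c u - c t) * h z" by blast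
      have "z \<in> {a..b}" using z c[of t] c[of u] by auto
      note hz = h[OF this]
      have "(c u - c t) * (1 / A) \<le> (c u - c t) * h z" "(c u - c t) * h z \<le> (c u - c t) * A"
        using hz lt by (intro mult_left_mono; simp)+
      then show ?thesis unfolding z(3) by (simp add: mult.commute)
    qed simp
    define w where "w = (u - t) - (c u - c t)"
    have "w / A \<le> w" "w \<le> A * w" using rest A unfolding w_def[symmetric]
      by (auto simp: divide_le_eq mult_le_cancel_left1 mult_le_cancel_right1)
    moreover have "G u - G t = g (c u) - g (c t) + w" unfolding G_def w_def by simp
    moreover have "(u - t) / A = (c u - c t) / A + w / A" "A * (u - t) = A * (c u - c t) + A * w"
      unfolding w_def by (simp_all add: add_divide_distrib[symmetric] distrib_left[symmetric])
    ultimately show ?thesis using mid by linarith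
  qed
  have eq: "F t = f t" if t: "t \<in> {a..b}" for t
  proof (cases "a = t")
    case True
    then show ?thesis unfolding F_def by simp
  next
    case False
    then have lt: "a < t" using t by simp
    have "((\<lambda>x. F x - f x) has_real_derivative 0) (at x)" if "a \<le> x" "x \<le> t" for x
    proof -
      have x: "x \<in> {a..b}" using that t by auto
      then have "G x = g x" unfolding G_def by (simp add: c_id)
      then show ?thesis using DERIV_diff[OF F[of x] f[OF x]] by simp
    qed
    from MVT2[OF lt this] obtain z where "(F t - f t) - (F a - f a) = 0" by auto
    then show ?thesis unfolding F_def by simp
  qed
  have "uniformly_convex A F G" unfolding uniformly_convex_def using A F bilip by blast
  then show thesis using eq by (rule that)
qed

lemma graph_curve_image: "graph_curve I f = (\<lambda>x. (x, f x)) ` I"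
  unfolding graph_curve_def by auto

lemma convex_arc_null:
  assumes s: "1/2 < s" "s < 1" and \<psi>: "approximating_function \<psi>"
    and sum: "summable (\<lambda>t. real (Suc t) powr (1 - s) * \<psi> (real (Suc t)) powr (s + 1))"
    and ab: "a < b" and A: "1 \<le> A"
    and f: "\<And>t. t \<in> {a..b} \<Longrightarrow> (f has_real_derivative g t) (at t)"
    and g: "\<And>t. t \<in> {a..b} \<Longrightarrow> (g has_real_derivative h t) (at t)"
    and h: "\<And>t. t \<in> {a..b} \<Longrightarrow> 1 / A \<le> h t \<and> h t \<le> A"
  shows "hausdorff_content s (graph_curve {a..b} f \<inter> simul_approximable \<psi>) = 0"
proof -
  obtain F G where F: "uniformly_convex A F G" "\<And>t. t \<in> {a..b} \<Longrightarrow> F t = f t"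
    using uniformly_convex_extension[OF ab A f g h] by blast
  have "graph_curve {a..b} F = graph_curve {a..b} f"
    unfolding graph_curve_image using F(2) by (intro image_cong) auto
  moreover have "hausdorff_content s (graph_curve {a..b} F \<inter> simul_approximable \<psi>) = 0"
    by (rule convex_curve_null[OF s \<psi> sum F(1)]) (use ab in simp)
  ultimately show ?thesis by simp
qed

text \<open>The reflection y \<mapsto> -y is an isometry, preserves approximability and makes the
  arc convex.\<close>

lemma concave_arc_null:
  assumes s: "1/2 < s" "s < 1" and \<psi>: "approximating_function \<psi>"
    and sum: "summable (\<lambda>t. real (Suc t) powr (1 - s) * \<psi> (real (Suc t)) powr (s + 1))"
    and ab: "a < b" and A: "1 \<le> A"
    and f: "\<And>t. t \<in> {a..b} \<Longrightarrow> (f has_real_derivative g t) (at t)"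
    and g: "\<And>t. t \<in> {a..b} \<Longrightarrow> (g has_real_derivative h t) (at t)"
    and h: "\<And>t. t \<in> {a..b} \<Longrightarrow> 1 / A \<le> - h t \<and> - h t \<le> A"
  shows "hausdorff_content s (graph_curve {a..b} f \<inter> simul_approximable \<psi>) = 0"
proof -
  define E where "E = graph_curve {a..b} (\<lambda>x. - f x) \<inter> simul_approximable \<psi>"
  have "hausdorff_content s E = 0"
    unfolding E_def
    by (rule convex_arc_null[OF s \<psi> sum ab A, where g = "\<lambda>x. - g x" and h = "\<lambda>x. - h x"])
      (use f g h in \<open>auto intro: DERIV_minus\<close>)
  then have "hausdorff_content s ((\<lambda>(x, y). (x, - y)) ` E) = 0"
    using s by (intro hausdorff_content_lipschitz_image_null[where C = 1]) (auto simp: dist_Pair_Pair dist_real_def power2_commute)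
  moreover have "graph_curve {a..b} f \<inter> simul_approximable \<psi> \<subseteq> (\<lambda>(x, y). (x, - y)) ` E"
  proof
    fix w assume "w \<in> graph_curve {a..b} f \<inter> simul_approximable \<psi>"
    then obtain x where x: "w = (x, f x)" "x \<in> {a..b}" "(x, f x) \<in> simul_approximable \<psi>"
      unfolding graph_curve_def by auto
    then have "(x, - f x) \<in> E" unfolding E_def graph_curve_def simul_approximable_def
      by (simp add: dist_nearest_int_minus)
    then show "w \<in> (\<lambda>(x, y). (x, - y)) ` E" using x(1) by force
  qed
  ultimately show ?thesis by (rule hausdorff_content_null_subset[rotated])
qed

lemma graph_over_null_set:
  assumes s: "0 < s" and f: "\<And>t. t \<in> {a..b} \<Longrightarrow> (f has_real_derivative g t) (at t)"
    and g: "continuous_on {a..b} g" and Z: "hausdorff_content s Z = 0"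
  shows "hausdorff_content s (graph_curve ({a..b} \<inter> Z) f) = 0"
proof -
  have "bounded (g ` {a..b})" using g by (intro compact_imp_bounded compact_continuous_image) auto
  then obtain B where B: "0 < B" "\<And>t. t \<in> {a..b} \<Longrightarrow> \<bar>g t\<bar> \<le> B"
    unfolding bounded_pos by auto
  show ?thesis
    unfolding graph_curve_image
  proof (rule hausdorff_content_lipschitz_image_null[where C = "1 + B"])
    fix x y assume xy: "x \<in> {a..b} \<inter> Z" "y \<in> {a..b} \<inter> Z"
    have "norm (f x - f y) \<le> B * norm (x - y)"
    proof (rule field_differentiable_bound[where S = "{a..b}" and f' = g])
      fix t assume "t \<in> {a..b}"
      then show "(f has_field_derivative g t) (at t within {a..b})" by (intro has_field_derivative_at_within[OF f])
    qed (use xy B in auto)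
    moreover have "dist (x, f x) (y, f y) \<le> \<bar>x - y\<bar> + \<bar>f x - f y\<bar>"
      unfolding dist_Pair_Pair dist_real_def
      by (rule sqrt_sum_squares_le_sum_abs[of "\<bar>x - y\<bar>" "\<bar>f x - f y\<bar>", simplified abs_abs])
    ultimately show "dist (x, f x) (y, f y) \<le> (1 + B) * dist x y" by (simp add: dist_real_def distrib_right)
  next
    show "hausdorff_content s ({a..b} \<inter> Z) = 0" by (rule hausdorff_content_null_subset[OF _ Z]) simp
  qed (use s B in auto)
qed

text \<open>At the endpoints belonging to I the derivatives are only one-sided; being finitely many,
  these points can be discarded as a null set.\<close>

lemma finite_interval_minus_interior:
  fixes I :: "real set"
  assumes "is_interval I"
  shows "finite (I - interior I)"
proof (rule finite_subset)
  let ?L = "{x \<in> I. \<forall>y\<in>I. x \<le> y}" and ?R = "{x \<in> I. \<forall>y\<in>I. y \<le> x}"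
  show "I - interior I \<subseteq> ?L \<union> ?R"
  proof
    fix x assume x: "x \<in> I - interior I"
    show "x \<in> ?L \<union> ?R"
    proof (rule ccontr)
      assume "x \<notin> ?L \<union> ?R"
      then obtain y z where yz: "y \<in> I" "y < x" "z \<in> I" "x < z" using x by force
      then have "{y<..<z} \<subseteq> I" using assms unfolding is_interval_1 by (meson greaterThanLessThan_iff less_imp_le subsetI)
      then have "x \<in> interior I" using yz by (intro interiorI[of "{y<..<z}"]) auto
      with x show False by simp
    qed
  qed
  have "finite ?L"
  proof (cases "?L = {}")
    case False
    then obtain z where "z \<in> ?L" by blast
    then have "?L \<subseteq> {z}" by (auto intro: antisym)
    then show ?thesis by (rule finite_subset) simp
  qed (simp only: finite.emptyI)
  moreover have "finite ?R"
  proof (cases "?R = {}")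
    case False
    then obtain z where "z \<in> ?R" by blast
    then have "?R \<subseteq> {z}" by (auto intro: antisym)
    then show ?thesis by (rule finite_subset) simp
  qed (simp only: finite.emptyI)
  ultimately show "finite (?L \<union> ?R)" by simp
qed

lemma has_real_derivative_deriv_within:
  assumes "deriv_within I j f differentiable_on I" "x \<in> interior I"
  shows "(deriv_within I j f has_real_derivative deriv_within I (Suc j) f x) (at x)"
proof -
  have at: "at x within I = at x" using assms(2) by (rule at_within_interior)
  have "deriv_within I j f differentiable (at x within I)"
    using assms interior_subset unfolding differentiable_on_def by blast
  then have "(deriv_within I j f has_vector_derivative vector_derivative (deriv_within I j f) (at x)) (at x)"
    unfolding at using vector_derivative_works by blast
  moreover have "deriv_within I (Suc j) f x = vector_derivative (deriv_within I j f) (at x)"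
    unfolding deriv_within_def by (simp add: at)
  ultimately show ?thesis unfolding has_real_derivative_iff_has_vector_derivative by simp
qed

theorem theorem1p7:
  fixes s :: real and \<psi> f :: "real \<Rightarrow> real" and I :: "real set"
  assumes "1/2 < s" and "s < 1"
    and "approximating_function \<psi>"
    and "is_interval I"
    and "C_k_on 3 I f"
    and "hausdorff_dim {x \<in> I. deriv_within I 2 f x = 0} \<le> ennreal (1/2)"
    and "summable (\<lambda>t. real (Suc t) powr (1 - s) * \<psi> (real (Suc t)) powr (s + 1))"
  shows "hausdorff_measure s (graph_curve I f \<inter> simul_approximable \<psi>) = 0"
proof -
  have s0: "0 < s" using assms(1) by simp
  define J where "J = interior I"
  define g h where "g = deriv_within I 1 f" and "h = deriv_within I 2 f"
  have f0: "f = deriv_within I 0 f" unfolding deriv_within_def by simp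
  have diff: "deriv_within I 0 f differentiable_on I" "deriv_within I 1 f differentiable_on I" "h differentiable_on I"
    using assms(5) unfolding C_k_on_def h_def by auto
  have df: "(f has_real_derivative g x) (at x)" if "x \<in> J" for x
    using has_real_derivative_deriv_within[OF diff(1)] that f0 unfolding J_def g_def by simp
  have dg: "(g has_real_derivative h x) (at x)" if "x \<in> J" for x
    using has_real_derivative_deriv_within[OF diff(2)] that unfolding J_def g_def h_def by (simp add: numeral_2_eq_2)
  have ch: "isCont h x" if "x \<in> J" for x
    using differentiable_imp_continuous_on[OF diff(3)] that continuous_on_interior unfolding J_def by blast
  define S where "S = simul_approximable \<psi>"
  define Z where "Z = {x \<in> I. h x = 0}"
  have Z: "hausdorff_content s Z = 0"
    using hausdorff_content_eq_0_if_dim[of Z "1/2" s] assms(1,6) unfolding Z_def h_def by simp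
  \<comment> \<open>Rational endpoints keep the families of arcs countable, so that countable unions
    of null sets suffice.\<close>
  define P where "P = {(a, b). a \<in> \<rat> \<and> b \<in> \<rat> \<and> a < b \<and> {a..b} \<subseteq> J}"
  define R where "R = {(a, b) \<in> P. \<exists>A\<ge>1. (\<forall>t\<in>{a..b}. 1 / A \<le> h t \<and> h t \<le> A) \<or> (\<forall>t\<in>{a..b}. 1 / A \<le> - h t \<and> - h t \<le> A)}"
  have "P \<subseteq> \<rat> \<times> \<rat>" unfolding P_def by auto
  then have cP: "countable P" by (rule countable_subset) (simp add: countable_rat)
  have cR: "countable R" by (rule countable_subset[OF _ cP]) (auto simp: R_def)
  have end_null: "hausdorff_content s (\<Union>x\<in>I - J. {(x, f x)}) = 0"
    using finite_interval_minus_interior[OF assms(4)] s0 unfolding J_def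
    by (intro hausdorff_content_countable_null hausdorff_content_singleton countable_finite)
  have Z_null: "hausdorff_content s (\<Union>p\<in>P. graph_curve ({fst p..snd p} \<inter> Z) f) = 0"
  proof (rule hausdorff_content_countable_null[OF cP])
    fix p assume "p \<in> P"
    then have sub: "{fst p..snd p} \<subseteq> J" unfolding P_def by auto
    show "hausdorff_content s (graph_curve ({fst p..snd p} \<inter> Z) f) = 0"
    proof (rule graph_over_null_set[OF s0 _ _ Z])
      show "continuous_on {fst p..snd p} g"
        using sub dg by (meson DERIV_continuous continuous_at_imp_continuous_on subsetD)
    qed (use sub df in blast)
  qed
  have R_null: "hausdorff_content s (\<Union>p\<in>R. graph_curve {fst p..snd p} f \<inter> S) = 0"
  proof (rule hausdorff_content_countable_null[OF cR])
    fix p assume "p \<in> R"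
    then obtain a b A where p: "p = (a, b)" "a < b" "{a..b} \<subseteq> J" "1 \<le> A"
      "(\<forall>t\<in>{a..b}. 1 / A \<le> h t \<and> h t \<le> A) \<or> (\<forall>t\<in>{a..b}. 1 / A \<le> - h t \<and> - h t \<le> A)"
      unfolding R_def P_def by auto
    have d: "(f has_real_derivative g t) (at t)" "(g has_real_derivative h t) (at t)" if "t \<in> {a..b}" for t
      using that p(3) df dg by auto
    from p(5) show "hausdorff_content s (graph_curve {fst p..snd p} f \<inter> S) = 0"
    proof
      assume "\<forall>t\<in>{a..b}. 1 / A \<le> h t \<and> h t \<le> A"
      then show ?thesis unfolding p(1) S_def fst_conv snd_conv
        by (intro convex_arc_null[OF assms(1,2,3,7) p(2,4) d]) auto
    next
      assume "\<forall>t\<in>{a..b}. 1 / A \<le> - h t \<and> - h t \<le> A"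
      then show ?thesis unfolding p(1) S_def fst_conv snd_conv
        by (intro concave_arc_null[OF assms(1,2,3,7) p(2,4) d]) auto
    qed
  qed
  have local: "\<exists>a b. (a, b) \<in> P \<and> a < x \<and> x < b \<and> (\<forall>t\<in>{a..b}. \<bar>h t - h x\<bar> < e)"
    if x: "x \<in> J" and e: "0 < e" for x e
  proof -
    obtain r1 where r1: "0 < r1" "ball x r1 \<subseteq> J" using x open_contains_ball[of J] unfolding J_def by auto
    obtain r2 where r2: "0 < r2" "\<And>t. dist t x < r2 \<Longrightarrow> dist (h t) (h x) < e"
      using ch[OF x] e unfolding continuous_at_eps_delta by blast
    define r where "r = min r1 r2"
    have r: "0 < r" unfolding r_def using r1 r2 by simp
    obtain a where a: "a \<in> \<rat>" "x - r < a" "a < x" using Rats_dense_in_real[of "x - r" x] r by auto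
    obtain b where b: "b \<in> \<rat>" "x < b" "b < x + r" using Rats_dense_in_real[of x "x + r"] r by auto
    have in_r: "dist t x < r" if "t \<in> {a..b}" for t using that a b by (auto simp: dist_real_def abs_less_iff)
    have "{a..b} \<subseteq> J"
    proof
      fix t assume "t \<in> {a..b}"
      then have "t \<in> ball x r1" using in_r[of t] unfolding r_def by (simp add: dist_commute)
      then show "t \<in> J" using r1(2) by blast
    qed
    then have "(a, b) \<in> P" unfolding P_def using a b by simp
    moreover have "\<forall>t\<in>{a..b}. \<bar>h t - h x\<bar> < e" using in_r r2(2) unfolding r_def by (simp add: dist_real_def)
    ultimately show ?thesis using a(3) b(2) by (intro exI[of _ a] exI[of _ b] conjI)
  qed
  have "graph_curve I f \<inter> S \<subseteq> (\<Union>x\<in>I - J. {(x, f x)}) \<union> ((\<Union>p\<in>P. graph_curve ({fst p..snd p} \<inter> Z) f)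
    \<union> (\<Union>p\<in>R. graph_curve {fst p..snd p} f \<inter> S))"
  proof
    fix w assume w: "w \<in> graph_curve I f \<inter> S"
    then obtain x where x: "w = (x, f x)" "x \<in> I" unfolding graph_curve_def by auto
    show "w \<in> (\<Union>x\<in>I - J. {(x, f x)}) \<union> ((\<Union>p\<in>P. graph_curve ({fst p..snd p} \<inter> Z) f)
      \<union> (\<Union>p\<in>R. graph_curve {fst p..snd p} f \<inter> S))"
    proof (cases "x \<in> J")
      case False
      then show ?thesis using x by auto
    next
      case True
      show ?thesis
      proof (cases "h x = 0")
        case hx: True
        obtain a b where ab: "(a, b) \<in> P" "a < x" "x < b" using local[OF True zero_less_one] by blast
        have "w \<in> graph_curve ({fst (a, b)..snd (a, b)} \<inter> Z) f"
          unfolding graph_curve_image Z_def using ab x hx by auto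
        then show ?thesis using ab(1) by blast
      next
        case hx: False
        then have "0 < \<bar>h x\<bar> / 2" by simp
        from local[OF True this] obtain a b where ab: "(a, b) \<in> P" "a < x" "x < b"
          "\<And>t. t \<in> {a..b} \<Longrightarrow> \<bar>h t - h x\<bar> < \<bar>h x\<bar> / 2" by blast
        \<comment> \<open>On the chosen arc h keeps the sign of h x, and |h| stays between |h x| / 2
          and 2 |h x|; \<open>A\<close> is large enough for both bounds.\<close>
        define A where "A = max 1 (max (2 / \<bar>h x\<bar>) (2 * \<bar>h x\<bar>))"
        have A: "1 \<le> A" "2 / \<bar>h x\<bar> \<le> A" "2 * \<bar>h x\<bar> \<le> A" unfolding A_def by auto
        have "1 / A \<le> \<bar>h x\<bar> / 2" using A(1,2) hx by (simp add: field_simps)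
        then have "(\<forall>t\<in>{a..b}. 1 / A \<le> h t \<and> h t \<le> A) \<or> (\<forall>t\<in>{a..b}. 1 / A \<le> - h t \<and> - h t \<le> A)"
        proof (cases "0 < h x")
          case True
          have "1 / A \<le> h t \<and> h t \<le> A" if "t \<in> {a..b}" for t
            using ab(4)[OF that] \<open>1 / A \<le> \<bar>h x\<bar> / 2\<close> A(3) True by linarith
          then show ?thesis by blast
        next
          case False
          have "1 / A \<le> - h t \<and> - h t \<le> A" if "t \<in> {a..b}" for t
            using ab(4)[OF that] \<open>1 / A \<le> \<bar>h x\<bar> / 2\<close> A(3) False hx by linarith
          then show ?thesis by blast
        qed
        then have "(a, b) \<in> R" unfolding R_def using ab(1) A(1) by auto
        moreover have "w \<in> graph_curve {fst (a, b)..snd (a, b)} f \<inter> S"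
          using w ab x unfolding graph_curve_image by auto
        ultimately show ?thesis by blast
      qed
    qed
  qed
  moreover have "hausdorff_content s ((\<Union>x\<in>I - J. {(x, f x)}) \<union> ((\<Union>p\<in>P. graph_curve ({fst p..snd p} \<inter> Z) f)
    \<union> (\<Union>p\<in>R. graph_curve {fst p..snd p} f \<inter> S))) = 0"
  proof -
    have un: "hausdorff_content s (A \<union> B) = 0" if "hausdorff_content s A = 0" "hausdorff_content s B = 0" for A B :: "(real \<times> real) set"
      using hausdorff_content_Un[of s A B] that by simp
    show ?thesis by (intro un end_null Z_null R_null)
  qed
  ultimately have "hausdorff_content s (graph_curve I f \<inter> S) = 0" by (rule hausdorff_content_null_subset)
  then show ?thesis unfolding S_def by (rule hausdorff_measure_eq_0_if_content[OF s0])
qed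

end
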